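(* Let $\mathcal{C}$ be the Cayley algebra over an algebraically closed field $\mathbb{F}$ of characteristic not two, let $G$ be an abelian group and let $\Gamma:\mathcal{C}=\bigoplus_{g\in G}\mathcal{C}_g$ be a $G$-grading of $(\mathcal{C},\{...\})$, where $\{xyz\}=(x\bar y)z$. Then $\Gamma$ is isomorphic to one of the following gradings: (1) $\Gamma^{\mathcal{C}}(G,\alpha)$, for a group homomorphism $\alpha:\mathbb{Z}^3\to G$; (2) $\Gamma^{\mathcal{C}}(G,H)$, for an elementary $2$-subgroup $H$ of $G$ of rank $3$; (3) $\Gamma^{\mathcal{C}}(G,H,K)$, for an elementary $2$-subgroup $H$ of $G$ of rank $4$ and a subgroup $K$ of $H$ of index $2$. Gradings in different items are not isomorphic, and: (1') $\Gamma^{\mathcal{C}}(G,\alpha)$ and $\Gamma^{\mathcal{C}}(G,\alpha')$ are isomorphic if and only if there is an element $\omega$ in the Weyl group $W(\Gamma^{\mathcal{C}}_{\mathrm{Cartan}})$ such that $\alpha'=\alpha\omega$; (2') $\Gamma^{\mathcal{C}}(G,H)$ and $\Gamma^{\mathcal{C}}(G,H')$ are isomorphic if and only if $H=H'$; (3') $\Gamma^{\mathcal{C}}(G,H,K)$ and $\Gamma^{\mathcal{C}}(G,H',K')$ are isomorphic if and only if $H=H'$ and $K=K'$.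
   Context: A Cayley algebra is an eight-dimensional unital nonassociative algebra with a nondegenerate multiplicative quadratic form $n$ (norm); over an algebraically closed field it is unique up to isomorphism. $n(x,y)=n(x+y)-n(x)-n(y)$, $\bar x=n(x,1)1-x$, $\{xyz\}=(x\bar y)z$. $\mathrm{Aut}(\mathcal{C},\{...\})$ is the group of linear automorphisms $\varphi$ with $\varphi(\{xyz\})=\{\varphi(x)\varphi(y)\varphi(z)\}$; it coincides with the automorphism group of the $3$-fold cross product $X_1^{\mathcal{C}}(x,y,z)=(x\bar y)z-\tfrac12 n(x,y)z-\tfrac12 n(y,z)x+\tfrac12 n(x,z)y$. A $G$-grading on $(\mathcal{C},\{...\})$ is a vector space decomposition $\mathcal{C}=\bigoplus_{g\in G}\mathcal{C}_g$ with $\{\mathcal{C}_{g_1}\mathcal{C}_{g_2}\mathcal{C}_{g_3}\}\subseteq\mathcal{C}_{g_1g_2g_3}$; $G$-gradings are isomorphic if some $\varphi\in\mathrm{Aut}(\mathcal{C},\{...\})$ maps the component of degree $g$ of the first onto the component of degree $g$ of the second, for all $g\in G$. Standard basis $\{e_1,e_2,u_1,u_2,u_3,v_1,v_2,v_3\}$ of $\mathcal{C}$: $e_1,e_2$ are orthogonal idempotents ($e_i^2=e_i$, $e_1e_2=e_2e_1=0$); $e_1u_i=u_ie_2=u_i$, $e_2u_i=u_ie_1=0$; $e_2v_i=v_ie_1=v_i$, $e_1v_i=v_ie_2=0$; $u_iv_i=-e_1$, $v_iu_i=-e_2$; $u_iu_{i+1}=-u_{i+1}u_i=v_{i+2}$,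 $v_iv_{i+1}=-v_{i+1}v_i=u_{i+2}$ (indices mod $3$); all other products of basis elements are $0$. Cartan grading $\Gamma^{\mathcal{C}}_{\mathrm{Cartan}}$: the $\mathbb{Z}^3$-grading on $(\mathcal{C},\{...\})$ with $\deg(u_1)=(1,0,0)=-\deg(v_1)$, $\deg(u_2)=(0,1,0)=-\deg(v_2)$, $\deg(u_3)=(0,0,1)=-\deg(v_3)$, $\deg(e_2)=(1,1,1)=-\deg(e_1)$. Its Weyl group $W(\Gamma^{\mathcal{C}}_{\mathrm{Cartan}})$ is the quotient of the group of all $\varphi\in\mathrm{Aut}(\mathcal{C},\{...\})$ permuting the homogeneous components by the subgroup of those fixing every homogeneous component; its action on degrees extends to $\mathbb{Z}^3$ (the universal grading group), so it is identified with a subgroup of $\mathrm{GL}_3(\mathbb{Z})=\mathrm{Aut}(\mathbb{Z}^3)$. For a homomorphism $\alpha:\mathbb{Z}^3\to G$, $\Gamma^{\mathcal{C}}(G,\alpha)$ is the $G$-grading obtained by giving degree $\alpha(a)$ to every element of degree $a$ in $\Gamma^{\mathcal{C}}_{\mathrm{Cartan}}$. CD-basis $\{1,w_1,\dots,w_7\}$ of $\mathcal{C}$: $w_i^2=-1$, $w_iw_{i+1}=-w_{i+1}w_i=w_{i+3}$, cyclically in $i,i+1,i+3$ (indices mod $7$). For an elementary $2$-subgroup $H\le G$ of rank $3$ with generators $h_1,h_2,h_3$, $\Gamma^{\mathcal{C}}(G,H)$ is the grading on the algebra $\mathcal{C}$ (hence on $(\mathcal{C},\{...\})$) determined by $\deg(w_i)=h_i$,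 $i=1,2,3$ (so $\deg(1)=e$, $\deg(w_4)=h_1h_2$, $\deg(w_5)=h_2h_3$, $\deg(w_6)=h_1h_2h_3$, $\deg(w_7)=h_1h_3$); up to isomorphism it does not depend on the choice of generators. For an elementary $2$-subgroup $H\le G$ of rank $4$ and $K\le H$ of index $2$, take $h\in H\setminus K$; $\Gamma^{\mathcal{C}}(G,H,K)$ is the grading on $(\mathcal{C},\{...\})$ in which $x$ has degree $hk$ whenever $x$ has degree $k$ in $\Gamma^{\mathcal{C}}(G,K)$; up to isomorphism it does not depend on $h$. *)

theory Defs
  imports
    "HOL-Algebra.Elementary_Groups"
    "HOL-Algebra.Bij"
    "HOL-Computational_Algebra.Polynomial"
    "HOL-Library.Numeral_Type"
begin

section \<open>Cayley algebras\<close>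

record ('f, 'c) quad_algebra =
  vscale :: "'f \<Rightarrow> 'c \<Rightarrow> 'c" (infixr \<open>\<bullet>\<index>\<close> 75)
  vprod :: "'c \<Rightarrow> 'c \<Rightarrow> 'c" (infixl \<open>\<star>\<index>\<close> 70)
  vunit :: "'c"
  vnorm :: "'c \<Rightarrow> 'f"

definition polar :: "('f::field, 'c::ab_group_add) quad_algebra \<Rightarrow> 'c \<Rightarrow> 'c \<Rightarrow> 'f" where
  "polar C x y = vnorm C (x + y) - vnorm C x - vnorm C y"

locale cayley_algebra = vector_space "vscale C"
  for C :: "('f::field, 'c::ab_group_add) quad_algebra" +
  assumes dim_8: "dim (UNIV :: 'c set) = 8"
    and prod_linear_left: "Vector_Spaces.linear (vscale C) (vscale C) (\<lambda>x. x \<star>\<^bsub>C\<^esub> y)"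
    and prod_linear_right: "Vector_Spaces.linear (vscale C) (vscale C) (\<lambda>y. x \<star>\<^bsub>C\<^esub> y)"
    and unit_left: "vunit C \<star>\<^bsub>C\<^esub> x = x"
    and unit_right: "x \<star>\<^bsub>C\<^esub> vunit C = x"
    and norm_scale: "vnorm C (a \<bullet>\<^bsub>C\<^esub> x) = a\<^sup>2 * vnorm C x"
    and polar_linear_left: "Vector_Spaces.linear (vscale C) (*) (\<lambda>x. polar C x y)"
    and polar_linear_right: "Vector_Spaces.linear (vscale C) (*) (\<lambda>y. polar C x y)"
    and norm_mult: "vnorm C (x \<star>\<^bsub>C\<^esub> y) = vnorm C x * vnorm C y"
    and norm_nondegenerate: "(\<And>y. polar C x y = 0) \<Longrightarrow> x = 0"

definition bar :: "('f::field, 'c::ab_group_add) quad_algebra \<Rightarrow> 'c \<Rightarrow> 'c" where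
  "bar C x = polar C x (vunit C) \<bullet>\<^bsub>C\<^esub> vunit C - x"

definition triple :: "('f::field, 'c::ab_group_add) quad_algebra \<Rightarrow> 'c \<Rightarrow> 'c \<Rightarrow> 'c \<Rightarrow> 'c" where
  "triple C x y z = (x \<star>\<^bsub>C\<^esub> bar C y) \<star>\<^bsub>C\<^esub> z"

definition triple_aut :: "('f::field, 'c::ab_group_add) quad_algebra \<Rightarrow> ('c \<Rightarrow> 'c) set" where
  "triple_aut C = {\<phi>. Vector_Spaces.linear (vscale C) (vscale C) \<phi> \<and> bij \<phi> \<and>
     (\<forall>x y z. \<phi> (triple C x y z) = triple C (\<phi> x) (\<phi> y) (\<phi> z))}"

section \<open>Gradings on the triple system\<close>

text \<open>A family of subspaces indexed by the carrier of \<open>G\<close>; only its values on the carrier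
  matter. The unique finitely supported decomposition says that the sum is direct and is everything.\<close>

definition is_grading ::
  "('f::field, 'c::ab_group_add) quad_algebra \<Rightarrow> ('g, 'm) monoid_scheme \<Rightarrow> ('g \<Rightarrow> 'c set) \<Rightarrow> bool" where
  "is_grading C G \<Gamma> \<longleftrightarrow>
     (\<forall>g\<in>carrier G. module.subspace (vscale C) (\<Gamma> g)) \<and>
     (\<forall>x. \<exists>!f. finite {g. f g \<noteq> 0} \<and> (\<forall>g\<in>carrier G. f g \<in> \<Gamma> g) \<and>
             (\<forall>g. g \<notin> carrier G \<longrightarrow> f g = 0) \<and> x = (\<Sum>g | f g \<noteq> 0. f g)) \<and>
     (\<forall>g1\<in>carrier G. \<forall>g2\<in>carrier G. \<forall>g3\<in>carrier G.
        \<forall>x\<in>\<Gamma> g1. \<forall>y\<in>\<Gamma> g2. \<forall>z\<in>\<Gamma> g3.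
          triple C x y z \<in> \<Gamma> (g1 \<otimes>\<^bsub>G\<^esub> g2 \<otimes>\<^bsub>G\<^esub> g3))"

definition grading_iso ::
  "('f::field, 'c::ab_group_add) quad_algebra \<Rightarrow> ('g, 'm) monoid_scheme \<Rightarrow>
    ('g \<Rightarrow> 'c set) \<Rightarrow> ('g \<Rightarrow> 'c set) \<Rightarrow> bool" where
  "grading_iso C G \<Gamma> \<Delta> \<longleftrightarrow> (\<exists>\<phi>\<in>triple_aut C. \<forall>g\<in>carrier G. \<phi> ` \<Gamma> g = \<Delta> g)"

definition homogeneous_components ::
  "('g, 'm) monoid_scheme \<Rightarrow> ('g \<Rightarrow> 'c::ab_group_add set) \<Rightarrow> 'c set set" where
  "homogeneous_components G \<Gamma> = {\<Gamma> g | g. g \<in> carrier G \<and> \<Gamma> g \<noteq> {0}}"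

definition grading_Aut ::
  "('f::field, 'c::ab_group_add) quad_algebra \<Rightarrow> ('g, 'm) monoid_scheme \<Rightarrow>
    ('g \<Rightarrow> 'c set) \<Rightarrow> ('c \<Rightarrow> 'c) set" where
  "grading_Aut C G \<Gamma> = {\<phi> \<in> triple_aut C.
     bij_betw ((`) \<phi>) (homogeneous_components G \<Gamma>) (homogeneous_components G \<Gamma>)}"

definition grading_Stab ::
  "('f::field, 'c::ab_group_add) quad_algebra \<Rightarrow> ('g, 'm) monoid_scheme \<Rightarrow>
    ('g \<Rightarrow> 'c set) \<Rightarrow> ('c \<Rightarrow> 'c) set" where
  "grading_Stab C G \<Gamma> = {\<phi> \<in> triple_aut C. \<forall>D\<in>homogeneous_components G \<Gamma>. \<phi> ` D = D}"

definition weyl_group ::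
  "('f::field, 'c::ab_group_add) quad_algebra \<Rightarrow> ('g, 'm) monoid_scheme \<Rightarrow>
    ('g \<Rightarrow> 'c set) \<Rightarrow> ('c \<Rightarrow> 'c) set monoid" where
  "weyl_group C G \<Gamma> =
     (BijGroup (UNIV :: 'c set) \<lparr>carrier := grading_Aut C G \<Gamma>\<rparr>) Mod grading_Stab C G \<Gamma>"

text \<open>The Weyl group seen inside the automorphism group of the grading group: those automorphisms
  \<open>\<omega>\<close> which, on the support, are the action on degrees of some element of the Weyl group. This
  realizes the Weyl group faithfully when the support generates \<open>G\<close> and every action on degrees
  extends to \<open>G\<close>, as for the Cartan grading below.\<close>

definition weyl_on_degrees ::
  "('f::field, 'c::ab_group_add) quad_algebra \<Rightarrow> ('g, 'm) monoid_scheme \<Rightarrow>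
    ('g \<Rightarrow> 'c set) \<Rightarrow> ('g \<Rightarrow> 'g) set" where
  "weyl_on_degrees C G \<Gamma> = {\<omega> \<in> carrier (AutoGroup G).
     \<exists>D\<in>carrier (weyl_group C G \<Gamma>). \<forall>\<phi>\<in>D.
       \<forall>g\<in>carrier G. \<Gamma> g \<noteq> {0} \<longrightarrow> \<phi> ` \<Gamma> g = \<Gamma> (\<omega> g)}"

definition induced_grading ::
  "('f::field, 'c::ab_group_add) quad_algebra \<Rightarrow> ('a, 'm) monoid_scheme \<Rightarrow>
    ('a \<Rightarrow> 'g) \<Rightarrow> ('a \<Rightarrow> 'c set) \<Rightarrow> 'g \<Rightarrow> 'c set" where
  "induced_grading C A \<alpha> \<Gamma> g = module.span (vscale C) (\<Union>a\<in>{a \<in> carrier A. \<alpha> a = g}. \<Gamma> a)"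

section \<open>The Cartan grading\<close>

text \<open>Indices modulo 3 (resp. 7) are elements of the type \<open>3\<close> (resp. \<open>7\<close>), whose arithmetic is
  modular; so \<open>U 3\<close> and \<open>U 0\<close> are the same.\<close>

datatype std_index = E1 | E2 | U 3 | V 3

definition standard_basis ::
  "('f::field, 'c::ab_group_add) quad_algebra \<Rightarrow> (std_index \<Rightarrow> 'c) \<Rightarrow> bool" where
  "standard_basis C b \<longleftrightarrow>
     inj b \<and> \<not> module.dependent (vscale C) (range b) \<and> module.span (vscale C) (range b) = UNIV \<and>
     b E1 \<star>\<^bsub>C\<^esub> b E1 = b E1 \<and> b E2 \<star>\<^bsub>C\<^esub> b E2 = b E2 \<and>
     b E1 \<star>\<^bsub>C\<^esub> b E2 = 0 \<and> b E2 \<star>\<^bsub>C\<^esub> b E1 = 0 \<and>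
     (\<forall>i. b E1 \<star>\<^bsub>C\<^esub> b (U i) = b (U i) \<and> b (U i) \<star>\<^bsub>C\<^esub> b E2 = b (U i) \<and>
          b E2 \<star>\<^bsub>C\<^esub> b (U i) = 0 \<and> b (U i) \<star>\<^bsub>C\<^esub> b E1 = 0 \<and>
          b E2 \<star>\<^bsub>C\<^esub> b (V i) = b (V i) \<and> b (V i) \<star>\<^bsub>C\<^esub> b E1 = b (V i) \<and>
          b E1 \<star>\<^bsub>C\<^esub> b (V i) = 0 \<and> b (V i) \<star>\<^bsub>C\<^esub> b E2 = 0 \<and>
          b (U i) \<star>\<^bsub>C\<^esub> b (V i) = - b E1 \<and> b (V i) \<star>\<^bsub>C\<^esub> b (U i) = - b E2 \<and>
          b (U i) \<star>\<^bsub>C\<^esub> b (U i) = 0 \<and> b (V i) \<star>\<^bsub>C\<^esub> b (V i) = 0 \<and>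
          b (U i) \<star>\<^bsub>C\<^esub> b (U (i + 1)) = b (V (i + 2)) \<and>
          b (U (i + 1)) \<star>\<^bsub>C\<^esub> b (U i) = - b (V (i + 2)) \<and>
          b (V i) \<star>\<^bsub>C\<^esub> b (V (i + 1)) = b (U (i + 2)) \<and>
          b (V (i + 1)) \<star>\<^bsub>C\<^esub> b (V i) = - b (U (i + 2))) \<and>
     (\<forall>i j. i \<noteq> j \<longrightarrow> b (U i) \<star>\<^bsub>C\<^esub> b (V j) = 0 \<and> b (V i) \<star>\<^bsub>C\<^esub> b (U j) = 0)"

definition Z3 :: "(int \<times> int \<times> int) monoid" where
  "Z3 = integer_group \<times>\<times> integer_group \<times>\<times> integer_group"

fun std_degree :: "std_index \<Rightarrow> int \<times> int \<times> int" where
  "std_degree E1 = (-1, -1, -1)"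
| "std_degree E2 = (1, 1, 1)"
| "std_degree (U i) = (if i = 1 then (1, 0, 0) else if i = 2 then (0, 1, 0) else (0, 0, 1))"
| "std_degree (V i) = (if i = 1 then (-1, 0, 0) else if i = 2 then (0, -1, 0) else (0, 0, -1))"

definition cartan_grading ::
  "('f::field, 'c::ab_group_add) quad_algebra \<Rightarrow> (std_index \<Rightarrow> 'c) \<Rightarrow> int \<times> int \<times> int \<Rightarrow> 'c set" where
  "cartan_grading C b a = module.span (vscale C) (b ` {k. std_degree k = a})"

definition Gamma_alpha ::
  "('f::field, 'c::ab_group_add) quad_algebra \<Rightarrow> (std_index \<Rightarrow> 'c) \<Rightarrow>
    (int \<times> int \<times> int \<Rightarrow> 'g) \<Rightarrow> 'g \<Rightarrow> 'c set" where
  "Gamma_alpha C b \<alpha> = induced_grading C Z3 \<alpha> (cartan_grading C b)"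

section \<open>The Cayley-Dickson gradings\<close>

definition cd_basis :: "('f::field, 'c::ab_group_add) quad_algebra \<Rightarrow> (7 \<Rightarrow> 'c) \<Rightarrow> bool" where
  "cd_basis C w \<longleftrightarrow>
     inj w \<and> vunit C \<notin> range w \<and>
     \<not> module.dependent (vscale C) (insert (vunit C) (range w)) \<and>
     module.span (vscale C) (insert (vunit C) (range w)) = UNIV \<and>
     (\<forall>i. w i \<star>\<^bsub>C\<^esub> w i = - vunit C \<and>
          w i \<star>\<^bsub>C\<^esub> w (i + 1) = w (i + 3) \<and> w (i + 1) \<star>\<^bsub>C\<^esub> w i = - w (i + 3) \<and>
          w (i + 1) \<star>\<^bsub>C\<^esub> w (i + 3) = w i \<and> w (i + 3) \<star>\<^bsub>C\<^esub> w (i + 1) = - w i \<and>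
          w (i + 3) \<star>\<^bsub>C\<^esub> w i = w (i + 1) \<and> w i \<star>\<^bsub>C\<^esub> w (i + 3) = - w (i + 1))"

definition cd_degree :: "('g, 'm) monoid_scheme \<Rightarrow> 'g \<Rightarrow> 'g \<Rightarrow> 'g \<Rightarrow> 7 \<Rightarrow> 'g" where
  "cd_degree G h1 h2 h3 i =
     (if i = 1 then h1 else if i = 2 then h2 else if i = 3 then h3
      else if i = 4 then h1 \<otimes>\<^bsub>G\<^esub> h2 else if i = 5 then h2 \<otimes>\<^bsub>G\<^esub> h3
      else if i = 6 then h1 \<otimes>\<^bsub>G\<^esub> h2 \<otimes>\<^bsub>G\<^esub> h3 else h1 \<otimes>\<^bsub>G\<^esub> h3)"

definition cd_grading ::
  "('f::field, 'c::ab_group_add) quad_algebra \<Rightarrow> (7 \<Rightarrow> 'c) \<Rightarrow> ('g, 'm) monoid_scheme \<Rightarrow>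
    'g \<Rightarrow> 'g \<Rightarrow> 'g \<Rightarrow> 'g \<Rightarrow> 'c set" where
  "cd_grading C w G h1 h2 h3 g =
     module.span (vscale C)
       ((if g = \<one>\<^bsub>G\<^esub> then {vunit C} else {}) \<union> w ` {i. cd_degree G h1 h2 h3 i = g})"

definition has_rank :: "('g, 'm) monoid_scheme \<Rightarrow> 'g set \<Rightarrow> nat \<Rightarrow> bool" where
  "has_rank G H r \<longleftrightarrow>
     (\<exists>S\<subseteq>H. finite S \<and> card S = r \<and> generate G S = H) \<and>
     (\<forall>S\<subseteq>H. finite S \<longrightarrow> generate G S = H \<longrightarrow> r \<le> card S)"

definition elementary_2_subgroup :: "('g, 'm) monoid_scheme \<Rightarrow> 'g set \<Rightarrow> nat \<Rightarrow> bool" where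
  "elementary_2_subgroup G H r \<longleftrightarrow>
     subgroup H G \<and> (\<forall>x\<in>H. x \<otimes>\<^bsub>G\<^esub> x = \<one>\<^bsub>G\<^esub>) \<and> has_rank G H r"

definition index_2_subgroup :: "('g, 'm) monoid_scheme \<Rightarrow> 'g set \<Rightarrow> 'g set \<Rightarrow> bool" where
  "index_2_subgroup G H K \<longleftrightarrow>
     subgroup K (G\<lparr>carrier := H\<rparr>) \<and> card (rcosets\<^bsub>G\<lparr>carrier := H\<rparr>\<^esub> K) = 2"

text \<open>The gradings attached to \<open>H\<close>, and to \<open>H\<close> and \<open>K\<close>, depend on choices (generators, and a
  coset representative) only up to isomorphism. The next two definitions collect the gradings
  arising from all choices.\<close>

definition Gamma_H ::
  "('f::field, 'c::ab_group_add) quad_algebra \<Rightarrow> (7 \<Rightarrow> 'c) \<Rightarrow> ('g, 'm) monoid_scheme \<Rightarrow>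
    'g set \<Rightarrow> ('g \<Rightarrow> 'c set) set" where
  "Gamma_H C w G H = {cd_grading C w G h1 h2 h3 | h1 h2 h3.
     {h1, h2, h3} \<subseteq> H \<and> generate G {h1, h2, h3} = H}"

definition Gamma_HK ::
  "('f::field, 'c::ab_group_add) quad_algebra \<Rightarrow> (7 \<Rightarrow> 'c) \<Rightarrow> ('g, 'm) monoid_scheme \<Rightarrow>
    'g set \<Rightarrow> 'g set \<Rightarrow> ('g \<Rightarrow> 'c set) set" where
  "Gamma_HK C w G H K = {\<lambda>g. \<Delta> (inv\<^bsub>G\<^esub> h \<otimes>\<^bsub>G\<^esub> g) | h \<Delta>. h \<in> H - K \<and> \<Delta> \<in> Gamma_H C w G K}"

end

theory Submission
  imports Defs
    "HOL-Combinatorics.Permutations"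
begin

text \<open>For \<open>c\<close> of norm 1 the product \<open>(a, b) \<mapsto> {a c b}\<close> defines a Cayley algebra with unit \<open>c\<close>, the
  same norm and the same triple product; so bases of two such isotopes with the same multiplication
  table are exchanged by an automorphism of the triple product. In a grading, components of degrees
  \<open>g\<close> and \<open>h\<close> are orthogonal unless \<open>g h = e\<close>.

  If there is a nonzero isotropic homogeneous element, it is part of a homogeneous hyperbolic pair;
  in the isotope whose unit is the sum of the pair these are orthogonal idempotents, their Peirce
  components are graded, and dual pairs in these complete a homogeneous standard basis. Otherwise
  the homogeneous components are lines of degrees of order at most 2; in the isotope at a
  homogeneous element of degree \<open>s\<close> (with \<open>s = e\<close> if possible) the grading shifted by \<open>s\<close> is an
  algebra grading with support an elementary 2-group of order 8, and three generators give a
  homogeneous Cayley-Dickson basis.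

  The supports and the existence of isotropic homogeneous elements separate the types and recover
  \<open>H\<close> and \<open>K\<close>. In the Cartan case, with \<open>\<epsilon> i\<close> the degrees of \<open>e1, u1, u2, u3\<close>, an isomorphism forces
  the multisets of the values \<open>\<alpha> (\<epsilon> i)\<close> and \<open>\<alpha>' (\<epsilon> i)\<close> to agree up to a common inversion, and every
  permutation of the \<open>\<epsilon> i\<close>, as well as the sign, comes from the Weyl group.\<close>

section \<open>Composition identities\<close>

text \<open>A grading of the triple product need not be a grading of the algebra: the unit need not
  be homogeneous, and then conjugation mixes degrees. The triple structure does not single out the
  unit, however, so a homogeneous element of norm 1, or a sum of two homogeneous elements, can take
  its place, and algebra arguments become available. The uniqueness of the Cayley algebra is not
  invoked; only multiplication tables are compared. Type (3) exists because the number of factors is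
  odd: multiplying all degrees of an algebra grading by s with s s = e changes a product of three
  degrees by s s s = s, so the triple product stays graded although the unit leaves degree e. In the
  Cartan case the obstacle is that \<alpha> may identify weights. An isomorphism then need not
  permute the basis lines and only spans of basis vectors can be followed; homomorphisms for which
  two weights of the u's cancel escape this argument and need their own.\<close>

lemma alg_closed_has_square_root:
  fixes a :: "'f::alg_closed_field"
  shows "\<exists>r. r\<^sup>2 = a"
  using nth_root_exists[of 2 a] by auto

context cayley_algebra
begin

abbreviation linear_map where
  "linear_map \<equiv> Vector_Spaces.linear (vscale C) (vscale C)"

abbreviation smult (infixr \<open>\<cdot>\<close> 75) where "smult \<equiv> vscale C"
abbreviation prd (infixl \<open>\<odot>\<close> 70) where "x \<odot> y \<equiv> x \<star>\<^bsub>C\<^esub> y"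
abbreviation unt (\<open>\<e>\<close>) where "\<e> \<equiv> vunit C"
abbreviation nrm where "nrm \<equiv> vnorm C"
abbreviation pol where "pol \<equiv> polar C"
abbreviation cj where "cj \<equiv> bar C"
abbreviation tri where "tri \<equiv> triple C"

lemma prod_add_left: "(x + y) \<odot> z = x \<odot> z + y \<odot> z"
  and prod_scale_left: "(a \<cdot> x) \<odot> z = a \<cdot> (x \<odot> z)"
  using prod_linear_left[of z] unfolding Vector_Spaces.linear_iff by auto

lemma prod_add_right: "z \<odot> (x + y) = z \<odot> x + z \<odot> y"
  and prod_scale_right: "z \<odot> (a \<cdot> x) = a \<cdot> (z \<odot> x)"
  using prod_linear_right[of z] unfolding Vector_Spaces.linear_iff by auto

lemma pol_add_left: "pol (x + y) z = pol x z + pol y z"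
  and pol_scale_left: "pol (a \<cdot> x) z = a * pol x z"
  using polar_linear_left[of z] unfolding Vector_Spaces.linear_iff by auto

lemma pol_add_right: "pol z (x + y) = pol z x + pol z y"
  and pol_scale_right: "pol z (a \<cdot> x) = a * pol z x"
  using polar_linear_right[of z] unfolding Vector_Spaces.linear_iff by auto

lemma pol_commute: "pol x y = pol y x"
  by (simp add: polar_def add.commute)

lemma prod_zero_left [simp]: "0 \<odot> x = 0"
  using prod_scale_left[of 0 0 x] by simp
lemma prod_zero_right [simp]: "x \<odot> 0 = 0"
  using prod_scale_right[of x 0 0] by simp
lemma pol_zero_left [simp]: "pol 0 x = 0"
  using pol_scale_left[of 0 0 x] by simp
lemma pol_zero_right [simp]: "pol x 0 = 0"
  using pol_scale_right[of x 0 0] by simp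
lemma prod_minus_left: "(- x) \<odot> y = - (x \<odot> y)"
  using prod_scale_left[of "-1" x y] by simp
lemma prod_minus_right: "x \<odot> (- y) = - (x \<odot> y)"
  using prod_scale_right[of x "-1" y] by simp
lemma pol_minus_left: "pol (- x) y = - pol x y"
  using pol_scale_left[of "-1" x y] by simp
lemma pol_minus_right: "pol x (- y) = - pol x y"
  using pol_scale_right[of x "-1" y] by simp
lemma prod_diff_left: "(x - y) \<odot> z = x \<odot> z - y \<odot> z"
  using prod_add_left[of x "-y" z] by (simp add: prod_minus_left)
lemma prod_diff_right: "z \<odot> (x - y) = z \<odot> x - z \<odot> y"
  using prod_add_right[of z x "-y"] by (simp add: prod_minus_right)
lemma pol_diff_left: "pol (x - y) z = pol x z - pol y z"
  using pol_add_left[of x "-y" z] by (simp add: pol_minus_left)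
lemma pol_diff_right: "pol z (x - y) = pol z x - pol z y"
  using pol_add_right[of z x "-y"] by (simp add: pol_minus_right)

lemmas bilinear_simps =
  prod_add_left prod_add_right prod_scale_left prod_scale_right prod_minus_left prod_minus_right
  prod_diff_left prod_diff_right pol_add_left pol_add_right pol_scale_left pol_scale_right
  pol_minus_left pol_minus_right pol_diff_left pol_diff_right

lemmas prod_simps =
  prod_add_left prod_add_right prod_scale_left prod_scale_right prod_minus_left prod_minus_right
  prod_diff_left prod_diff_right unit_left unit_right

lemma nrm_zero [simp]: "nrm 0 = 0"
  using norm_scale[of 0 0] by simp
lemma nrm_minus [simp]: "nrm (- x) = nrm x"
  using norm_scale[of "-1" x] by simp
lemma nrm_add: "nrm (x + y) = nrm x + nrm y + pol x y"
  by (simp add: polar_def)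
lemma nrm_diff: "nrm (x - y) = nrm x + nrm y - pol x y"
  using nrm_add[of x "-y"] by (simp add: pol_minus_right)
lemma scale_two: "2 \<cdot> x = x + x"
  by (metis one_add_one scale_left_distrib scale_one)
lemma pol_self: "pol x x = 2 * nrm x"
  using norm_scale[of 2 x] by (simp add: scale_two polar_def power2_eq_square)

lemma pol_prod_left: "pol (x \<odot> y) (x \<odot> z) = nrm x * pol y z"
proof -
  have "nrm (x \<odot> y + x \<odot> z) = nrm x * nrm (y + z)"
    by (metis norm_mult prod_add_right)
  then show ?thesis by (simp add: nrm_add norm_mult algebra_simps)
qed

lemma pol_prod_right: "pol (y \<odot> x) (z \<odot> x) = pol y z * nrm x"
proof -
  have "nrm (y \<odot> x + z \<odot> x) = nrm (y + z) * nrm x"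
    by (metis norm_mult prod_add_left)
  then show ?thesis by (simp add: nrm_add norm_mult algebra_simps)
qed

text \<open>Polarising \<open>pol_prod_left\<close> in the left factor. With one factor equal to the
  unit it becomes the adjointness of multiplication by an element and by its conjugate.\<close>

lemma pol_prod_exchange:
  "pol (x \<odot> y) (z \<odot> w) + pol (x \<odot> w) (z \<odot> y) = pol x z * pol y w"
proof -
  have "pol ((x + z) \<odot> y) ((x + z) \<odot> w) = nrm (x + z) * pol y w"
    by (rule pol_prod_left)
  then show ?thesis
    by (simp add: bilinear_simps nrm_add pol_prod_left distrib_right add.commute pol_commute[of "z \<odot> y"])
qed

lemma nondegenerate_eq:
  assumes "\<And>z. pol x z = pol y z"
  shows "x = y"
  using norm_nondegenerate[of "x - y"] assms by (simp add: pol_diff_left)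

text \<open>A nonzero n(x) can be cancelled in n(1) n(x) = n(x). Without such an x the polar form
  would vanish, and nondegeneracy would shrink the space to 0, against dimension 8.\<close>

lemma nrm_one [simp]: "nrm \<e> = 1"
proof -
  obtain x where "nrm x \<noteq> 0"
  proof (rule ccontr)
    assume "\<not> thesis"
    with that have "\<And>x. nrm x = 0" by blast
    then have "\<And>x y. pol x y = 0" by (simp add: polar_def)
    then have "x = 0" for x :: 'c using norm_nondegenerate[of x] by simp
    then have "(UNIV :: 'c set) = span {}" by auto
    then have "dim (UNIV :: 'c set) \<le> card ({} :: 'c set)" by (intro dim_le_card) auto
    with dim_8 show False by simp
  qed
  then show ?thesis using norm_mult[of \<e> x] unit_left[of x] by simp
qed

lemma one_neq_zero [simp]: "\<e> \<noteq> 0"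
  using nrm_one nrm_zero by (metis zero_neq_one)

lemma conj_eq: "cj x = pol x \<e> \<cdot> \<e> - x"
  by (simp add: bar_def)

lemma conj_add: "cj (x + y) = cj x + cj y"
  by (simp add: conj_eq pol_add_left scale_left_distrib)
lemma conj_scale: "cj (a \<cdot> x) = a \<cdot> cj x"
  by (simp add: conj_eq pol_scale_left scale_right_diff_distrib)
lemma conj_minus: "cj (- x) = - cj x"
  by (simp add: conj_eq pol_minus_left scale_minus_left)
lemma conj_diff: "cj (x - y) = cj x - cj y"
  using conj_add[of x "-y"] by (simp add: conj_minus)
lemma conj_zero [simp]: "cj 0 = 0"
  by (simp add: conj_eq)
lemma conj_one [simp]: "cj \<e> = \<e>"
  by (simp add: conj_eq pol_self scale_two)
lemma conj_conj [simp]: "cj (cj x) = x"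
  by (simp add: conj_eq conj_diff conj_scale pol_diff_left pol_scale_left pol_self
      flip: scale_left_diff_distrib scale_left_distrib)

lemma pol_conj_conj [simp]: "pol (cj x) (cj y) = pol x y"
  by (simp add: conj_eq bilinear_simps pol_self pol_commute[of \<e>] algebra_simps)
lemma nrm_conj [simp]: "nrm (cj x) = nrm x"
  unfolding conj_eq nrm_diff norm_scale
  by (simp add: pol_scale_left pol_commute[of \<e>] power2_eq_square)

lemma pol_adjoint_left: "pol (x \<odot> y) z = pol y (cj x \<odot> z)"
proof -
  have "pol (x \<odot> y) (\<e> \<odot> z) + pol (x \<odot> z) (\<e> \<odot> y) = pol x \<e> * pol y z"
    by (rule pol_prod_exchange)
  then show ?thesis
    by (simp add: unit_left conj_eq bilinear_simps pol_commute[of _ y] algebra_simps)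
qed

lemma pol_adjoint_right: "pol (x \<odot> y) z = pol x (z \<odot> cj y)"
proof -
  have "pol (x \<odot> y) (z \<odot> \<e>) + pol (x \<odot> \<e>) (z \<odot> y) = pol x z * pol y \<e>"
    by (rule pol_prod_exchange)
  then show ?thesis
    by (simp add: unit_right conj_eq bilinear_simps algebra_simps)
qed

text \<open>Adjointness moves the outer factor to the other side of the form, where multiplicativity
  produces \<open>nrm x\<close>; nondegeneracy removes the test vector. Identities of this kind, and
  their linearised forms, replace associativity throughout.\<close>

lemma conj_left_prod: "cj x \<odot> (x \<odot> y) = nrm x \<cdot> y"
proof (rule nondegenerate_eq)
  fix z
  show "pol (cj x \<odot> (x \<odot> y)) z = pol (nrm x \<cdot> y) z"
    by (simp add: pol_adjoint_left[of "cj x"] pol_prod_left pol_scale_left)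
qed

lemma conj_right_prod: "(y \<odot> x) \<odot> cj x = nrm x \<cdot> y"
proof (rule nondegenerate_eq)
  fix z
  show "pol ((y \<odot> x) \<odot> cj x) z = pol (nrm x \<cdot> y) z"
    by (simp add: pol_adjoint_right[of _ "cj x"] pol_prod_right pol_scale_left)
qed

lemma conj_right_prod': "(y \<odot> cj x) \<odot> x = nrm x \<cdot> y"
  using conj_right_prod[of _ "cj x"] by simp

lemma conj_left_prod_linearized: "cj x \<odot> (z \<odot> y) + cj z \<odot> (x \<odot> y) = pol x z \<cdot> y"
  using conj_left_prod[of "x + z" y] conj_left_prod[of x y] conj_left_prod[of z y]
  by (simp add: conj_add prod_simps nrm_add scale_left_distrib algebra_simps)

lemma conj_right_prod_linearized: "(y \<odot> x) \<odot> cj z + (y \<odot> z) \<odot> cj x = pol x z \<cdot> y"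
  using conj_right_prod[of y "x + z"] conj_right_prod[of y x] conj_right_prod[of y z]
  by (simp add: conj_add prod_simps nrm_add scale_left_distrib algebra_simps)

lemma prod_conj_self: "x \<odot> cj x = nrm x \<cdot> \<e>"
  using conj_right_prod[of \<e> x] by (simp add: unit_left)
lemma square_eq: "x \<odot> x = pol x \<e> \<cdot> x - nrm x \<cdot> \<e>"
  using prod_conj_self[of x] by (simp add: conj_eq prod_simps algebra_simps)
lemma left_alternative: "x \<odot> (x \<odot> y) = (x \<odot> x) \<odot> y"
  using conj_left_prod[of x y] by (simp add: conj_eq square_eq prod_simps algebra_simps)
lemma right_alternative: "(y \<odot> x) \<odot> x = y \<odot> (x \<odot> x)"
  using conj_right_prod[of y x] by (simp add: conj_eq square_eq prod_simps algebra_simps)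

lemma prod_conj_linearized: "x \<odot> cj y + y \<odot> cj x = pol x y \<cdot> \<e>"
  using conj_right_prod_linearized[of \<e> x y] by (simp add: unit_left)

text \<open>This identity and \<open>triple_right\<close> tie the norm to the triple product: they
  make an element of norm 1 the unit of its isotope, and this one forces triple automorphisms to
  preserve the norm.\<close>

lemma triple_left: "tri x x z = nrm x \<cdot> z"
  by (simp add: triple_def prod_conj_self prod_simps)
lemma triple_right: "tri x y y = nrm y \<cdot> x"
  by (simp add: triple_def conj_right_prod')
lemma triple_left_linearized: "tri x y z + tri y x z = pol x y \<cdot> z"
  by (metis triple_def prod_conj_linearized prod_add_left prod_scale_left unit_left)
lemma triple_right_linearized: "tri x y z + tri x z y = pol y z \<cdot> x"
  using conj_right_prod_linearized[of x "cj y" "cj z"] by (simp add: triple_def)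
lemma triple_outer: "tri x y x = pol x y \<cdot> x - nrm x \<cdot> y"
  using triple_left_linearized[of x y x] triple_right[of y x] by (simp add: algebra_simps)

lemma triple_add: "tri (x + x') y z = tri x y z + tri x' y z"
  "tri x (y + y') z = tri x y z + tri x y' z"
  "tri x y (z + z') = tri x y z + tri x y z'"
  by (simp_all add: triple_def prod_simps conj_add)
lemma triple_scale: "tri (a \<cdot> x) y z = a \<cdot> tri x y z" "tri x (a \<cdot> y) z = a \<cdot> tri x y z"
  "tri x y (a \<cdot> z) = a \<cdot> tri x y z"
  by (simp_all add: triple_def prod_simps conj_scale)
lemma triple_zero [simp]: "tri 0 y z = 0" "tri x 0 z = 0" "tri x y 0 = 0"
  by (simp_all add: triple_def)

section \<open>Dimension counts\<close>

lemma finite_basis: "\<exists>B. finite B \<and> independent B \<and> span B = UNIV \<and> card B = 8"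
proof -
  obtain B where B: "independent B" "(UNIV :: 'c set) \<subseteq> span B" "card B = dim (UNIV :: 'c set)"
    by (rule basis_exists[of UNIV])
  then have "card B = 8" using dim_8 by simp
  then have "finite B" by (intro card_ge_0_finite) simp
  with B \<open>card B = 8\<close> show ?thesis by auto
qed

lemma spanning_if_independent:
  assumes "independent B" "finite B" "card B = 8"
  shows "span B = UNIV"
proof -
  obtain B0 where B0: "finite B0" "independent B0" "span B0 = UNIV"
    using finite_basis by blast
  then interpret F: finite_dimensional_vector_space "vscale C" B0
    by unfold_locales auto
  show ?thesis
    using F.card_ge_dim_independent[of B UNIV] assms dim_8 by auto
qed

lemma card_spanning: "finite B \<Longrightarrow> span B = UNIV \<Longrightarrow> 8 \<le> card B"
  using dim_le_card[of UNIV B] dim_8 by simp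

lemma linear_inj_imp_bij:
  assumes "linear_map f" "inj f"
  shows "bij f"
proof -
  obtain B0 where B0: "finite B0" "independent B0" "span B0 = UNIV"
    using finite_basis by blast
  then interpret F: finite_dimensional_vector_space "vscale C" B0
    by unfold_locales auto
  show ?thesis using F.linear_inj_imp_surj assms by (simp add: bij_def)
qed

lemma isotropic_neq_zeroE:
  assumes "x \<noteq> 0"
  obtains y where "pol x y \<noteq> 0"
  using norm_nondegenerate assms by blast

end

section \<open>Isotopes with the same triple product\<close>

text \<open>For c of norm 1 the conjugate of c is its inverse, so the product is (a c^-1) b and c is
  neutral on both sides.\<close>

definition isotope :: "('f::field, 'c::ab_group_add) quad_algebra \<Rightarrow> 'c \<Rightarrow> ('f, 'c) quad_algebra" where
  "isotope C c = C\<lparr>vprod := \<lambda>a b. (a \<star>\<^bsub>C\<^esub> bar C c) \<star>\<^bsub>C\<^esub> b, vunit := c\<rparr>"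

lemma isotope_simps [simp]:
  "vscale (isotope C c) = vscale C" "vunit (isotope C c) = c" "vnorm (isotope C c) = vnorm C"
  "polar (isotope C c) = polar C"
  by (auto simp: isotope_def polar_def fun_eq_iff)

lemma isotope_prod: "x \<star>\<^bsub>isotope C c\<^esub> y = triple C x c y"
  by (simp add: isotope_def triple_def)

context cayley_algebra
begin

lemma cayley_algebra_isotope:
  assumes c: "nrm c = 1"
  shows "cayley_algebra (isotope C c)"
proof -
  have vs: "vector_space (vscale C)" by unfold_locales
  interpret I: vector_space "vscale (isotope C c)" by (simp add: vs)
  show ?thesis
  proof (intro cayley_algebra.intro cayley_algebra_axioms.intro)
    show "vector_space (vscale (isotope C c))" by (simp add: vs)
    show "I.dim (UNIV :: 'c set) = 8" using dim_8 by simp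
    fix x y :: 'c and a
    show "Vector_Spaces.linear (vscale (isotope C c)) (vscale (isotope C c))
        (\<lambda>x. x \<star>\<^bsub>isotope C c\<^esub> y)"
      by (simp add: Vector_Spaces.linear_iff vs isotope_prod triple_add triple_scale)
    show "Vector_Spaces.linear (vscale (isotope C c)) (vscale (isotope C c))
        (\<lambda>y. x \<star>\<^bsub>isotope C c\<^esub> y)"
      by (simp add: Vector_Spaces.linear_iff vs isotope_prod triple_add triple_scale)
    show "vunit (isotope C c) \<star>\<^bsub>isotope C c\<^esub> x = x"
      by (simp add: isotope_prod triple_left c)
    show "x \<star>\<^bsub>isotope C c\<^esub> vunit (isotope C c) = x"
      by (simp add: isotope_prod triple_right c)
    show "vnorm (isotope C c) (a \<bullet>\<^bsub>isotope C c\<^esub> x) = a\<^sup>2 * vnorm (isotope C c) x"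
      by (simp add: norm_scale)
    show "Vector_Spaces.linear (vscale (isotope C c)) (*) (\<lambda>x. polar (isotope C c) x y)"
      by (simp add: polar_linear_left)
    show "Vector_Spaces.linear (vscale (isotope C c)) (*) (\<lambda>y. polar (isotope C c) x y)"
      by (simp add: polar_linear_right)
    show "vnorm (isotope C c) (x \<star>\<^bsub>isotope C c\<^esub> y)
        = vnorm (isotope C c) x * vnorm (isotope C c) y"
      by (simp add: isotope_prod triple_def norm_mult c)
    show "(\<And>y. polar (isotope C c) x y = 0) \<Longrightarrow> x = 0"
      by (simp add: norm_nondegenerate)
  qed
qed

text \<open>Passing to an isotope moves any given element of norm 1 to the unit, without changing the
  triple product; this replaces the transitivity of the automorphism group on such elements.\<close>

lemma triple_isotope:
  assumes c: "nrm c = 1"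
  shows "triple (isotope C c) = tri"
proof (intro ext)
  fix x y z
  have bar_eq: "bar (isotope C c) y = pol y c \<cdot> c - y"
    by (simp add: bar_def)
  \<comment> \<open>\<open>conj_right_prod_linearized\<close> for the element
    \<open>x \<odot> cj c\<close> and the pair y, c. Since
    \<open>x \<odot> cj c \<odot> c = x\<close>, the twists of the isotope product cancel against
    the conjugation of the isotope and leave \<open>x \<odot> cj y\<close>.\<close>
  have "x \<odot> cj c \<odot> y \<odot> cj c + (x \<odot> cj c \<odot> c) \<odot> cj y = pol y c \<cdot> (x \<odot> cj c)"
    by (rule conj_right_prod_linearized)
  then have "(x \<odot> cj c \<odot> (pol y c \<cdot> c - y)) \<odot> cj c = x \<odot> cj y"
    by (simp add: conj_right_prod' c prod_simps algebra_simps)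
  then show "triple (isotope C c) x y z = tri x y z"
    unfolding triple_def[of "isotope C c"] bar_eq isotope_prod by (simp add: triple_def)
qed

lemma isotope_one: "isotope C \<e> = C"
  by (simp add: isotope_def unit_right)

end

text \<open>The quadratic equation \<open>square_eq\<close> recovers the trace
  \<open>pol x \<e>\<close> from the product: unless x is a multiple of the unit, the coefficient of
  x in it is unique. The trace determines conjugation, and with it the triple product.\<close>

lemma (in cayley_algebra) iso_preserves_triple:
  assumes C': "cayley_algebra C'" and sc: "vscale C' = vscale C"
    and lin: "linear_map \<phi>" and bij: "bij \<phi>"
    and mult: "\<And>x y. \<phi> (x \<odot> y) = \<phi> x \<star>\<^bsub>C'\<^esub> \<phi> y"
  shows "\<phi> (tri x y z) = triple C' (\<phi> x) (\<phi> y) (\<phi> z)"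
proof -
  interpret C': cayley_algebra C' by (rule C')
  have add: "\<phi> (x + y) = \<phi> x + \<phi> y" and scl: "\<phi> (a \<cdot> x) = a \<cdot> \<phi> x" for x y a
    using lin unfolding Vector_Spaces.linear_iff by auto
  have diff: "\<phi> (x - y) = \<phi> x - \<phi> y" for x y
    using add[of "x - y" y] by (simp add: algebra_simps)
  have one: "\<phi> \<e> = vunit C'"
    by (metis C'.unit_right bij bij_pointE mult unit_left)
  have "pol x \<e> = polar C' (\<phi> x) (vunit C')" for x
  proof (cases "\<exists>a. x = a \<cdot> \<e>")
    case True
    then show ?thesis
      using C'.pol_scale_left by (auto simp: scl one pol_scale_left pol_self C'.pol_self sc)
  next
    case False
    define d where "d = pol x \<e> - polar C' (\<phi> x) (vunit C')"
    have "\<phi> (x \<odot> x) = \<phi> x \<star>\<^bsub>C'\<^esub> \<phi> x" by (rule mult)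
    then have "pol x \<e> \<cdot> \<phi> x - nrm x \<cdot> vunit C'
        = polar C' (\<phi> x) (vunit C') \<cdot> \<phi> x - vnorm C' (\<phi> x) \<cdot> vunit C'"
      by (simp add: square_eq C'.square_eq diff scl one sc)
    then have "d \<cdot> \<phi> x = (nrm x - vnorm C' (\<phi> x)) \<cdot> vunit C'"
      by (simp add: d_def scale_left_diff_distrib algebra_simps)
    also have "\<dots> = \<phi> ((nrm x - vnorm C' (\<phi> x)) \<cdot> \<e>)"
      by (simp add: scl one)
    finally have "d \<cdot> x = (nrm x - vnorm C' (\<phi> x)) \<cdot> \<e>"
      using bij by (simp add: scl[symmetric] bij_is_inj inj_eq del: scl)
    then have "d \<noteq> 0 \<Longrightarrow> x = ((1 / d) * (nrm x - vnorm C' (\<phi> x))) \<cdot> \<e>"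
      by (metis divide_self_if mult.commute scale_one scale_scale times_divide_eq_right mult.right_neutral)
    with False have "d = 0" by blast
    then show ?thesis by (simp add: d_def)
  qed
  then have "\<phi> (cj y) = bar C' (\<phi> y)"
    by (simp add: conj_eq C'.conj_eq diff scl one sc)
  then show ?thesis by (simp add: triple_def mult)
qed

text \<open>The assumption \<open>mult\<close> compares the two multiplication tables through the
  linear extension of \<open>b k \<mapsto> b' k\<close>. This avoids structure constants and lets
  each kind of basis supply its own table.\<close>

lemma (in cayley_algebra) triple_aut_from_bases:
  fixes b b' :: "'i \<Rightarrow> 'c"
  assumes c: "nrm c = 1"
    and b: "inj b" "independent (range b)" "span (range b) = UNIV"
    and b': "inj b'" "independent (range b')" "span (range b') = UNIV"
    and mult: "\<And>\<phi> i j. linear_map \<phi> \<Longrightarrow> (\<And>k. \<phi> (b k) = b' k) \<Longrightarrow>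
        \<phi> (b i \<odot> b j) = b' i \<star>\<^bsub>isotope C c\<^esub> b' j"
  shows "\<exists>\<phi>\<in>triple_aut C. \<forall>k. \<phi> (b k) = b' k"
proof -
  interpret P: vector_space_pair "vscale C" "vscale C" by unfold_locales
  interpret I: cayley_algebra "isotope C c" by (rule cayley_algebra_isotope[OF c])
  obtain \<phi> where lin: "linear_map \<phi>"
      and \<phi>0: "\<forall>x\<in>range b. \<phi> x = b' (inv_into UNIV b x)"
    using P.linear_independent_extend[OF b(2), of "\<lambda>x. b' (inv_into UNIV b x)"] by blast
  obtain \<psi> where lin': "linear_map \<psi>"
      and \<psi>0: "\<forall>x\<in>range b'. \<psi> x = b (inv_into UNIV b' x)"
    using P.linear_independent_extend[OF b'(2), of "\<lambda>x. b (inv_into UNIV b' x)"] by blast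
  have \<phi>: "\<phi> (b k) = b' k" and \<psi>: "\<psi> (b' k) = b k" for k
    using \<phi>0 \<psi>0 b(1) b'(1) by auto
  have "linear_map (\<lambda>x. \<psi> (\<phi> x))"
    "linear_map (\<lambda>x. x)"
    using lin lin' unfolding Vector_Spaces.linear_iff by auto
  then have "\<psi> (\<phi> x) = x" for x
    by (rule P.linear_eq_on[where B = "range b"]) (use \<phi> \<psi> b(3) in auto)
  then have "inj \<phi>" by (metis injI)
  then have bij: "bij \<phi>" by (rule linear_inj_imp_bij[OF lin])
  have linl: "linear_map (\<lambda>x. \<phi> (x \<odot> y))"
    "linear_map (\<lambda>y. \<phi> (x \<odot> y))"
    "linear_map (\<lambda>x. \<phi> x \<star>\<^bsub>isotope C c\<^esub> \<phi> y)"
    "linear_map (\<lambda>y. \<phi> x \<star>\<^bsub>isotope C c\<^esub> \<phi> y)" for x y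
    using lin I.prod_simps unfolding Vector_Spaces.linear_iff by (auto simp: prod_simps)
  have m1: "\<phi> (b i \<odot> y) = \<phi> (b i) \<star>\<^bsub>isotope C c\<^esub> \<phi> y" for i y
    by (rule P.linear_eq_on[where B = "range b", OF linl(2) linl(4)])
      (use mult[OF lin \<phi>] \<phi> b(3) in auto)
  have "\<phi> (x \<odot> y) = \<phi> x \<star>\<^bsub>isotope C c\<^esub> \<phi> y" for x y
    by (rule P.linear_eq_on[where B = "range b", OF linl(1) linl(3)])
      (use m1 b(3) in auto)
  then have "\<phi> (tri x y z) = tri (\<phi> x) (\<phi> y) (\<phi> z)" for x y z
    using iso_preserves_triple[OF cayley_algebra_isotope[OF c] _ lin bij] triple_isotope[OF c]
    by simp
  with lin bij \<phi> show ?thesis unfolding triple_aut_def by blast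
qed

section \<open>Indices modulo 3 and modulo 7\<close>

lemma exhaust_mod3: "i = 1 \<or> i = 2 \<or> i = (3::3)"
proof (induction i rule: bit1_induct)
  case (of_int z)
  then have "z = 0 \<or> z = 1 \<or> z = 2" by auto
  then show ?case by auto
qed

lemma exhaust_mod7:
  "i = 1 \<or> i = 2 \<or> i = 3 \<or> i = 4 \<or> i = 5 \<or> i = 6 \<or> i = (7::7)"
proof (induction i rule: bit1_induct)
  case (of_int z)
  then have "z = 0 \<or> z = 1 \<or> z = 2 \<or> z = 3 \<or> z = 4 \<or> z = 5 \<or> z = 6" by auto
  then show ?case by auto
qed

section \<open>Gradings and homogeneous bases\<close>

context cayley_algebra
begin

lemma triple_autD:
  assumes "\<phi> \<in> triple_aut C"
  shows "linear_map \<phi>" "bij \<phi>"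
    "\<phi> (tri x y z) = tri (\<phi> x) (\<phi> y) (\<phi> z)" "\<phi> (x + y) = \<phi> x + \<phi> y"
    "\<phi> (a \<cdot> x) = a \<cdot> \<phi> x" "\<phi> 0 = 0" "\<phi> x = 0 \<longleftrightarrow> x = 0"
proof -
  show lin: "linear_map \<phi>" and bij: "bij \<phi>"
    and "\<phi> (tri x y z) = tri (\<phi> x) (\<phi> y) (\<phi> z)"
    using assms by (auto simp: triple_aut_def)
  show "\<phi> (x + y) = \<phi> x + \<phi> y" and s: "\<phi> (a \<cdot> x) = a \<cdot> \<phi> x" for a x
    using lin unfolding Vector_Spaces.linear_iff by auto
  show z: "\<phi> 0 = 0" using s[of 0 0] by simp
  then show "\<phi> x = 0 \<longleftrightarrow> x = 0" using bij by (metis bij_is_inj injD)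
qed

text \<open>The scalar in \<open>tri x x \<e> = nrm x \<cdot> \<e>\<close> is expressed by the
  triple product alone.\<close>

lemma triple_aut_nrm:
  assumes "\<phi> \<in> triple_aut C"
  shows "nrm (\<phi> x) = nrm x"
proof -
  have "nrm x \<cdot> \<phi> \<e> = \<phi> (tri x x \<e>)"
    by (simp add: triple_left triple_autD[OF assms])
  also have "\<dots> = nrm (\<phi> x) \<cdot> \<phi> \<e>"
    unfolding triple_autD(3)[OF assms] by (rule triple_left)
  finally show ?thesis using triple_autD(7)[OF assms] by simp
qed

lemma triple_aut_id: "id \<in> triple_aut C" "(\<lambda>x. x) \<in> triple_aut C"
  by (simp_all add: triple_aut_def Vector_Spaces.linear_iff vector_space_axioms bij_id[unfolded id_def])

lemma triple_aut_comp:
  assumes "\<phi> \<in> triple_aut C" "\<psi> \<in> triple_aut C"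
  shows "\<phi> \<circ> \<psi> \<in> triple_aut C"
  using assms bij_comp[of \<psi> \<phi>] unfolding triple_aut_def Vector_Spaces.linear_iff by auto

lemma triple_aut_inv:
  assumes "\<phi> \<in> triple_aut C"
  shows "inv_into UNIV \<phi> \<in> triple_aut C"
proof -
  note D = triple_autD[OF assms]
  have i: "inv_into UNIV \<phi> y = x \<longleftrightarrow> y = \<phi> x" for x y
    using D(2) by (metis bij_inv_eq_iff)
  have r: "\<phi> (inv_into UNIV \<phi> y) = y" for y
    using i by metis
  show ?thesis
    using D(2) unfolding triple_aut_def Vector_Spaces.linear_iff
    by (auto simp: i r D(3-5) vector_space_axioms bij_imp_bij_inv)
qed

lemma grading_iso_sym:
  assumes "grading_iso C G \<Gamma> \<Delta>"
  shows "grading_iso C G \<Delta> \<Gamma>"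
proof -
  obtain \<phi> where \<phi>: "\<phi> \<in> triple_aut C" "\<forall>g\<in>carrier G. \<phi> ` \<Gamma> g = \<Delta> g"
    using assms unfolding grading_iso_def by blast
  have "inj \<phi>" using triple_autD(2)[OF \<phi>(1)] by (rule bij_is_inj)
  then have "\<forall>g\<in>carrier G. inv_into UNIV \<phi> ` \<Delta> g = \<Gamma> g"
    using \<phi>(2) by (metis image_inv_f_f)
  with triple_aut_inv[OF \<phi>(1)] show ?thesis unfolding grading_iso_def by blast
qed

lemma triple_aut_span:
  assumes "\<phi> \<in> triple_aut C"
  shows "\<phi> ` span S = span (\<phi> ` S)"
proof -
  interpret P: vector_space_pair "vscale C" "vscale C" by unfold_locales
  show ?thesis using P.linear_span_image[OF triple_autD(1)[OF assms]] by simp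
qed

end

text \<open>Orthogonality of components of degrees that are not inverse to each other, together with the
  nondegeneracy of the norm, does the work of the directness of the sum.\<close>

definition (in cayley_algebra) orthogonal_family ::
  "('g, 'm) monoid_scheme \<Rightarrow> ('g \<Rightarrow> 'c set) \<Rightarrow> bool" where
  "orthogonal_family G \<Gamma> \<longleftrightarrow> (\<forall>g\<in>carrier G. subspace (\<Gamma> g)) \<and>
     (\<forall>g\<in>carrier G. \<forall>h\<in>carrier G. g \<otimes>\<^bsub>G\<^esub> h \<noteq> \<one>\<^bsub>G\<^esub> \<longrightarrow> (\<forall>x\<in>\<Gamma> g. \<forall>y\<in>\<Gamma> h. pol x y = 0)) \<and>
     span (\<Union>g\<in>carrier G. \<Gamma> g) = UNIV"

definition (in cayley_algebra) triple_closed ::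
  "('g, 'm) monoid_scheme \<Rightarrow> ('g \<Rightarrow> 'c set) \<Rightarrow> bool" where
  "triple_closed G \<Gamma> \<longleftrightarrow> (\<forall>g1\<in>carrier G. \<forall>g2\<in>carrier G. \<forall>g3\<in>carrier G.
     \<forall>x\<in>\<Gamma> g1. \<forall>y\<in>\<Gamma> g2. \<forall>z\<in>\<Gamma> g3. tri x y z \<in> \<Gamma> (g1 \<otimes>\<^bsub>G\<^esub> g2 \<otimes>\<^bsub>G\<^esub> g3))"

lemma (in cayley_algebra) pol_span_zero:
  assumes "x \<in> span S" "\<And>s. s \<in> S \<Longrightarrow> pol s y = 0"
  shows "pol x y = 0"
  using assms by (induction rule: span_induct_alt) (auto simp: bilinear_simps)

locale cayley_group = cayley_algebra C + G: comm_group G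
  for C :: "('f::field, 'c::ab_group_add) quad_algebra" and G :: "('g, 'm) monoid_scheme" (structure)
begin

lemma orthogonal_familyD:
  assumes "orthogonal_family G \<Gamma>"
  shows "g \<in> carrier G \<Longrightarrow> subspace (\<Gamma> g)"
    "g \<in> carrier G \<Longrightarrow> h \<in> carrier G \<Longrightarrow> x \<in> \<Gamma> g \<Longrightarrow> y \<in> \<Gamma> h \<Longrightarrow> g \<otimes> h \<noteq> \<one> \<Longrightarrow> pol x y = 0"
    "span (\<Union>g\<in>carrier G. \<Gamma> g) = UNIV"
  using assms unfolding orthogonal_family_def by auto

text \<open>Homogeneous elements span and the polar form is nondegenerate, so some homogeneous
  element pairs nontrivially with x; orthogonality leaves \<open>inv g\<close> as its only possible
  degree.\<close>

lemma orthogonal_family_nondegenerate: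
  assumes "orthogonal_family G \<Gamma>" "x \<in> \<Gamma> g" "g \<in> carrier G" "x \<noteq> 0"
  obtains y where "y \<in> \<Gamma> (inv g)" "pol x y = 1"
proof -
  note D = orthogonal_familyD[OF assms(1)]
  have "\<exists>h\<in>carrier G. \<exists>y\<in>\<Gamma> h. pol y x \<noteq> 0"
  proof (rule ccontr)
    assume "\<not> ?thesis"
    then have "pol y x = 0" for y
      using pol_span_zero[of y "\<Union>g\<in>carrier G. \<Gamma> g" x] D(3) by auto
    then have "x = 0" using norm_nondegenerate[of x] pol_commute by metis
    with assms show False by simp
  qed
  then obtain h y where y: "h \<in> carrier G" "y \<in> \<Gamma> h" "pol y x \<noteq> 0" by blast
  then have "h \<otimes> g = \<one>" using D(2)[of h g y x] assms by auto
  then have "h = inv g" using y assms by (simp add: G.inv_equality)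
  moreover have "(1 / pol y x) \<cdot> y \<in> \<Gamma> h" using D(1) y subspace_scale by blast
  moreover have "pol x ((1 / pol y x) \<cdot> y) = 1"
    using y(3) by (simp add: pol_scale_right pol_commute[of x])
  ultimately show ?thesis using that by blast
qed

text \<open>Let z be the part of x spanned by basis vectors of degrees other than g. It lies in
  \<open>\<Gamma> g\<close>, hence is orthogonal to every \<open>\<Gamma> h\<close> with g h
  \<noteq> e; for h inverse to g it is orthogonal because its basis vectors have the wrong degrees.
  So z = 0 by nondegeneracy.\<close>

lemma homogeneous_basis_components:
  assumes fam: "orthogonal_family G \<Gamma>" and d: "\<And>k. d k \<in> carrier G" "\<And>k. b k \<in> \<Gamma> (d k)"
    and sp: "span (range b) = UNIV" and g: "g \<in> carrier G"
  shows "\<Gamma> g = span (b ` {k. d k = g})"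
proof
  note D = orthogonal_familyD[OF fam]
  show sub: "span (b ` {k. d k = g}) \<subseteq> \<Gamma> g"
    using d by (intro span_minimal D(1) g) auto
  show "\<Gamma> g \<subseteq> span (b ` {k. d k = g})"
  proof
    fix x assume x: "x \<in> \<Gamma> g"
    have "range b = b ` {k. d k = g} \<union> b ` {k. d k \<noteq> g}" by auto
    then have "x \<in> span (b ` {k. d k = g} \<union> b ` {k. d k \<noteq> g})" using sp by simp
    then obtain y z where yz: "y \<in> span (b ` {k. d k = g})" "z \<in> span (b ` {k. d k \<noteq> g})" "x = y + z"
      unfolding span_Un by auto
    have z: "z \<in> \<Gamma> g"
      using x yz sub subspace_diff[OF D(1)[OF g], of x y] by auto
    have "pol w z = 0" if w: "w \<in> \<Gamma> h" "h \<in> carrier G" for w h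
    proof (cases "g \<otimes> h = \<one>")
      case True
      have "pol (b k) w = 0" if "d k \<noteq> g" for k
      proof -
        have "d k \<otimes> h \<noteq> \<one>"
        proof
          assume "d k \<otimes> h = \<one>"
          then show False using True that d g w by (metis G.inv_equality)
        qed
        then show ?thesis using D(2) d w by blast
      qed
      then have "pol z w = 0" by (intro pol_span_zero[OF yz(2)]) auto
      then show ?thesis by (simp add: pol_commute)
    next
      case False
      then show ?thesis using D(2)[OF g w(2) z w(1)] by (simp add: pol_commute)
    qed
    then have "pol w z = 0" for w
      using pol_span_zero[of w "\<Union>g\<in>carrier G. \<Gamma> g" z] D(3) by auto
    then have "z = 0" using norm_nondegenerate[of z] pol_commute by metis
    then show "x \<in> span (b ` {k. d k = g})" using yz by simp
  qed
qed

text \<open>If \<open>pol x y \<noteq> 0\<close>, then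
  \<open>tri x y z + tri y x z = pol x y \<cdot> z\<close> puts every z of degree k also into degree
  \<open>g \<otimes> h \<otimes> k\<close>, which differs from k; directness of the sum then makes
  every component zero. Uniqueness of the decomposition is used here and nowhere else.\<close>

lemma grading_orthogonal:
  assumes "is_grading C G \<Gamma>"
  shows "orthogonal_family G \<Gamma>" "triple_closed G \<Gamma>"
proof -
  note gr = assms[unfolded is_grading_def]
  have sub: "subspace (\<Gamma> g)" if "g \<in> carrier G" for g
    by (rule gr[THEN conjunct1, rule_format, OF that])
  have dec: "\<exists>!f. finite {g. f g \<noteq> 0} \<and> (\<forall>g\<in>carrier G. f g \<in> \<Gamma> g) \<and>
             (\<forall>g. g \<notin> carrier G \<longrightarrow> f g = 0) \<and> x = (\<Sum>g | f g \<noteq> 0. f g)" for x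
    by (rule gr[THEN conjunct2, THEN conjunct1, rule_format])
  show tc: "triple_closed G \<Gamma>"
    unfolding triple_closed_def by (rule gr[THEN conjunct2, THEN conjunct2])
  have int: "x = 0" if gh: "g \<in> carrier G" "h \<in> carrier G" "g \<noteq> h" "x \<in> \<Gamma> g" "x \<in> \<Gamma> h" for g h x
  proof (rule ccontr)
    assume x: "x \<noteq> 0"
    define Q where "Q f \<longleftrightarrow> finite {g. f g \<noteq> 0} \<and> (\<forall>g\<in>carrier G. f g \<in> \<Gamma> g) \<and>
        (\<forall>g. g \<notin> carrier G \<longrightarrow> f g = 0) \<and> x = (\<Sum>g | f g \<noteq> 0. f g)" for f
    have Q: "Q (\<lambda>i. if i = k then x else 0)" if k: "k \<in> carrier G" "x \<in> \<Gamma> k" for k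
    proof -
      have "{i. (if i = k then x else 0) \<noteq> 0} = {k}" using x by auto
      then show ?thesis unfolding Q_def using k sub subspace_0 by auto
    qed
    have "\<exists>!f. Q f" unfolding Q_def by (rule dec)
    \<comment> \<open>x has one decomposition concentrated in degree g and another one concentrated
      in degree h.\<close>
    then have "(\<lambda>i. if i = g then x else 0) = (\<lambda>i. if i = h then x else 0)"
      using Q[OF gh(1,4)] Q[OF gh(2,5)] by blast
    then show False using x gh(3) by (metis (full_types))
  qed
  have spn: "span (\<Union>g\<in>carrier G. \<Gamma> g) = UNIV"
  proof -
    have "x \<in> span (\<Union>g\<in>carrier G. \<Gamma> g)" for x
    proof -
      obtain f where f: "\<forall>g\<in>carrier G. f g \<in> \<Gamma> g" "\<forall>g. g \<notin> carrier G \<longrightarrow> f g = 0"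
          "x = (\<Sum>g | f g \<noteq> 0. f g)"
        using dec[of x] by blast
      have "f g \<in> span (\<Union>g\<in>carrier G. \<Gamma> g)" if "f g \<noteq> 0" for g
        using f that by (intro span_base) blast
      then show ?thesis unfolding f(3) by (intro span_sum) auto
    qed
    then show ?thesis by auto
  qed
  have "pol x y = 0" if gh: "g \<in> carrier G" "h \<in> carrier G" "g \<otimes> h \<noteq> \<one>" and xy: "x \<in> \<Gamma> g" "y \<in> \<Gamma> h"
    for g h x y
  proof (rule ccontr)
    assume p: "pol x y \<noteq> 0"
    have "z = 0" if z: "z \<in> \<Gamma> k" "k \<in> carrier G" for z k
    proof -
      have "tri x y z + tri y x z \<in> \<Gamma> (g \<otimes> h \<otimes> k)"
      proof (rule subspace_add)
        show "subspace (\<Gamma> (g \<otimes> h \<otimes> k))" using sub gh z by simp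
        show "tri x y z \<in> \<Gamma> (g \<otimes> h \<otimes> k)" using tc gh xy z unfolding triple_closed_def by blast
        have "tri y x z \<in> \<Gamma> (h \<otimes> g \<otimes> k)" using tc gh xy z unfolding triple_closed_def by blast
        then show "tri y x z \<in> \<Gamma> (g \<otimes> h \<otimes> k)" using gh G.m_comm by simp
      qed
      then have "pol x y \<cdot> z \<in> \<Gamma> (g \<otimes> h \<otimes> k)" by (simp add: triple_left_linearized)
      moreover have "pol x y \<cdot> z \<in> \<Gamma> k" using sub z subspace_scale by blast
      moreover have "g \<otimes> h \<otimes> k \<noteq> k" using gh z by simp
      ultimately have "pol x y \<cdot> z = 0" using int[of "g \<otimes> h \<otimes> k" k] gh z by blast
      then show "z = 0" using p by simp
    qed
    then have "(\<Union>g\<in>carrier G. \<Gamma> g) \<subseteq> {0}" by blast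
    then have "(UNIV :: 'c set) \<subseteq> span {0}" using spn span_mono by metis
    then have "\<e> \<in> {0}" by (simp add: subset_iff)
    then show False by simp
  qed
  with sub spn show "orthogonal_family G \<Gamma>"
    unfolding orthogonal_family_def by blast
qed

end

text \<open>Pairing with \<open>b' i\<close> kills every other \<open>b j\<close>, so
  \<open>b i\<close> is not in their span, and eight independent vectors span. For Cayley-Dickson
  bases b' is b itself; for standard bases it is b with opposite basis vectors exchanged.\<close>

lemma (in cayley_algebra) dual_basis:
  fixes b b' :: "'i \<Rightarrow> 'c"
  assumes card: "CARD('i) = 8"
    and dual: "\<And>i j. i \<noteq> j \<Longrightarrow> pol (b i) (b' j) = 0" "\<And>i. pol (b i) (b' i) \<noteq> 0"
  shows "inj b" "independent (range b)" "span (range b) = UNIV"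
proof -
  show inj: "inj b"
    using dual by (metis injI)
  show ind: "independent (range b)"
  proof
    assume "dependent (range b)"
    then obtain i where "b i \<in> span (range b - {b i})"
      unfolding dependent_def by blast
    then have "pol (b i) (b' i) = 0"
      by (rule pol_span_zero) (auto intro!: dual(1))
    then show False using dual(2) by blast
  qed
  have "finite (UNIV :: 'i set)" using card by (intro card_ge_0_finite) simp
  then show "span (range b) = UNIV"
    using ind inj card by (intro spanning_if_independent) (auto simp: card_image)
qed

text \<open>Subtracting projections makes any vector orthogonal to S. As S is too small to span,
  some \<open>T x\<close> is nonzero, and nondegeneracy provides v with
  \<open>pol (T x) (T v) \<noteq> 0\<close>; one of \<open>T x\<close>, \<open>T v\<close> and their
  sum is then anisotropic.\<close>

lemma (in cayley_algebra) orthonormal_extension: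
  assumes two: "(2::'f) \<noteq> 0" and S: "finite S" "card S < 8"
    and on: "\<And>s t. s \<in> S \<Longrightarrow> t \<in> S \<Longrightarrow> s \<noteq> t \<Longrightarrow> pol s t = 0" "\<And>s. s \<in> S \<Longrightarrow> nrm s = 1"
  obtains a where "\<And>s. s \<in> S \<Longrightarrow> pol a s = 0" "nrm a \<noteq> 0"
proof -
  \<comment> \<open>The denominator 2 is the value of \<open>pol s s = 2 * nrm s\<close>.\<close>
  define p where "p z = (\<Sum>s\<in>S. (pol z s / 2) \<cdot> s)" for z
  have pp: "pol (p z) t = pol z t" if t: "t \<in> S" for z t
  proof -
    have "pol (p z) t = (\<Sum>s\<in>S. (pol z s / 2) * pol s t)"
      unfolding p_def by (induction rule: finite_induct[OF S(1)]) (auto simp: bilinear_simps)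
    also have "\<dots> = (\<Sum>s\<in>S. if s = t then pol z t else 0)"
      using on t two by (intro sum.cong) (auto simp: pol_self)
    finally show ?thesis using S t by simp
  qed
  have psp: "p z \<in> span S" for z
    unfolding p_def by (intro span_sum span_scale span_base)
  define T where "T z = z - p z" for z
  have T: "pol (T z) s = 0" if "s \<in> S" for z s
    using pp that by (simp add: T_def bilinear_simps)
  have "\<exists>x. T x \<noteq> 0"
  proof (rule ccontr)
    assume "\<not> ?thesis"
    then have "z \<in> span S" for z
      using psp[of z] by (simp add: T_def)
    then have "8 \<le> card S" by (intro card_spanning S) auto
    then show False using S by simp
  qed
  then obtain x where x: "T x \<noteq> 0" by blast
  then obtain v where v: "pol (T x) v \<noteq> 0" by (rule isotropic_neq_zeroE)
  have "pol (p v) (T x) = 0"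
    using psp by (rule pol_span_zero) (use T pol_commute in metis)
  then have "pol (T x) v = pol (T x) (T v)"
    by (simp add: T_def[of v] pol_diff_right pol_commute[of "p v"])
  then have "pol (T x) (T v) \<noteq> 0" using v by simp
  then have "nrm (T x + T v) - nrm (T x) - nrm (T v) \<noteq> 0" unfolding polar_def .
  then have "nrm (T x + T v) \<noteq> 0 \<or> nrm (T x) \<noteq> 0 \<or> nrm (T v) \<noteq> 0" by auto
  then show ?thesis using that T by (metis add_0 pol_add_left)
qed

section \<open>Standard bases from idempotents\<close>

lemma all_mod3: "(\<forall>i::3. P i) \<longleftrightarrow> P 1 \<and> P 2 \<and> P 3"
  by (metis exhaust_mod3)

lemma UNIV_std_index: "(UNIV :: std_index set) = {E1, E2, U 1, U 2, U 3, V 1, V 2, V 3}"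
proof -
  have "k \<in> {E1, E2, U 1, U 2, U 3, V 1, V 2, V 3}" for k
    by (cases k) (use exhaust_mod3 in auto)
  then show ?thesis by blast
qed

lemma all_std_index:
  "(\<forall>k. P k) \<longleftrightarrow> P E1 \<and> P E2 \<and> P (U 1) \<and> P (U 2) \<and> P (U 3) \<and> P (V 1) \<and> P (V 2) \<and> P (V 3)"
  using UNIV_std_index by (metis UNIV_I empty_iff insert_iff)

lemma mod3_simps: "(1::3) + 1 = 2" "(2::3) + 1 = 3" "(3::3) + 1 = 1" "(1::3) + 2 = 3"
  "(2::3) + 2 = 1" "(3::3) + 2 = 2" "(1::3) \<noteq> 2" "(1::3) \<noteq> 3" "(2::3) \<noteq> 3"
  "(2::3) \<noteq> 1" "(3::3) \<noteq> 1" "(3::3) \<noteq> 2"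
  by simp_all

lemma card_std_index: "CARD(std_index) = 8"
  unfolding UNIV_std_index by simp

context cayley_algebra
begin

text \<open>By \<open>square_eq\<close>, norm 0 and trace 1 give e e = e; norm 0 excludes the unit
  and trace 1 excludes zero, so these are nontrivial idempotents.\<close>

definition idem :: "'c \<Rightarrow> bool" where
  "idem e \<longleftrightarrow> nrm e = 0 \<and> pol e \<e> = 1"

text \<open>The equation \<open>e \<odot> u = u\<close> also holds for u = e; the orthogonality
  conditions cut this out. For e = e1 of a standard basis the solutions are the span of the u's, for
  e2 the span of the v's.\<close>

definition peirce :: "'c \<Rightarrow> 'c \<Rightarrow> bool" where
  "peirce e u \<longleftrightarrow> pol u e = 0 \<and> pol u \<e> = 0 \<and> e \<odot> u = u"

lemma idem_compl: "idem e \<Longrightarrow> idem (\<e> - e)"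
  by (simp add: idem_def nrm_diff pol_diff_left pol_self pol_commute[of \<e>])

lemma idem_conj: "idem e \<Longrightarrow> cj e = \<e> - e"
  by (simp add: idem_def conj_eq)

lemma idem_square: "idem e \<Longrightarrow> e \<odot> e = e"
  by (simp add: idem_def square_eq)

lemma peirce_conj: "peirce e u \<Longrightarrow> cj u = - u"
  by (simp add: peirce_def conj_eq)

lemma peirce_isotropic: "idem e \<Longrightarrow> peirce e u \<Longrightarrow> nrm u = 0"
  by (metis idem_def mult_zero_left norm_mult peirce_def)

lemma peirce_pol: "idem e \<Longrightarrow> peirce e u \<Longrightarrow> peirce e u' \<Longrightarrow> pol u u' = 0"
  by (metis idem_def mult_zero_left peirce_def pol_prod_left)

lemma peirce_square: "idem e \<Longrightarrow> peirce e u \<Longrightarrow> u \<odot> u = 0"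
  using peirce_isotropic[of e u] by (simp add: square_eq peirce_def)

lemma peirce_mult:
  assumes "idem e" "peirce e u"
  shows "e \<odot> u = u" "(\<e> - e) \<odot> u = 0" "u \<odot> e = 0" "u \<odot> (\<e> - e) = u"
proof -
  show 1: "e \<odot> u = u" using assms by (simp add: peirce_def)
  then show "(\<e> - e) \<odot> u = 0" by (simp add: prod_simps)
  have "e \<odot> cj u + u \<odot> cj e = 0"
    using prod_conj_linearized[of e u] assms by (simp add: peirce_def pol_commute)
  then show "u \<odot> e = 0"
    using 1 assms by (simp add: peirce_conj idem_conj prod_simps)
  then show "u \<odot> (\<e> - e) = u" by (simp add: prod_simps)
qed

lemma peirce_scale: "peirce e u \<Longrightarrow> peirce e (a \<cdot> u)"
  and peirce_diff: "peirce e u \<Longrightarrow> peirce e u' \<Longrightarrow> peirce e (u - u')"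
  by (simp_all add: peirce_def bilinear_simps)

lemma peirce_compl_pol: "peirce e u \<Longrightarrow> pol u (\<e> - e) = 0" "peirce (\<e> - e) u \<Longrightarrow> pol u e = 0"
  by (auto simp: peirce_def pol_diff_right)

lemma peirce_anticommute:
  assumes "idem e" "peirce e u" "peirce e u'"
  shows "u' \<odot> u = - (u \<odot> u')"
  using prod_conj_linearized[of u u'] peirce_pol[OF assms] assms
  by (simp add: peirce_conj prod_simps add_eq_0_iff2)

text \<open>Conjugation turns e into its complement and changes the sign of u. As e and u are
  orthogonal, linearised left cancellation therefore gives
  \<open>(\<e> - e) \<odot> (u \<odot> u') = u \<odot> (e \<odot> u')\<close>.\<close>

lemma peirce_prod:
  assumes e: "idem e" and u: "peirce e u" "peirce e u'"
  shows "peirce (\<e> - e) (u \<odot> u')"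
proof -
  have "pol e u = 0" using u by (simp add: peirce_def pol_commute)
  then have "(\<e> - e) \<odot> (u \<odot> u') = u \<odot> u'"
    using conj_left_prod_linearized[of e u u'] u e
    by (simp add: idem_conj peirce_conj peirce_mult prod_minus_left)
  moreover have "pol (u \<odot> u') e = 0" "pol (u \<odot> u') \<e> = 0"
    using u e peirce_pol[OF e u] pol_adjoint_right[of u u']
    by (simp_all add: peirce_conj peirce_mult prod_simps pol_minus_right)
  ultimately show ?thesis by (simp add: peirce_def pol_diff_right)
qed

text \<open>e and its complement form a hyperbolic pair, so the coefficient of each is the pairing
  with the other. \<open>Q z\<close> is the remainder, orthogonal to both, and left multiplication
  by the two idempotents splits it.\<close>

lemma peirce_decomposition:
  assumes e: "idem e"
  defines "Q \<equiv> \<lambda>z. z - pol z (\<e> - e) \<cdot> e - pol z e \<cdot> (\<e> - e)"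
  shows "peirce e (e \<odot> Q z)" "peirce (\<e> - e) ((\<e> - e) \<odot> Q z)"
    "z = pol z (\<e> - e) \<cdot> e + pol z e \<cdot> (\<e> - e) + e \<odot> Q z + (\<e> - e) \<odot> Q z"
proof -
  have p: "nrm e = 0" "pol e \<e> = 1" "pol \<e> e = 1" "pol e e = 0"
    using e by (auto simp: idem_def pol_self pol_commute[of \<e>])
  have Q: "pol (Q z) e = 0" "pol (Q z) \<e> = 0"
    by (simp_all add: Q_def bilinear_simps p pol_self)
  have 1: "peirce e (e \<odot> w)" if "idem e" "pol w e = 0" "pol w \<e> = 0" for e w
  proof -
    have "pol (e \<odot> w) (e \<odot> \<e>) = 0" "pol (e \<odot> w) \<e> = 0"
      using that unfolding pol_prod_left pol_adjoint_left[of e w \<e>]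
      by (auto simp: idem_def idem_conj unit_right pol_diff_right)
    then show ?thesis
      using that by (simp add: peirce_def unit_right left_alternative idem_square)
  qed
  show "peirce e (e \<odot> Q z)" using 1 e Q by blast
  show "peirce (\<e> - e) ((\<e> - e) \<odot> Q z)"
    using 1[OF idem_compl[OF e]] Q by (simp add: pol_diff_right)
  show "z = pol z (\<e> - e) \<cdot> e + pol z e \<cdot> (\<e> - e) + e \<odot> Q z + (\<e> - e) \<odot> Q z"
    by (simp add: prod_simps) (simp add: Q_def)
qed

text \<open>The product p satisfies e p = p e = p. Its remainder w after removing the multiple of e
  dictated by the form satisfies e w = w and is orthogonal to e and the unit, so w is in the Peirce
  component of e, where right multiplication by e is zero; but w e = w.\<close>

lemma peirce_opposite_prod:
  assumes e: "idem e" and u: "peirce e u" and v: "peirce (\<e> - e) v"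
  shows "u \<odot> v = - pol u v \<cdot> e"
proof -
  define p where "p = u \<odot> v"
  note e' = idem_compl[OF e]
  have v': "v \<odot> e = v" "e \<odot> v = 0" "v \<odot> (\<e> - e) = 0"
    using peirce_mult[OF e' v] by simp_all
  have "pol e u = 0" "pol v e = 0"
    using u peirce_compl_pol(2)[OF v] by (simp_all add: peirce_def pol_commute)
  then have "(\<e> - e) \<odot> p = 0" "p \<odot> (\<e> - e) = 0"
    using conj_left_prod_linearized[of e u v] conj_right_prod_linearized[of u v e]
      peirce_mult[OF e u] v' e by (simp_all add: idem_conj p_def)
  then have ep: "e \<odot> p = p" "p \<odot> e = p" by (simp_all add: prod_simps)
  have pe: "pol p e = 0"
    using pol_adjoint_right[of u v e] v v' by (simp add: p_def peirce_conj prod_simps)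
  have pe1: "pol p (\<e> - e) = - pol u v"
    using pol_adjoint_right[of u v "\<e> - e"] v
    by (simp add: p_def peirce_conj[of _ v] prod_simps pol_minus_right v')
  define w where "w = p - (- pol u v) \<cdot> e"
  have "pol w \<e> = 0" "pol w e = 0"
    using pe pe1 e by (simp_all add: w_def idem_def bilinear_simps pol_self)
  moreover have ew: "e \<odot> w = w" "w \<odot> e = w"
    using ep e by (simp_all add: w_def prod_simps idem_square)
  ultimately have "peirce e w" by (simp add: peirce_def)
  then have "w \<odot> e = 0" using peirce_mult e by blast
  then have "w = 0" using ew by simp
  then show ?thesis by (simp add: w_def p_def eq_neg_iff_add_eq_0)
qed

text \<open>The table forces u3 = v1 v2 and v3 = u1 u2, so two dual pairs determine the
  third.\<close>

definition std_basis_of :: "'c \<Rightarrow> 'c \<Rightarrow> 'c \<Rightarrow> 'c \<Rightarrow> 'c \<Rightarrow> std_index \<Rightarrow> 'c" where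
  "std_basis_of e u1 u2 v1 v2 k = (case k of E1 \<Rightarrow> e | E2 \<Rightarrow> \<e> - e
     | U i \<Rightarrow> if i = 1 then u1 else if i = 2 then u2 else v1 \<odot> v2
     | V i \<Rightarrow> if i = 1 then v1 else if i = 2 then v2 else u1 \<odot> u2)"

lemma std_basis_of_simps [simp]:
  "std_basis_of e u1 u2 v1 v2 E1 = e" "std_basis_of e u1 u2 v1 v2 E2 = \<e> - e"
  "std_basis_of e u1 u2 v1 v2 (U 1) = u1" "std_basis_of e u1 u2 v1 v2 (U 2) = u2"
  "std_basis_of e u1 u2 v1 v2 (U 3) = v1 \<odot> v2" "std_basis_of e u1 u2 v1 v2 (V 1) = v1"
  "std_basis_of e u1 u2 v1 v2 (V 2) = v2" "std_basis_of e u1 u2 v1 v2 (V 3) = u1 \<odot> u2"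
  by (simp_all add: std_basis_of_def mod3_simps)

lemma standard_basis_of:
  assumes e: "idem e"
    and u: "peirce e u1" "peirce e u2" and v: "peirce (\<e> - e) v1" "peirce (\<e> - e) v2"
    and p: "pol u1 v1 = 1" "pol u2 v2 = 1" "pol u1 v2 = 0" "pol u2 v1 = 0"
  shows "standard_basis C (std_basis_of e u1 u2 v1 v2)"
proof -
  define u3 v3 where "u3 = v1 \<odot> v2" and "v3 = u1 \<odot> u2"
  let ?f = "\<e> - e"
  note e' = idem_compl[OF e]
  have f: "\<e> - ?f = e" by simp
  have u3: "peirce e u3" using peirce_prod[OF e' v] by (simp add: u3_def)
  have v3: "peirce ?f v3" using peirce_prod[OF e u] by (simp add: v3_def)
  have uv: "x \<odot> y = - pol x y \<cdot> e" and vu: "y \<odot> x = - pol x y \<cdot> ?f"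
    if "peirce e x" "peirce ?f y" for x y
    using peirce_opposite_prod[OF e that] peirce_opposite_prod[OF e', of y x] that
    by (simp_all add: pol_commute)
  \<comment> \<open>In the exchange identity n(v1 v2, u1 u2) + n(v1 u2, u1 v2) = n(v1, u1) n(v2, u2)
    the second summand vanishes because v1 u2 = 0.\<close>
  have p3: "pol u3 v3 = 1"
    using pol_prod_exchange[of v1 v2 u1 u2] vu[OF u(2) v(1)] p
    by (simp add: u3_def v3_def pol_commute)
  have p3': "pol u1 v3 = 0" "pol u2 v3 = 0" "pol u3 v1 = 0" "pol u3 v2 = 0"
  proof -
    have "pol u1 v3 = 0" using pol_adjoint_left[of u1 u2 u1] peirce_square[OF e u(1)] u(1)
      by (simp add: v3_def peirce_conj prod_simps pol_commute[of u1 "u1 \<odot> u2"])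
    moreover have "pol u2 v3 = 0" using pol_adjoint_right[of u1 u2 u2] peirce_square[OF e u(2)] u(2)
      by (simp add: v3_def peirce_conj[of e] prod_simps pol_commute[of u2 "u1 \<odot> u2"])
    moreover have "pol u3 v1 = 0" using pol_adjoint_left[of v1 v2 v1] peirce_square[OF e' v(1)] v(1)
      by (simp add: u3_def peirce_conj[of ?f] prod_simps)
    moreover have "pol u3 v2 = 0" using pol_adjoint_right[of v1 v2 v2] peirce_square[OF e' v(2)] v(2)
      by (simp add: u3_def peirce_conj[of ?f] prod_simps)
    ultimately show "pol u1 v3 = 0" "pol u2 v3 = 0" "pol u3 v1 = 0" "pol u3 v2 = 0" by blast+
  qed
  note pols = p p3 p3'
  \<comment> \<open>Linearised left cancellation for elements of trace zero. Applied to u3 = v1 v2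
    and v3 = u1 u2 it does the reassociation in the products with the third pair.\<close>
  have ex: "x \<odot> (z \<odot> y) + z \<odot> (x \<odot> y) = - pol x z \<cdot> y"
    if "cj x = - x" "cj z = - z" for x y z
  proof -
    have "- (x \<odot> (z \<odot> y) + z \<odot> (x \<odot> y)) = pol x z \<cdot> y"
      using conj_left_prod_linearized[of x z y] that by (simp add: prod_minus_left)
    then show ?thesis by (metis minus_minus scale_minus_left)
  qed
  have cju: "cj u1 = - u1" "cj u2 = - u2" "cj v1 = - v1" "cj v2 = - v2"
    using u v peirce_conj by blast+
  note mu = peirce_mult[OF e u(1)] peirce_mult[OF e u(2)] peirce_mult[OF e u3]
  note mv = peirce_mult[OF e' v(1), unfolded f] peirce_mult[OF e' v(2), unfolded f]
    peirce_mult[OF e' v3, unfolded f]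
  have t: "u2 \<odot> u3 = v1" "u3 \<odot> u1 = v2" "v2 \<odot> v3 = u1" "v3 \<odot> v1 = u2"
  proof -
    show "u2 \<odot> u3 = v1"
      using ex[of u2 v1 v2] cju p mv uv[OF u(2) v(2)] by (simp add: u3_def prod_simps)
    have "u1 \<odot> u3 = - v2"
      using ex[of u1 v1 v2] cju p uv[OF u(1) v(2)] by (simp add: u3_def prod_simps)
    then show "u3 \<odot> u1 = v2" using peirce_anticommute[OF e u(1) u3] by simp
    show "v2 \<odot> v3 = u1"
      using ex[of v2 u1 u2] cju p mu vu[OF u(2) v(2)]
      by (simp add: v3_def prod_simps pol_commute[of v2])
    have "v1 \<odot> v3 = - u2"
      using ex[of v1 u1 u2] cju p vu[OF u(2) v(1)]
      by (simp add: v3_def prod_simps pol_commute[of v1])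
    then show "v3 \<odot> v1 = u2" using peirce_anticommute[OF e' v(1) v3] by simp
  qed
  have t': "u3 \<odot> u2 = - v1" "u1 \<odot> u3 = - v2" "v3 \<odot> v2 = - u1" "v1 \<odot> v3 = - u2"
    "u2 \<odot> u1 = - v3" "v2 \<odot> v1 = - u3"
    using peirce_anticommute[OF e u(2) u3] peirce_anticommute[OF e u3 u(1)]
      peirce_anticommute[OF e' v(2) v3] peirce_anticommute[OF e' v3 v(1)] t
      peirce_anticommute[OF e u] peirce_anticommute[OF e' v]
    by (simp_all add: u3_def v3_def)
  have sq: "u1 \<odot> u1 = 0" "u2 \<odot> u2 = 0" "u3 \<odot> u3 = 0" "v1 \<odot> v1 = 0" "v2 \<odot> v2 = 0" "v3 \<odot> v3 = 0"
    using peirce_square[OF e] peirce_square[OF e'] u u3 v v3 by blast+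
  have ee: "e \<odot> e = e" "?f \<odot> ?f = ?f" "e \<odot> ?f = 0" "?f \<odot> e = 0"
    using idem_square[OF e] idem_square[OF e'] by (simp_all add: prod_simps)
  let ?b = "std_basis_of e u1 u2 v1 v2"
  \<comment> \<open>The basis is isotropic, so duality pairs each vector with its opposite.\<close>
  let ?d = "\<lambda>k. case k of E1 \<Rightarrow> E2 | E2 \<Rightarrow> E1 | U i \<Rightarrow> V i | V i \<Rightarrow> U i"
  have p1: "pol e e = 0" "pol ?f ?f = 0" using e e' by (simp_all add: idem_def pol_self)
  have p2: "pol e ?f = 1" "pol ?f e = 1"
    using e by (simp_all add: idem_def pol_diff_right pol_diff_left pol_self pol_commute[of \<e>])
  have p4: "\<forall>x\<in>{e, ?f}. \<forall>y\<in>{u1, u2, u3, v1, v2, v3}. pol x y = 0 \<and> pol y x = 0"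
    using u u3 v v3 peirce_compl_pol(2)
    by (auto simp: peirce_def pol_diff_left pol_diff_right pol_commute[of e] pol_commute[of \<e>])
  have p5: "\<forall>x\<in>{u1, u2, u3}. \<forall>y\<in>{u1, u2, u3}. pol x y = 0"
    using u u3 peirce_pol[OF e] by auto
  have p6: "\<forall>x\<in>{v1, v2, v3}. \<forall>y\<in>{v1, v2, v3}. pol x y = 0"
    using v v3 peirce_pol[OF e'] by auto
  have b3: "?b (U 3) = u3" "?b (V 3) = v3" by (simp_all add: u3_def v3_def)
  note cases = p1 p2 p4[simplified ball_simps] p5[simplified ball_simps] p6[simplified ball_simps]
    pols pols[unfolded pol_commute[of u1] pol_commute[of u2] pol_commute[of u3]]
  have "\<forall>i j. pol (?b i) (?b (?d j)) = (if i = j then 1 else 0)"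
    unfolding all_std_index by (simp only: std_basis_of_simps(1-4,6,7) b3 std_index.case
        std_index.distinct std_index.inject mod3_simps cases if_True if_False simp_thms)
  then have table: "pol (?b i) (?b (?d j)) = (if i = j then 1 else 0)" for i j by blast
  have "inj ?b" "independent (range ?b)" "span (range ?b) = UNIV"
    using dual_basis[OF card_std_index, of ?b "\<lambda>j. ?b (?d j)"] table by auto
  then show ?thesis
    unfolding standard_basis_def all_mod3 mod3_simps
    by (simp add: mod3_simps ee mu mv sq t t' uv vu u u3 v v3 pols flip: u3_def v3_def)
qed

end

section \<open>Gradings with an isotropic homogeneous element\<close>

lemma std_degree_simps:
  "std_degree (U 1) = (1, 0, 0)" "std_degree (U 2) = (0, 1, 0)" "std_degree (U 3) = (0, 0, 1)"
  "std_degree (V 1) = (-1, 0, 0)" "std_degree (V 2) = (0, -1, 0)" "std_degree (V 3) = (0, 0, -1)"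
  by (simp_all add: mod3_simps)

lemma Z3_simps [simp]: "carrier Z3 = UNIV" "(a, b, c) \<otimes>\<^bsub>Z3\<^esub> (a', b', c') = (a + a', b + b', c + c')"
  "\<one>\<^bsub>Z3\<^esub> = (0, 0, 0)"
  by (simp_all add: Z3_def DirProd_def integer_group_def)

lemma comm_group_Z3: "comm_group Z3"
proof (rule comm_groupI)
  fix x :: "int \<times> int \<times> int"
  obtain a b c where "x = (a, b, c)" by (cases x)
  then have "(- a, - b, - c) \<otimes>\<^bsub>Z3\<^esub> x = \<one>\<^bsub>Z3\<^esub>" by simp
  then show "\<exists>y\<in>carrier Z3. y \<otimes>\<^bsub>Z3\<^esub> x = \<one>\<^bsub>Z3\<^esub>" by (metis UNIV_I Z3_simps(1))
qed auto

context cayley_algebra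
begin

lemma Gamma_alpha_eq: "Gamma_alpha C b \<alpha> g = span (b ` {k. \<alpha> (std_degree k) = g})"
proof -
  have "span (\<Union>a\<in>{a. \<alpha> a = g}. span (b ` {k. std_degree k = a})) = span (b ` {k. \<alpha> (std_degree k) = g})"
    (is "span ?A = span ?B")
  proof (rule antisym)
    show "span ?A \<subseteq> span ?B"
      by (intro span_minimal subspace_span UN_least span_mono) auto
    show "span ?B \<subseteq> span ?A"
    proof (rule span_mono)
      show "?B \<subseteq> ?A" by (auto intro!: span_base)
    qed
  qed
  then show ?thesis by (simp add: Gamma_alpha_def induced_grading_def cartan_grading_def)
qed

lemma standard_basis_triple_aut:
  assumes c: "nrm c = 1" and b: "standard_basis C b" and b': "standard_basis (isotope C c) b'"
  shows "\<exists>\<phi>\<in>triple_aut C. \<forall>k. \<phi> (b k) = b' k"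
proof (rule triple_aut_from_bases[OF c])
  show "inj b" "independent (range b)" "span (range b) = UNIV"
    using b by (auto simp: standard_basis_def)
  show "inj b'" "independent (range b')" "span (range b') = UNIV"
    using b' by (auto simp: standard_basis_def)
  fix \<phi> i j assume lin: "linear_map \<phi>" and \<phi>: "\<And>k. \<phi> (b k) = b' k"
  have z: "\<phi> 0 = 0" and m: "\<phi> (- x) = - \<phi> x" for x
  proof -
    interpret L: Vector_Spaces.linear "vscale C" "vscale C" \<phi> by (rule lin)
    show "\<phi> 0 = 0" "\<phi> (- x) = - \<phi> x" by (rule L.zero, rule L.neg)
  qed
  note B = b[unfolded standard_basis_def all_mod3 mod3_simps, simplified mod3_simps simp_thms]
  note B' = b'[unfolded standard_basis_def all_mod3 mod3_simps, simplified mod3_simps simp_thms]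
  have "\<forall>i j. \<phi> (b i \<odot> b j) = b' i \<star>\<^bsub>isotope C c\<^esub> b' j"
    unfolding all_std_index using B B' by (simp add: z m \<phi>)
  then show "\<phi> (b i \<odot> b j) = b' i \<star>\<^bsub>isotope C c\<^esub> b' j" by blast
qed

end

context cayley_group
begin

lemma triple_closedD:
  assumes "triple_closed G \<Gamma>" "g1 \<in> carrier G" "g2 \<in> carrier G" "g3 \<in> carrier G"
    "x \<in> \<Gamma> g1" "y \<in> \<Gamma> g2" "z \<in> \<Gamma> g3"
  shows "tri x y z \<in> \<Gamma> (g1 \<otimes> g2 \<otimes> g3)"
  using assms unfolding triple_closed_def by blast

text \<open>Either the degrees h and d agree or the coefficient vanishes. Hence projections formed
  with homogeneous dual vectors respect degrees.\<close>

lemma homogeneous_projection: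
  assumes fam: "orthogonal_family G \<Gamma>" and c: "h \<in> carrier G" "d \<in> carrier G"
    and z: "z \<in> \<Gamma> h" "x \<in> \<Gamma> d" "y \<in> \<Gamma> (inv d)"
  shows "pol z y \<cdot> x \<in> \<Gamma> h"
proof (cases "h \<otimes> inv d = \<one>")
  case True
  then have "h = d" using c by (metis G.inv_equality G.inv_inv G.inv_closed)
  then show ?thesis using z c orthogonal_familyD(1)[OF fam] subspace_scale by blast
next
  case False
  then have "pol z y = 0" using orthogonal_familyD(2)[OF fam c(1) _ z(1,3)] c(2) by simp
  then show ?thesis using c orthogonal_familyD(1)[OF fam] subspace_0 by simp
qed

lemma hom_Z3D:
  assumes "\<alpha> \<in> hom Z3 G"
  shows "\<alpha> x \<in> carrier G" "\<alpha> (a + a', b + b', c + c') = \<alpha> (a, b, c) \<otimes> \<alpha> (a', b', c')"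
    "\<alpha> (0, 0, 0) = \<one>" "\<alpha> (- a, - b, - c) = inv (\<alpha> (a, b, c))"
proof -
  interpret Z: comm_group Z3 by (rule comm_group_Z3)
  interpret H: group_hom Z3 G \<alpha> by unfold_locales (rule assms)
  show "\<alpha> x \<in> carrier G" using H.hom_closed[of x] by simp
  have add: "\<alpha> (a + a', b + b', c + c') = \<alpha> (a, b, c) \<otimes> \<alpha> (a', b', c')" for a b c a' b' c'
    using H.hom_mult[of "(a, b, c)" "(a', b', c')"] by simp
  then show "\<alpha> (a + a', b + b', c + c') = \<alpha> (a, b, c) \<otimes> \<alpha> (a', b', c')" .
  show one: "\<alpha> (0, 0, 0) = \<one>" using H.hom_one by simp
  have "\<alpha> (- a, - b, - c) \<otimes> \<alpha> (a, b, c) = \<one>"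
    using add[of "- a" a "- b" b "- c" c] one by simp
  then show "\<alpha> (- a, - b, - c) = inv (\<alpha> (a, b, c))"
    using H.hom_closed by (intro G.inv_equality[symmetric]) auto
qed

lemma hom_Z3_exists:
  assumes d: "d1 \<in> carrier G" "d2 \<in> carrier G" "d3 \<in> carrier G"
  shows "\<exists>\<alpha>\<in>hom Z3 G. \<alpha> (1, 0, 0) = d1 \<and> \<alpha> (0, 1, 0) = d2 \<and> \<alpha> (0, 0, 1) = d3"
proof
  let ?\<alpha> = "\<lambda>(i::int, j::int, k::int). d1 [^] i \<otimes> d2 [^] j \<otimes> d3 [^] k"
  show "?\<alpha> \<in> hom Z3 G"
  proof (rule homI)
    fix x y show "?\<alpha> (x \<otimes>\<^bsub>Z3\<^esub> y) = ?\<alpha> x \<otimes> ?\<alpha> y"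
      using d by (cases x; cases y) (simp add: G.int_pow_mult G.m_ac)
  qed (use d in auto)
  show "?\<alpha> (1, 0, 0) = d1 \<and> ?\<alpha> (0, 1, 0) = d2 \<and> ?\<alpha> (0, 0, 1) = d3"
    using d by simp
qed

section \<open>Peirce components of a homogeneous idempotent\<close>

context
  fixes \<Gamma> e g
  assumes fam: "orthogonal_family G \<Gamma>" and tc: "triple_closed G \<Gamma>" and g: "g \<in> carrier G"
    and e: "idem e" "e \<in> \<Gamma> g" "\<e> - e \<in> \<Gamma> (inv g)"
begin

lemma hom_subspace: "h \<in> carrier G \<Longrightarrow> subspace (\<Gamma> h)"
  using orthogonal_familyD(1)[OF fam] .

text \<open>Since the complement of e has conjugate e and e e = e, multiplication by e is
  \<open>tri e (\<e> - e)\<close>, whose two degrees g and \<open>inv g\<close> cancel; similarly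
  for the complement.\<close>

lemma peirce_hom:
  assumes z: "z \<in> \<Gamma> h" "h \<in> carrier G"
  defines "Q \<equiv> z - pol z (\<e> - e) \<cdot> e - pol z e \<cdot> (\<e> - e)"
  shows "e \<odot> Q \<in> \<Gamma> h" "(\<e> - e) \<odot> Q \<in> \<Gamma> h"
proof -
  have "pol z (\<e> - e) \<cdot> e \<in> \<Gamma> h"
    by (rule homogeneous_projection[OF fam z(2) g z(1) e(2,3)])
  moreover have "pol z e \<cdot> (\<e> - e) \<in> \<Gamma> h"
    using homogeneous_projection[OF fam z(2) _ z(1) e(3), of e] e(2) g by simp
  ultimately have Q: "Q \<in> \<Gamma> h"
    unfolding Q_def using z by (intro subspace_diff hom_subspace)
  have "cj (\<e> - e) = e" using idem_conj[OF idem_compl[OF e(1)]] by simp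
  then have 1: "e \<odot> Q = tri e (\<e> - e) Q" "(\<e> - e) \<odot> Q = tri (\<e> - e) e Q"
    using idem_square[OF e(1)] idem_square[OF idem_compl[OF e(1)]] e(1)
    by (simp_all add: triple_def idem_conj)
  have "tri e (\<e> - e) Q \<in> \<Gamma> (g \<otimes> inv g \<otimes> h)" "tri (\<e> - e) e Q \<in> \<Gamma> (inv g \<otimes> g \<otimes> h)"
    by (rule triple_closedD[OF tc]; use Q z g e in simp)+
  then show "e \<odot> Q \<in> \<Gamma> h" "(\<e> - e) \<odot> Q \<in> \<Gamma> h"
    unfolding 1 using g z by simp_all
qed

text \<open>Starting from \<open>u1 = v1 = 0\<close> this yields a first dual pair, and from a dual pair a second one.
  If there were none, four vectors would span the algebra.\<close>

lemma next_peirce: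
  assumes d: "d \<in> carrier G" and u1: "u1 \<in> \<Gamma> d" "peirce e u1"
    and v1: "v1 \<in> \<Gamma> (inv d)" "peirce (\<e> - e) v1" and p: "pol u1 v1 = 1 \<or> u1 = 0 \<and> v1 = 0"
  obtains u h v where "h \<in> carrier G" "u \<in> \<Gamma> h" "peirce e u" "pol u v1 = 0"
    "v \<in> \<Gamma> (inv h)" "peirce (\<e> - e) v" "pol u v = 1" "pol u1 v = 0"
proof -
  note D = orthogonal_familyD[OF fam]
  define Q where "Q z = z - pol z (\<e> - e) \<cdot> e - pol z e \<cdot> (\<e> - e)" for z
  \<comment> \<open>The e-Peirce part of z, corrected so that it becomes orthogonal to v1.\<close>
  define R where "R z = e \<odot> Q z - pol (e \<odot> Q z) v1 \<cdot> u1" for z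
  have dec: "peirce e (e \<odot> Q z)" "peirce (\<e> - e) ((\<e> - e) \<odot> Q z)"
    "z = pol z (\<e> - e) \<cdot> e + pol z e \<cdot> (\<e> - e) + e \<odot> Q z + (\<e> - e) \<odot> Q z" for z
    using peirce_decomposition[OF e(1), of z] by (simp_all add: Q_def)
  note e' = idem_compl[OF e(1)]
  have polU: "pol u z = pol u ((\<e> - e) \<odot> Q z)" if u: "peirce e u" for u z
  proof -
    have "pol u z = pol u (pol z (\<e> - e) \<cdot> e + pol z e \<cdot> (\<e> - e) + e \<odot> Q z + (\<e> - e) \<odot> Q z)"
      by (rule arg_cong[OF dec(3)])
    also have "\<dots> = pol u ((\<e> - e) \<odot> Q z)"
      using peirce_compl_pol(1)[OF u] peirce_pol[OF e(1) u dec(1)[of z]] u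
      by (simp add: pol_add_right pol_scale_right peirce_def)
    finally show ?thesis .
  qed
  have polV: "pol v z = pol v (e \<odot> Q z)" if v: "peirce (\<e> - e) v" for v z
  proof -
    have "pol v z = pol v (pol z (\<e> - e) \<cdot> e + pol z e \<cdot> (\<e> - e) + e \<odot> Q z + (\<e> - e) \<odot> Q z)"
      by (rule arg_cong[OF dec(3)])
    also have "\<dots> = pol v (e \<odot> Q z)"
      using peirce_compl_pol(2)[OF v] peirce_pol[OF e' v dec(2)[of z]] v
      by (simp add: pol_add_right pol_scale_right peirce_def)
    finally show ?thesis .
  qed
  have linR: "linear_map R"
    unfolding Vector_Spaces.linear_iff
    by (simp add: vector_space_axioms R_def Q_def bilinear_simps scale_left_distrib algebra_simps)
  have "\<exists>h\<in>carrier G. \<exists>z\<in>\<Gamma> h. R z \<noteq> 0"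
  proof (rule ccontr)
    assume no: "\<not> (\<exists>h\<in>carrier G. \<exists>z\<in>\<Gamma> h. R z \<noteq> 0)"
    interpret P: vector_space_pair "vscale C" "vscale C" by unfold_locales
    have "R z = 0" for z
      by (rule P.linear_eq_0_on_span[OF linR, of "\<Union>h\<in>carrier G. \<Gamma> h"])
        (use no D(3) in auto)
    then have U: "e \<odot> Q z = pol (e \<odot> Q z) v1 \<cdot> u1" for z by (simp add: R_def)
    \<comment> \<open>By \<open>polV\<close> the pairing of v with z only sees the e-Peirce part of
      z, which by \<open>U\<close> is a multiple of u1. So v is determined by its pairing with
      u1.\<close>
    have V: "v = pol u1 v \<cdot> v1" if v: "peirce (\<e> - e) v" for v
    proof (rule nondegenerate_eq)
      fix z
      have "pol v z = pol (e \<odot> Q z) v1 * pol v u1"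
        using polV[OF v, of z] U[of z] by (metis pol_scale_right)
      moreover have "pol v1 z = pol (e \<odot> Q z) v1"
        using polV[OF v1(2), of z] by (simp add: pol_commute)
      ultimately show "pol v z = pol (pol u1 v \<cdot> v1) z"
        by (simp add: pol_scale_left pol_commute[of v])
    qed
    have "z \<in> span {e, \<e> - e, u1, v1}" for z
    proof -
      have "e \<odot> Q z \<in> span {e, \<e> - e, u1, v1}" "(\<e> - e) \<odot> Q z \<in> span {e, \<e> - e, u1, v1}"
        using U[of z] V[OF dec(2)[of z]] by (metis insertI1 insertI2 span_base span_scale)+
      then show ?thesis
        by (subst dec(3)[of z]) (intro span_add span_scale; auto intro: span_base)
    qed
    then have "8 \<le> card {e, \<e> - e, u1, v1}" by (intro card_spanning) auto
    moreover have "card {e, \<e> - e, u1, v1} \<le> 4"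
      by (simp add: card_insert_if)
    ultimately show False by simp
  qed
  then obtain h z where z: "h \<in> carrier G" "z \<in> \<Gamma> h" "R z \<noteq> 0" by blast
  have Ph: "e \<odot> Q z \<in> \<Gamma> h" using peirce_hom[OF z(2,1)] by (simp add: Q_def)
  have "pol (e \<odot> Q z) v1 \<cdot> u1 \<in> \<Gamma> h"
    by (rule homogeneous_projection[OF fam z(1) d Ph u1(1) v1(1)])
  then have Rh: "R z \<in> \<Gamma> h" unfolding R_def using Ph z by (intro subspace_diff hom_subspace)
  have RU: "peirce e (R z)" unfolding R_def using dec u1 by (intro peirce_diff peirce_scale)
  have Rv: "pol (R z) v1 = 0" using p by (auto simp: R_def bilinear_simps)
  obtain y where y: "y \<in> \<Gamma> (inv h)" "pol (R z) y = 1"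
    using orthogonal_family_nondegenerate[OF fam Rh z(1,3)] by blast
  define v0 where "v0 = (\<e> - e) \<odot> Q y"
  have v0: "v0 \<in> \<Gamma> (inv h)" "peirce (\<e> - e) v0" "pol (R z) v0 = 1"
    using peirce_hom[OF y(1)] z dec(2) polU[OF RU, of y] y by (simp_all add: v0_def Q_def)
  \<comment> \<open>Makes the partner orthogonal to u1; its pairing with \<open>R z\<close> is
    unchanged because \<open>R z\<close> is orthogonal to v1.\<close>
  define v where "v = v0 - pol u1 v0 \<cdot> v1"
  have "pol u1 v0 \<cdot> v1 \<in> \<Gamma> (inv h)"
    using homogeneous_projection[OF fam _ _ v0(1) v1(1), of u1] u1(1) d z(1)
    by (simp add: pol_commute[of u1])
  then have "v \<in> \<Gamma> (inv h)" unfolding v_def using v0 z by (intro subspace_diff hom_subspace) auto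
  moreover have "peirce (\<e> - e) v" unfolding v_def using v0 v1 by (intro peirce_diff peirce_scale)
  moreover have "pol (R z) v = 1" "pol u1 v = 0"
    using v0 Rv p by (auto simp: v_def bilinear_simps)
  ultimately show ?thesis using that z Rh RU Rv by blast
qed

lemma homogeneous_standard_basis:
  "\<exists>\<alpha>\<in>hom Z3 G. \<exists>b. standard_basis C b \<and> (\<forall>k. b k \<in> \<Gamma> (\<alpha> (std_degree k)))"
proof -
  note e' = idem_compl[OF e(1)]
  have "peirce e 0" "peirce (\<e> - e) 0" by (simp_all add: peirce_def)
  moreover have "0 \<in> \<Gamma> \<one>" "0 \<in> \<Gamma> (inv \<one>)" by (simp_all add: hom_subspace subspace_0)
  ultimately obtain u1 v1 d1 where 1: "d1 \<in> carrier G" "u1 \<in> \<Gamma> d1" "peirce e u1"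
      "v1 \<in> \<Gamma> (inv d1)" "peirce (\<e> - e) v1" "pol u1 v1 = 1"
    using next_peirce[of \<one> 0 0] by (metis G.one_closed)
  obtain u2 v2 d2 where 2: "d2 \<in> carrier G" "u2 \<in> \<Gamma> d2" "peirce e u2" "pol u2 v1 = 0"
      "v2 \<in> \<Gamma> (inv d2)" "peirce (\<e> - e) v2" "pol u2 v2 = 1" "pol u1 v2 = 0"
    using next_peirce[OF 1(1-5) disjI1[OF 1(6)]] by metis
  \<comment> \<open>The degree of \<open>tri v1 (\<e> - e) v2\<close>, which equals v1 v2, written
    in the order in which the triple product multiplies degrees.\<close>
  define d3 where "d3 = inv d1 \<otimes> inv g \<otimes> inv d2"
  have d3: "d3 \<in> carrier G" using 1 2 g by (simp add: d3_def)
  have inv3: "inv d3 = d1 \<otimes> g \<otimes> d2"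
    using 1 2 g by (simp add: d3_def G.inv_mult_group G.m_ac)
  \<comment> \<open>This is the relation deg(e1) = -(1,1,1) of the Cartan grading, which lets a
    homomorphism defined on the u's also give the degree of e.\<close>
  have deg_e: "inv d1 \<otimes> inv d2 \<otimes> inv d3 = g"
  proof -
    have "inv d1 \<otimes> inv d2 = inv (d1 \<otimes> d2)" "d1 \<otimes> g \<otimes> d2 = (d1 \<otimes> d2) \<otimes> g"
      using 1 2 g by (simp_all add: G.inv_mult_group G.m_ac)
    then have "inv d1 \<otimes> inv d2 \<otimes> inv d3 = inv (d1 \<otimes> d2) \<otimes> ((d1 \<otimes> d2) \<otimes> g)"
      by (simp add: inv3)
    also have "\<dots> = inv (d1 \<otimes> d2) \<otimes> (d1 \<otimes> d2) \<otimes> g"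
      using 1 2 g by (simp only: G.m_assoc G.inv_closed G.m_closed)
    also have "\<dots> = g" using 1 2 g by simp
    finally show ?thesis .
  qed
  have "tri v1 (\<e> - e) v2 \<in> \<Gamma> d3"
    unfolding d3_def using 1 2 g e by (intro triple_closedD[OF tc]) auto
  moreover have "tri u1 e u2 \<in> \<Gamma> (inv d3)"
    unfolding inv3 using 1 2 g e by (intro triple_closedD[OF tc]) auto
  ultimately have u3: "v1 \<odot> v2 \<in> \<Gamma> d3" and v3: "u1 \<odot> u2 \<in> \<Gamma> (inv d3)"
    using idem_conj[OF e(1)] idem_conj[OF e'] peirce_mult[OF e(1) 1(3)] peirce_mult[OF e' 1(5)]
    by (simp_all add: triple_def)
  obtain \<alpha> where \<alpha>: "\<alpha> \<in> hom Z3 G" "\<alpha> (1, 0, 0) = d1" "\<alpha> (0, 1, 0) = d2" "\<alpha> (0, 0, 1) = d3"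
    using hom_Z3_exists[OF 1(1) 2(1) d3] by blast
  note H = hom_Z3D[OF \<alpha>(1)]
  have neg: "\<alpha> (-1, 0, 0) = inv d1" "\<alpha> (0, -1, 0) = inv d2" "\<alpha> (0, 0, -1) = inv d3"
    using H(4)[of 1 0 0] H(4)[of 0 1 0] H(4)[of 0 0 1] \<alpha> by simp_all
  have "\<alpha> (-1, -1, -1) = g"
    using H(2)[of "-1" 0 0 "-1" 0 0] H(2)[of "-1" 0 "-1" 0 0 "-1"] neg deg_e by simp
  moreover from this have "\<alpha> (1, 1, 1) = inv g" using H(4)[of "-1" "-1" "-1"] by simp
  ultimately have "\<forall>k. std_basis_of e u1 u2 v1 v2 k \<in> \<Gamma> (\<alpha> (std_degree k))"
    unfolding all_std_index std_degree_simps std_basis_of_simps std_degree.simps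
    using \<alpha> neg 1 2 u3 v3 e by simp
  moreover have "standard_basis C (std_basis_of e u1 u2 v1 v2)"
    using 1 2 e by (intro standard_basis_of)
  ultimately show ?thesis using \<alpha>(1) by blast
qed

end

lemma isotropic_grading_iso:
  assumes two: "(2::'f) \<noteq> 0"
    and fam: "orthogonal_family G \<Gamma>" and tc: "triple_closed G \<Gamma>" and b: "standard_basis C b"
    and x: "g \<in> carrier G" "x \<in> \<Gamma> g" "x \<noteq> 0" "nrm x = 0"
  shows "\<exists>\<alpha>\<in>hom Z3 G. grading_iso C G \<Gamma> (Gamma_alpha C b \<alpha>)"
proof -
  obtain y0 where y0: "y0 \<in> \<Gamma> (inv g)" "pol x y0 = 1"
    using orthogonal_family_nondegenerate[OF fam x(2,1,3)] by blast
  \<comment> \<open>n(y) = n(y0) - n(y0) n(x, y0) = 0, and the pairing with x is still 1 because x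
    is isotropic.\<close>
  define y where "y = y0 - nrm y0 \<cdot> x"
  have xx: "pol x x = 0" using x by (simp add: pol_self)
  have y: "nrm y = 0" "pol x y = 1"
    using y0 x xx by (simp_all add: y_def nrm_diff norm_scale bilinear_simps pol_commute[of y0])
  \<comment> \<open>The correction is homogeneous of the same degree as y0: n(y0) is half of
    \<open>pol y0 y0\<close>, which vanishes unless g is its own inverse.\<close>
  have "(1/2) \<cdot> (pol y0 y0 \<cdot> x) \<in> \<Gamma> (inv g)"
    by (intro subspace_scale orthogonal_familyD(1)[OF fam]
        homogeneous_projection[OF fam _ x(1) y0(1) x(2) y0(1)] G.inv_closed x(1))
  then have "y \<in> \<Gamma> (inv g)"
    using y0 two x(1) orthogonal_familyD(1)[OF fam] by (simp add: y_def pol_self subspace_diff)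
  define c where "c = x + y"
  have c: "nrm c = 1" using x y by (simp add: c_def nrm_add)
  interpret I: cayley_group "isotope C c" G
    by (intro cayley_group.intro cayley_algebra_isotope c G.comm_group_axioms)
  have "I.orthogonal_family G \<Gamma>" "I.triple_closed G \<Gamma>"
    using fam tc unfolding I.orthogonal_family_def orthogonal_family_def
      I.triple_closed_def triple_closed_def by (simp_all add: triple_isotope[OF c])
  moreover have "I.idem x" "vunit (isotope C c) - x = y"
    unfolding I.idem_def using x y xx by (simp_all add: c_def pol_add_right)
  ultimately obtain \<alpha> b' where \<alpha>: "\<alpha> \<in> hom Z3 G" and b': "standard_basis (isotope C c) b'"
      "\<forall>k. b' k \<in> \<Gamma> (\<alpha> (std_degree k))"
    using I.homogeneous_standard_basis[of \<Gamma> g x] x \<open>y \<in> \<Gamma> (inv g)\<close> by auto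
  obtain \<phi> where \<phi>: "\<phi> \<in> triple_aut C" "\<forall>k. \<phi> (b k) = b' k"
    using standard_basis_triple_aut[OF c b b'(1)] by blast
  have "span (range b') = UNIV" using b'(1) by (simp add: standard_basis_def)
  then have "\<Gamma> h = span (b' ` {k. \<alpha> (std_degree k) = h})" if "h \<in> carrier G" for h
    using homogeneous_basis_components[OF fam, of "\<lambda>k. \<alpha> (std_degree k)" b' h] b'(2) that
      hom_Z3D(1)[OF \<alpha>] by blast
  then have "\<phi> ` Gamma_alpha C b \<alpha> h = \<Gamma> h" if "h \<in> carrier G" for h
    using that \<phi>(2) by (simp add: Gamma_alpha_eq triple_aut_span[OF \<phi>(1)] image_image)
  then have "grading_iso C G (Gamma_alpha C b \<alpha>) \<Gamma>"
    unfolding grading_iso_def using \<phi>(1) by blast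
  then show ?thesis using \<alpha> grading_iso_sym by blast
qed

text \<open>With everything in degree e, the construction of homogeneous standard bases yields the
  bare existence of a standard basis.\<close>

lemma trivial_family:
  "orthogonal_family G (\<lambda>g. if g = \<one> then UNIV else {0})"
  "triple_closed G (\<lambda>g. if g = \<one> then UNIV else {0})"
proof -
  have "(\<Union>g\<in>carrier G. if g = \<one> then UNIV else {0}) = (UNIV :: 'c set)" by auto
  then show "orthogonal_family G (\<lambda>g. if g = \<one> then UNIV else {0})"
    unfolding orthogonal_family_def by auto
  show "triple_closed G (\<lambda>g. if g = \<one> then UNIV else {0})"
    unfolding triple_closed_def by auto
qed

end

lemma standard_basis_exists:
  fixes C :: "('f::alg_closed_field, 'c::ab_group_add) quad_algebra"
  assumes "cayley_algebra C" and two: "(2::'f) \<noteq> 0"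
  shows "\<exists>b. standard_basis C b"
proof -
  interpret cayley_group C Z3
    by (intro cayley_group.intro comm_group_Z3 assms)
  obtain a where a: "pol a \<e> = 0" "nrm a \<noteq> 0"
    using orthonormal_extension[OF two, of "{\<e>}"] by auto
  \<comment> \<open>Chosen so that the vector 1/2 + r a, of trace 1, has norm 1/4 + r^2 n(a) =
    0.\<close>
  obtain r where r: "r\<^sup>2 = - 1 / (4 * nrm a)" using alg_closed_has_square_root by blast
  have "(4::'f) \<noteq> 0" using two by (metis mult_2_right mult_eq_0_iff numeral_Bit0)
  define e where "e = (1/2) \<cdot> \<e> + r \<cdot> a"
  have "nrm e = (1/2)\<^sup>2 + r\<^sup>2 * nrm a"
    using a by (simp add: e_def nrm_add norm_scale bilinear_simps pol_commute[of \<e>])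
  then have "nrm e = 0" using a(2) r two \<open>(4::'f) \<noteq> 0\<close> by (simp add: power_divide)
  moreover have "pol e \<e> = 1" using a two by (simp add: e_def bilinear_simps pol_self)
  ultimately have "idem e" by (simp add: idem_def)
  then show ?thesis
    using homogeneous_standard_basis[OF trivial_family, of "\<one>\<^bsub>Z3\<^esub>" e] G.inv_one
    by (auto simp del: Z3_simps(3))
qed

section \<open>Cayley-Dickson bases\<close>

lemma all_mod7: "(\<forall>i::7. P i) \<longleftrightarrow> P 1 \<and> P 2 \<and> P 3 \<and> P 4 \<and> P 5 \<and> P 6 \<and> P 7"
  by (metis exhaust_mod7)

text \<open>The lines {m, m+1, m+3} of the Fano plane: 0, 1, 3 is a perfect difference set modulo 7,
  so any two distinct indices lie on exactly one line. Verifying a table then takes seven generic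
  cases instead of 49.\<close>

lemma mod7_line_cases:
  fixes i j :: 7
  obtains m where "i = m" "j = m" | m where "i = m" "j = m + 1" | m where "i = m + 1" "j = m"
    | m where "i = m + 1" "j = m + 3" | m where "i = m + 3" "j = m + 1"
    | m where "i = m + 3" "j = m" | m where "i = m" "j = m + 3"
proof -
  have "\<forall>i::7. j = i \<or> j = i + 1 \<or> j + 1 = i \<or> j = i + 2 \<or> j + 2 = i \<or> j + 3 = i \<or> j = i + 3"
    using exhaust_mod7[of j] by (elim disjE; simp add: all_mod7)
  moreover have "i = (i - 1) + 1" "i + 2 = (i - 1) + 3" "j = (j - 1) + 1" "j + 2 = (j - 1) + 3" by simp_all
  ultimately show ?thesis using that by (metis (no_types))
qed

text \<open>Indexing by \<open>7 option\<close>, a type with eight elements, treats the unit and the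
  \<open>w i\<close> as one family.\<close>

definition cd_vec :: "('f::field, 'c::ab_group_add) quad_algebra \<Rightarrow> (7 \<Rightarrow> 'c) \<Rightarrow> 7 option \<Rightarrow> 'c" where
  "cd_vec C w k = (case k of None \<Rightarrow> vunit C | Some i \<Rightarrow> w i)"

lemma cd_vec_simps [simp]: "cd_vec C w None = vunit C" "cd_vec C w (Some i) = w i"
  by (simp_all add: cd_vec_def)

lemma range_cd_vec: "range (cd_vec C w) = insert (vunit C) (range w)"
  by (auto simp: cd_vec_def split: option.splits intro: range_eqI[of _ _ None] range_eqI[of _ _ "Some _"])

lemma inj_cd_vec: "inj (cd_vec C w) \<longleftrightarrow> inj w \<and> vunit C \<notin> range w"
proof
  assume "inj (cd_vec C w)"
  then have "cd_vec C w k = cd_vec C w l \<longleftrightarrow> k = l" for k l by (simp add: inj_eq)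
  from this[of "Some _" "Some _"] this[of None "Some _"] show "inj w \<and> vunit C \<notin> range w"
    by (auto simp: inj_def)
next
  assume *: "inj w \<and> vunit C \<notin> range w"
  then have "vunit C \<noteq> w i" "w i \<noteq> vunit C" for i by (metis rangeI)+
  with * show "inj (cd_vec C w)"
    by (auto simp: inj_def cd_vec_def split: option.splits)
qed

context cayley_algebra
begin

text \<open>By \<open>square_eq\<close> these elements square to -1.\<close>

definition imag :: "'c \<Rightarrow> bool" where
  "imag x \<longleftrightarrow> pol x \<e> = 0 \<and> nrm x = 1"

lemma imag_conj: "imag x \<Longrightarrow> cj x = - x"
  by (simp add: imag_def conj_eq)

lemma imag_square: "imag x \<Longrightarrow> x \<odot> x = - \<e>"
  by (simp add: imag_def square_eq)

lemma imag_left: "imag x \<Longrightarrow> x \<odot> (x \<odot> y) = - y"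
  by (simp add: left_alternative imag_square prod_simps)

lemma imag_right: "imag x \<Longrightarrow> (y \<odot> x) \<odot> x = - y"
  by (simp add: right_alternative imag_square prod_simps)

lemma imag_anticommute: "imag x \<Longrightarrow> imag y \<Longrightarrow> pol x y = 0 \<Longrightarrow> y \<odot> x = - (x \<odot> y)"
  using prod_conj_linearized[of x y] by (simp add: imag_conj prod_simps add_eq_0_iff2)

lemma imag_exchange:
  assumes "imag x" "imag z" "pol x z = 0"
  shows "x \<odot> (z \<odot> y) = - (z \<odot> (x \<odot> y))"
  using conj_left_prod_linearized[of x z y] assms
  by (simp add: imag_conj prod_simps) (metis minus_minus)

text \<open>x, y and x y multiply like the quaternion units i, j, k: orthogonal elements of trace
  zero anticommute, and alternativity settles products with a repeated factor.\<close>

lemma imag_prod: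
  assumes "imag x" "imag y" "pol x y = 0"
  shows "imag (x \<odot> y)" "pol x (x \<odot> y) = 0" "pol y (x \<odot> y) = 0"
    "y \<odot> (x \<odot> y) = x" "(x \<odot> y) \<odot> x = y" "(x \<odot> y) \<odot> y = - x" "x \<odot> (x \<odot> y) = - y"
proof -
  have yx: "x \<odot> y = - (y \<odot> x)" using imag_anticommute[of y x] assms by (simp add: pol_commute)
  show "imag (x \<odot> y)"
    using assms pol_adjoint_right[of x y \<e>] by (simp add: imag_def norm_mult unit_left imag_conj[unfolded imag_def] pol_minus_right)
  show "pol x (x \<odot> y) = 0" "pol y (x \<odot> y) = 0"
    using pol_prod_left[of x \<e> y] pol_prod_right[of \<e> y x] assms
    by (simp_all add: unit_left unit_right imag_def pol_commute)
  show "(x \<odot> y) \<odot> y = - x" "x \<odot> (x \<odot> y) = - y" using assms by (simp_all add: imag_left imag_right)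
  show "y \<odot> (x \<odot> y) = x" "(x \<odot> y) \<odot> x = y"
    unfolding yx using assms by (simp_all add: imag_left imag_right prod_simps)
qed

lemma pol_zero_sym: "pol x y = 0 \<Longrightarrow> pol y x = 0"
  by (simp add: pol_commute)

text \<open>By \<open>imag_prod\<close> each line m, m+1, m+3 is a quaternion triple, which supplies
  the other products and the orthogonality on it; every pair of indices lies on a line.\<close>

lemma cd_basisI:
  assumes two: "(2::'f) \<noteq> 0" and im: "\<And>i. imag (w i)"
    and orth: "\<And>i. pol (w i) (w (i + 1)) = 0" and pr: "\<And>i. w i \<odot> w (i + 1) = w (i + 3)"
  shows "cd_basis C w"
proof -
  note Q = imag_prod[OF im im orth, unfolded pr]
  have i0: "pol (w i) \<e> = 0" and i1: "nrm (w i) = 1" for i using im by (simp_all add: imag_def)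
  have "pol (w i) (w j) = 0" if "i \<noteq> j" for i j
    using that by (rule_tac mod7_line_cases[of i j])
      (simp_all only: orth Q(2,3) orth[THEN pol_zero_sym] Q(2,3)[THEN pol_zero_sym])
  then have "pol (cd_vec C w i) (cd_vec C w j) = 0" if "i \<noteq> j" for i j
    using that i0 i0[THEN pol_zero_sym] by (cases i; cases j) simp_all
  moreover have "pol (cd_vec C w i) (cd_vec C w i) \<noteq> 0" for i
    using two i1 by (cases i) (simp_all add: pol_self)
  ultimately have "inj (cd_vec C w)" "independent (range (cd_vec C w))" "span (range (cd_vec C w)) = UNIV"
    using dual_basis[of "cd_vec C w" "cd_vec C w"] by simp_all
  then show ?thesis
    unfolding cd_basis_def range_cd_vec inj_cd_vec
    using pr Q imag_square[OF im] imag_anticommute[OF im im orth] by auto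
qed

definition cd_of :: "'c \<Rightarrow> 'c \<Rightarrow> 'c \<Rightarrow> 7 \<Rightarrow> 'c" where
  "cd_of x y z i = (if i = 1 then x else if i = 2 then y else if i = 3 then z
     else if i = 4 then x \<odot> y else if i = 5 then y \<odot> z
     else if i = 6 then z \<odot> (x \<odot> y) else x \<odot> z)"

text \<open>With \<open>x = w 1\<close>, \<open>y = w 2\<close>, \<open>z = w 3\<close>, this identity, applied along the cyclic index, gives the
  three lines of the Fano plane that are not part of the definition of \<open>cd_of\<close> below.\<close>

lemma imag_product_chain:
  assumes "imag x" "imag y" "imag z" "pol x y = 0" "pol y z = 0" "pol x z = 0" "pol (x \<odot> y) z = 0"
  shows "(x \<odot> y) \<odot> (y \<odot> z) = x \<odot> z"
proof -
  note xy = imag_prod[OF assms(1,2,4)]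
  have "(x \<odot> y) \<odot> (y \<odot> z) = - (y \<odot> ((x \<odot> y) \<odot> z))"
    using imag_exchange[OF xy(1) assms(2)] xy(3) by (simp add: pol_commute)
  also have "(x \<odot> y) \<odot> z = - (z \<odot> (x \<odot> y))"
    using imag_anticommute[OF assms(3) xy(1)] assms by (simp add: pol_commute)
  also have "- (y \<odot> - (z \<odot> (x \<odot> y))) = - (z \<odot> (y \<odot> (x \<odot> y)))"
    using imag_exchange[OF assms(2,3,5)] by (simp add: prod_simps)
  also have "y \<odot> (x \<odot> y) = x" by (rule xy)
  also have "- (z \<odot> x) = x \<odot> z"
    using imag_anticommute[OF assms(1,3,6)] by simp
  finally show ?thesis .
qed

lemma cd_basis_of:
  assumes two: "(2::'f) \<noteq> 0" and im: "imag x" "imag y" "imag z"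
    and o: "pol x y = 0" "pol y z = 0" "pol x z = 0" "pol (x \<odot> y) z = 0"
  shows "cd_basis C (cd_of x y z)"
proof -
  note xy = imag_prod[OF im(1,2) o(1)] and yz = imag_prod[OF im(2,3) o(2)]
    and xz = imag_prod[OF im(1,3) o(3)]
  have zxy: "pol z (x \<odot> y) = 0" using o by (simp add: pol_commute)
  note zxy' = imag_prod[OF im(3) xy(1) zxy]
  \<comment> \<open>For the next three claims: anticommuting brings the common factor to the same
    side of both products, where it cancels from the form.\<close>
  have o4: "pol (x \<odot> y) (y \<odot> z) = 0"
  proof -
    have "y \<odot> z = - (z \<odot> y)" using imag_anticommute[OF im(2,3) o(2)] by simp
    then show ?thesis using pol_prod_right[of x y z] o(3) by (simp add: pol_minus_right)
  qed
  have o5: "pol (y \<odot> z) (z \<odot> (x \<odot> y)) = 0"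
  proof -
    have "y \<odot> z = - (z \<odot> y)" using imag_anticommute[OF im(2,3) o(2)] by simp
    then show ?thesis using pol_prod_left[of z y "x \<odot> y"] xy(3) by (simp add: pol_minus_left)
  qed
  have o6: "pol (z \<odot> (x \<odot> y)) (x \<odot> z) = 0"
  proof -
    have "x \<odot> z = - (z \<odot> x)" using imag_anticommute[OF im(1,3) o(3)] by simp
    then show ?thesis using pol_prod_left[of z "x \<odot> y" x] xy(2)
      by (simp add: pol_minus_right pol_commute[of _ x])
  qed
  have c1: "(x \<odot> y) \<odot> (y \<odot> z) = x \<odot> z"
    using imag_product_chain[OF im o] .
  have c2: "(y \<odot> z) \<odot> (z \<odot> (x \<odot> y)) = x"
    using imag_product_chain[OF im(2,3) xy(1) o(2) zxy xy(3)] o4 xy(4) by (simp add: pol_commute)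
  have c3: "(z \<odot> (x \<odot> y)) \<odot> (x \<odot> z) = y"
    using imag_product_chain[OF im(3) xy(1) yz(1) zxy o4 yz(3)] o5 yz(4) c1 by (simp add: pol_commute)
  have "\<forall>i. imag (cd_of x y z i)"
    unfolding all_mod7 by (simp add: cd_of_def im xy yz xz zxy')
  moreover have "\<forall>i. pol (cd_of x y z i) (cd_of x y z (i + 1)) = 0"
    unfolding all_mod7 using zxy o o4 o5 o6 xz(2) by (simp add: cd_of_def pol_commute[of "x \<odot> z" x])
  moreover have "\<forall>i. cd_of x y z i \<odot> cd_of x y z (i + 1) = cd_of x y z (i + 3)"
    unfolding all_mod7 by (simp add: cd_of_def c1 c2 c3 xz)
  ultimately show ?thesis by (intro cd_basisI two) auto
qed

lemma cd_basisD:
  assumes "cd_basis C w"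
  shows "inj (cd_vec C w)" "independent (range (cd_vec C w))" "span (range (cd_vec C w)) = UNIV"
    "w i \<odot> w i = - \<e>" "w i \<odot> w (i + 1) = w (i + 3)" "w (i + 1) \<odot> w i = - w (i + 3)"
    "w (i + 1) \<odot> w (i + 3) = w i" "w (i + 3) \<odot> w (i + 1) = - w i"
    "w (i + 3) \<odot> w i = w (i + 1)" "w i \<odot> w (i + 3) = - w (i + 1)"
  using assms unfolding cd_basis_def range_cd_vec inj_cd_vec by auto

text \<open>Comparing w w = -1 with \<open>square_eq\<close> makes a multiple of w equal to a
  multiple of the unit; independence of the two forces trace 0 and then norm 1.\<close>

lemma cd_basis_imag:
  assumes two: "(2::'f) \<noteq> 0" and w: "cd_basis C w"
  shows "imag (w i)"
proof -
  note D = cd_basisD[OF w]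
  have eq: "pol (w i) \<e> \<cdot> w i = (nrm (w i) - 1) \<cdot> \<e>"
    using D(4)[of i] by (simp add: square_eq scale_left_diff_distrib algebra_simps)
  have "pol (w i) \<e> = 0"
  proof (rule ccontr)
    assume n: "pol (w i) \<e> \<noteq> 0"
    have "w i = (1 / pol (w i) \<e>) \<cdot> (pol (w i) \<e> \<cdot> w i)" using n by simp
    also have "\<dots> \<in> span {\<e>}" unfolding eq by (intro span_scale span_base) simp
    finally have "w i \<in> span {\<e>}" .
    moreover have "w i \<noteq> \<e>" using D(1) unfolding inj_cd_vec by (metis rangeI)
    then have "{\<e>} \<subseteq> range (cd_vec C w) - {w i}" unfolding range_cd_vec by auto
    ultimately have "w i \<in> span (range (cd_vec C w) - {w i})" using span_mono by blast
    moreover have "w i \<in> range (cd_vec C w)" unfolding range_cd_vec by auto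
    ultimately show False using D(2) unfolding dependent_def by blast
  qed
  with eq show ?thesis by (simp add: imag_def)
qed

lemma cd_basis_orthogonal:
  assumes two: "(2::'f) \<noteq> 0" and w: "cd_basis C w" and "k \<noteq> l"
  shows "pol (cd_vec C w k) (cd_vec C w l) = 0"
proof -
  note D = cd_basisD[OF w] and im = cd_basis_imag[OF two w]
  have anti: "pol x y = 0" if "imag x" "imag y" "y \<odot> x = - (x \<odot> y)" for x y
  proof -
    have "pol x y \<cdot> \<e> = 0"
      using prod_conj_linearized[of x y] that by (simp add: imag_conj prod_simps)
    then show ?thesis by simp
  qed
  have o: "pol (w m) (w (m + 1)) = 0" for m using anti im D(5,6) by metis
  note Q = imag_prod(2,3)[OF im im o, unfolded D(5)]
  have "pol (w i) (w j) = 0" if "i \<noteq> j" for i j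
    using that by (rule_tac mod7_line_cases[of i j])
      (simp_all only: o Q o[THEN pol_zero_sym] Q[THEN pol_zero_sym])
  moreover have "pol (w i) \<e> = 0" for i using im by (simp add: imag_def)
  moreover from this have "pol \<e> (w i) = 0" for i by (rule pol_zero_sym)
  ultimately show ?thesis
    using assms(3) by (cases k; cases l) simp_all
qed

lemma nrm_cd_vec:
  assumes "(2::'f) \<noteq> 0" "cd_basis C w"
  shows "nrm (cd_vec C w k) = 1"
  using cd_basis_imag[OF assms] by (cases k) (auto simp: imag_def)

lemma cd_basis_triple_aut:
  assumes c: "nrm c = 1" and b: "cd_basis C w" and b': "cd_basis (isotope C c) w'"
  shows "\<exists>\<phi>\<in>triple_aut C. \<forall>k. \<phi> (cd_vec C w k) = cd_vec (isotope C c) w' k"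
proof (rule triple_aut_from_bases[OF c])
  interpret I: cayley_algebra "isotope C c" by (rule cayley_algebra_isotope[OF c])
  note D = cd_basisD[OF b] and D' = I.cd_basisD[OF b']
  show "inj (cd_vec C w)" "independent (range (cd_vec C w))" "span (range (cd_vec C w)) = UNIV"
    using D by auto
  show "inj (cd_vec (isotope C c) w')" "independent (range (cd_vec (isotope C c) w'))"
    "span (range (cd_vec (isotope C c) w')) = UNIV"
    using D' by auto
  fix \<phi> k l assume lin: "linear_map \<phi>"
    and \<phi>: "\<And>k. \<phi> (cd_vec C w k) = cd_vec (isotope C c) w' k"
  interpret L: Vector_Spaces.linear "vscale C" "vscale C" \<phi> by (rule lin)
  have \<phi>1: "\<phi> \<e> = vunit (isotope C c)" and \<phi>w: "\<phi> (w i) = w' i" for i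
    using \<phi>[of None] \<phi>[of "Some i"] by simp_all
  have "\<phi> (w i \<odot> w j) = w' i \<star>\<^bsub>isotope C c\<^esub> w' j" for i j
    by (rule mod7_line_cases[of i j])
      (simp_all only: D(4-) D'(4-) \<phi>w \<phi>1 L.neg)
  then show "\<phi> (cd_vec C w k \<odot> cd_vec C w l)
      = cd_vec (isotope C c) w' k \<star>\<^bsub>isotope C c\<^esub> cd_vec (isotope C c) w' l"
    using I.unit_left I.unit_right \<phi>1 \<phi>w
    by (cases k; cases l) (simp_all add: unit_left unit_right)
qed

end

text \<open>x, y and z are chosen orthogonal to the subalgebra obtained so far, of dimension 1, 2
  and 4; a square root rescales an anisotropic vector to norm 1.\<close>

lemma cd_basis_exists:
  fixes C :: "('f::alg_closed_field, 'c::ab_group_add) quad_algebra"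
  assumes "cayley_algebra C" and two: "(2::'f) \<noteq> 0"
  shows "\<exists>w. cd_basis C w"
proof -
  interpret cayley_algebra C by fact
  have ext: "\<exists>a. nrm a = 1 \<and> (\<forall>s\<in>S. pol a s = 0)"
    if S: "finite S" "card S < 8" and on: "\<forall>s\<in>S. \<forall>t\<in>S. s \<noteq> t \<longrightarrow> pol s t = 0" "\<forall>s\<in>S. nrm s = 1" for S
  proof -
    obtain a where a: "\<And>s. s \<in> S \<Longrightarrow> pol a s = 0" "nrm a \<noteq> 0"
      using orthonormal_extension[OF two S] on by blast
    obtain r where "r\<^sup>2 = 1 / nrm a" using alg_closed_has_square_root by blast
    then have "nrm (r \<cdot> a) = 1" using a by (simp add: norm_scale)
    then show ?thesis using a by (metis mult_zero_right pol_scale_left)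
  qed
  obtain x where x: "imag x" using ext[of "{\<e>}"] by (auto simp: imag_def)
  obtain y where y: "imag y" "pol y x = 0"
  proof -
    have "card {\<e>, x} < 8" by (simp add: card_insert_if)
    then have "\<exists>a. nrm a = 1 \<and> (\<forall>s\<in>{\<e>, x}. pol a s = 0)"
      by (rule ext[rotated]) (use x pol_zero_sym in \<open>auto simp: imag_def\<close>)
    then show thesis using that by (auto simp: imag_def)
  qed
  have xy: "pol x y = 0" using y by (simp add: pol_commute)
  note p = imag_prod[OF x y(1) xy]
  have "\<exists>z. nrm z = 1 \<and> (\<forall>s\<in>{\<e>, x, y, x \<odot> y}. pol z s = 0)"
  proof (rule ext)
    show "card {\<e>, x, y, x \<odot> y} < 8" by (simp add: card_insert_if)
    show "\<forall>s\<in>{\<e>, x, y, x \<odot> y}. nrm s = 1" using x y p by (auto simp: imag_def)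
    show "\<forall>s\<in>{\<e>, x, y, x \<odot> y}. \<forall>t\<in>{\<e>, x, y, x \<odot> y}. s \<noteq> t \<longrightarrow> pol s t = 0"
    proof -
      have e: "pol x \<e> = 0" "pol y \<e> = 0" "pol (x \<odot> y) \<e> = 0"
        using x y p(1) by (simp_all add: imag_def)
      show ?thesis
        using e e[THEN pol_zero_sym] y(2) xy p(2,3) p(2,3)[THEN pol_zero_sym] by simp
    qed
  qed simp
  then obtain z where z: "imag z" "pol z x = 0" "pol z y = 0" "pol z (x \<odot> y) = 0"
    by (auto simp: imag_def)
  then have "cd_basis C (cd_of x y z)"
    using x y by (intro cd_basis_of[OF two]) (auto simp: pol_commute)
  then show ?thesis by blast
qed

section \<open>Elementary 2-subgroups\<close>

context comm_group
begin

lemma generate_insert_involution: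
  assumes x: "x \<in> carrier G" "x \<otimes> x = \<one>" and S: "S \<subseteq> carrier G"
  shows "generate G (insert x S) = generate G S \<union> (\<lambda>g. x \<otimes> g) ` generate G S"
proof
  let ?H = "generate G S"
  have H: "subgroup ?H G" using S by (rule generate_is_subgroup)
  have Hc: "?H \<subseteq> carrier G" using S by (rule generate_incl)
  have ix: "inv x = x" using x by (intro inv_equality)
  have xx: "x \<otimes> (x \<otimes> y) = y" if "y \<in> carrier G" for y
    using x that by (simp add: m_assoc[symmetric])
  show "generate G (insert x S) \<subseteq> ?H \<union> (\<lambda>g. x \<otimes> g) ` ?H"
  proof (rule generate_subgroup_incl)
    have "x = x \<otimes> \<one>" using x by simp
    then have "x \<in> (\<lambda>g. x \<otimes> g) ` ?H" using generate.one by (rule image_eqI)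
    moreover have "S \<subseteq> ?H" by (auto intro: generate.incl)
    ultimately show "insert x S \<subseteq> ?H \<union> (\<lambda>g. x \<otimes> g) ` ?H" by auto
    show "subgroup (?H \<union> (\<lambda>g. x \<otimes> g) ` ?H) G"
    proof (rule subgroupI)
      show "?H \<union> (\<lambda>g. x \<otimes> g) ` ?H \<subseteq> carrier G" using Hc x by auto
      show "?H \<union> (\<lambda>g. x \<otimes> g) ` ?H \<noteq> {}" using generate.one by auto
    next
      fix a assume "a \<in> ?H \<union> (\<lambda>g. x \<otimes> g) ` ?H"
      then show "inv a \<in> ?H \<union> (\<lambda>g. x \<otimes> g) ` ?H"
        using subgroup.m_inv_closed[OF H] Hc x by (auto simp: inv_mult ix)
    next
      fix a b assume ab: "a \<in> ?H \<union> (\<lambda>g. x \<otimes> g) ` ?H" "b \<in> ?H \<union> (\<lambda>g. x \<otimes> g) ` ?H"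
      note cl = subgroup.m_closed[OF H]
      show "a \<otimes> b \<in> ?H \<union> (\<lambda>g. x \<otimes> g) ` ?H"
      proof -
        consider "a \<in> ?H" "b \<in> ?H" | c where "c \<in> ?H" "a \<in> ?H" "b = x \<otimes> c"
          | c where "c \<in> ?H" "a = x \<otimes> c" "b \<in> ?H"
          | c d where "c \<in> ?H" "d \<in> ?H" "a = x \<otimes> c" "b = x \<otimes> d"
          using ab by blast
        then show ?thesis
        proof cases
          case 2
          then have "a \<otimes> b = x \<otimes> (a \<otimes> c)" using Hc x by (simp add: m_lcomm subsetD)
          then show ?thesis using cl 2 by blast
        next
          case 3
          then have "a \<otimes> b = x \<otimes> (c \<otimes> b)" using Hc x by (simp add: m_assoc subsetD)
          then show ?thesis using cl 3 by blast
        next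
          case 4
          then have "a \<otimes> b = x \<otimes> (x \<otimes> (c \<otimes> d))" using Hc x by (simp add: m_ac subsetD)
          then have "a \<otimes> b = c \<otimes> d" using Hc 4 by (simp add: xx subsetD)
          then show ?thesis using cl[OF 4(1,2)] by simp
        qed (simp add: cl)
      qed
    qed
  qed
  have "?H \<subseteq> generate G (insert x S)" by (rule mono_generate) auto
  moreover have "x \<in> generate G (insert x S)" by (rule generate.incl) simp
  ultimately show "?H \<union> (\<lambda>g. x \<otimes> g) ` ?H \<subseteq> generate G (insert x S)"
    by (auto intro: generate.eng)
qed

text \<open>Basis extraction over the field with two elements: a further generator is either
  redundant or doubles the order.\<close>

lemma generate_independent_subset:
  assumes "finite S" "S \<subseteq> carrier G" "\<forall>s\<in>S. s \<otimes> s = \<one>"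
  shows "\<exists>S'\<subseteq>S. generate G S' = generate G S \<and> finite (generate G S) \<and> card (generate G S) = 2 ^ card S'"
  using assms
proof (induction S rule: finite_induct)
  case empty
  show ?case by (simp add: generate_empty)
next
  case (insert x F)
  then obtain F' where F': "F' \<subseteq> F" "generate G F' = generate G F" "finite (generate G F)"
      "card (generate G F) = 2 ^ card F'"
    by auto
  let ?H = "generate G F"
  have x: "x \<in> carrier G" "x \<otimes> x = \<one>" and F: "F \<subseteq> carrier G" using insert by auto
  have H: "subgroup ?H G" using F by (rule generate_is_subgroup)
  have Hc: "?H \<subseteq> carrier G" using F by (rule generate_incl)
  have gi: "generate G (insert x F) = ?H \<union> (\<lambda>g. x \<otimes> g) ` ?H"
    by (rule generate_insert_involution[OF x F])
  show ?case
  proof (cases "x \<in> ?H")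
    case True
    then have "generate G (insert x F) = ?H"
      unfolding gi using subgroup.m_closed[OF H] by blast
    then show ?thesis using F' by (metis subset_insertI2)
  next
    case False
    have "generate G (insert x F') = generate G (insert x F)"
      unfolding gi using generate_insert_involution[OF x, of F'] F' F by auto
    moreover have "?H \<inter> (\<lambda>g. x \<otimes> g) ` ?H = {}"
    proof (rule ccontr)
      assume "?H \<inter> (\<lambda>g. x \<otimes> g) ` ?H \<noteq> {}"
      then obtain g where g: "g \<in> ?H" "x \<otimes> g \<in> ?H" by blast
      then have "x \<otimes> g \<otimes> inv g \<in> ?H" using subgroup.m_closed[OF H] subgroup.m_inv_closed[OF H] by blast
      then show False using False g x Hc by (simp add: m_assoc subsetD)
    qed
    moreover have "card ((\<lambda>g. x \<otimes> g) ` ?H) = card ?H"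
      using Hc x by (intro card_image inj_onI) (auto simp: subsetD)
    moreover have "x \<notin> F'" using False F' generate.incl[of x F'] by auto
    moreover have "finite F'" using F' insert finite_subset by blast
    ultimately show ?thesis using F' gi
      by (intro exI[of _ "insert x F'"]) (auto simp: card_Un_disjoint)
  qed
qed

text \<open>Rank, a minimum over generating sets, is traded for the order: a generating set contains
  one of size log2 of the order.\<close>

lemma elementary_2_subgroup_iff:
  "elementary_2_subgroup G H r \<longleftrightarrow>
    subgroup H G \<and> (\<forall>x\<in>H. x \<otimes> x = \<one>) \<and> finite H \<and> card H = 2 ^ r"
proof -
  have "has_rank G H r \<longleftrightarrow> finite H \<and> card H = 2 ^ r"
    if H: "subgroup H G" "\<forall>x\<in>H. x \<otimes> x = \<one>"
  proof -
    have Hc: "H \<subseteq> carrier G" using H subgroup.subset by blast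
    have ind: "\<exists>S'\<subseteq>S. generate G S' = generate G S \<and> finite (generate G S) \<and> card (generate G S) = 2 ^ card S'"
      if "finite S" "S \<subseteq> H" for S
      using that Hc H by (intro generate_independent_subset) auto
    show ?thesis
    proof
      assume r: "has_rank G H r"
      then obtain S where S: "S \<subseteq> H" "finite S" "card S = r" "generate G S = H"
        unfolding has_rank_def by blast
      then obtain S' where S': "S' \<subseteq> S" "generate G S' = H" "finite H" "card H = 2 ^ card S'"
        using ind[of S] by auto
      have "S' \<subseteq> H" "finite S'" using S S' finite_subset by auto
      then have "r \<le> card S'" using r S'(2) unfolding has_rank_def by simp
      moreover have "card S' \<le> r" using S S' card_mono by blast
      ultimately show "finite H \<and> card H = 2 ^ r" using S' by auto
    next
      assume fin: "finite H \<and> card H = 2 ^ r"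
      have "generate G H = H"
        using generate_subgroup_incl[OF _ H(1), of H] generate.incl[of _ H] by blast
      then obtain S where S: "S \<subseteq> H" "generate G S = H" "card H = 2 ^ card S"
        using ind[of H] fin by auto
      then have "card S = r" using fin power_inject_exp[of "2::nat"] by simp
      moreover have "r \<le> card T" if T: "T \<subseteq> H" "finite T" "generate G T = H" for T
      proof -
        obtain T' where T': "T' \<subseteq> T" "card H = 2 ^ card T'" using ind[of T] T by auto
        then have "card T' = r" using fin power_inject_exp[of "2::nat"] by simp
        then show ?thesis using T T' card_mono by blast
      qed
      moreover have "finite S" using S fin finite_subset by blast
      ultimately show "has_rank G H r" unfolding has_rank_def using S(1,2) by auto
    qed
  qed
  then show ?thesis unfolding elementary_2_subgroup_def by blast
qed

lemma index_2_subgroup_iff: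
  assumes H: "subgroup H G" "finite H"
  shows "index_2_subgroup G H K \<longleftrightarrow> subgroup K G \<and> K \<subseteq> H \<and> card H = 2 * card K"
proof -
  interpret H: group "G\<lparr>carrier := H\<rparr>" using H by (simp add: subgroup_imp_group)
  have "subgroup K (G\<lparr>carrier := H\<rparr>) \<longleftrightarrow> subgroup K G \<and> K \<subseteq> H"
    using incl_subgroup[OF H(1)] subgroup.subset[of K "G\<lparr>carrier := H\<rparr>"] subgroup_incl[of K H] H(1)
    by auto
  moreover have "card (rcosets\<^bsub>G\<lparr>carrier := H\<rparr>\<^esub> K) = 2 \<longleftrightarrow> card H = 2 * card K"
    if K: "subgroup K (G\<lparr>carrier := H\<rparr>)" "K \<subseteq> H"
  proof -
    have "card (rcosets\<^bsub>G\<lparr>carrier := H\<rparr>\<^esub> K) * card K = card H"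
      using H.lagrange[OF K(1)] by (simp add: Coset.order_def)
    moreover have "card K > 0"
      using K(1) K(2) H finite_subset subgroup.one_closed by (metis card_gt_0_iff empty_iff)
    ultimately show ?thesis by auto
  qed
  ultimately show ?thesis unfolding index_2_subgroup_def by blast
qed

text \<open>Order 8 and exponent 2 make the three generators independent, so that the eight degrees
  in \<open>cd_deg\<close> are distinct and exhaust K.\<close>

definition cd_gens :: "'a set \<Rightarrow> 'a \<Rightarrow> 'a \<Rightarrow> 'a \<Rightarrow> bool" where
  "cd_gens K h1 h2 h3 \<longleftrightarrow> subgroup K G \<and> (\<forall>x\<in>K. x \<otimes> x = \<one>) \<and> card K = 8 \<and>
     {h1, h2, h3} \<subseteq> K \<and> generate G {h1, h2, h3} = K"

lemma elementary_generators:
  assumes "elementary_2_subgroup G K 3"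
  obtains h1 h2 h3 where "cd_gens K h1 h2 h3"
proof -
  obtain S where S: "S \<subseteq> K" "card S = 3" "generate G S = K"
    using assms unfolding elementary_2_subgroup_def has_rank_def by blast
  then obtain h1 h2 h3 where "S = {h1, h2, h3}"
    by (auto simp: card_3_iff)
  then show ?thesis
    using that S assms unfolding cd_gens_def elementary_2_subgroup_iff by auto
qed

end

definition cd_deg :: "('g, 'm) monoid_scheme \<Rightarrow> 'g \<Rightarrow> 'g \<Rightarrow> 'g \<Rightarrow> 7 option \<Rightarrow> 'g" where
  "cd_deg G h1 h2 h3 k = (case k of None \<Rightarrow> \<one>\<^bsub>G\<^esub> | Some i \<Rightarrow> cd_degree G h1 h2 h3 i)"

lemma cd_deg_simps [simp]: "cd_deg G h1 h2 h3 None = \<one>\<^bsub>G\<^esub>"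
  "cd_deg G h1 h2 h3 (Some i) = cd_degree G h1 h2 h3 i"
  by (simp_all add: cd_deg_def)

lemma UNIV_option7: "(UNIV :: 7 option set) =
  {None, Some 1, Some 2, Some 3, Some 4, Some 5, Some 6, Some 7}"
proof -
  have "k \<in> {None, Some 1, Some 2, Some 3, Some 4, Some 5, Some 6, Some 7}" for k :: "7 option"
    by (cases k) (use exhaust_mod7 in auto)
  then show ?thesis by blast
qed

context comm_group
begin

context
  fixes K h1 h2 h3
  assumes gens: "cd_gens K h1 h2 h3"
begin

lemma cd_gensD: "subgroup K G" "x \<in> K \<Longrightarrow> x \<otimes> x = \<one>" "x \<in> K \<Longrightarrow> x \<in> carrier G"
  "h1 \<in> K" "h2 \<in> K" "h3 \<in> K"
  using gens subgroup.subset[of K G] unfolding cd_gens_def by auto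

lemma range_cd_deg: "range (cd_deg G h1 h2 h3) = K"
proof -
  have c: "h1 \<in> carrier G" "h2 \<in> carrier G" "h3 \<in> carrier G" "h1 \<otimes> h1 = \<one>" "h2 \<otimes> h2 = \<one>" "h3 \<otimes> h3 = \<one>"
    using cd_gensD by auto
  have "generate G {h1, h2, h3} = {\<one>, h1, h2, h3, h1 \<otimes> h2, h2 \<otimes> h3, h1 \<otimes> h2 \<otimes> h3, h1 \<otimes> h3}"
    using c by (auto simp: generate_insert_involution generate_empty m_assoc)
  moreover have "range (cd_deg G h1 h2 h3) = {\<one>, h1, h2, h3, h1 \<otimes> h2, h2 \<otimes> h3, h1 \<otimes> h2 \<otimes> h3, h1 \<otimes> h3}"
    unfolding UNIV_option7 by (simp add: cd_degree_def)
  ultimately show ?thesis using gens by (simp add: cd_gens_def)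
qed

lemma cd_deg_closed: "cd_deg G h1 h2 h3 k \<in> K"
  using range_cd_deg by blast

lemma inj_cd_deg: "inj (cd_deg G h1 h2 h3)"
proof (rule eq_card_imp_inj_on)
  show "card (range (cd_deg G h1 h2 h3)) = CARD(7 option)"
    unfolding range_cd_deg using gens by (simp add: cd_gens_def)
qed simp

lemma cd_degree_line:
  fixes i :: 7
  defines "d \<equiv> cd_degree G h1 h2 h3"
  shows "d i \<otimes> d i = \<one>" "d i \<otimes> d (i + 1) = d (i + 3)" "d (i + 1) \<otimes> d i = d (i + 3)"
    "d (i + 1) \<otimes> d (i + 3) = d i" "d (i + 3) \<otimes> d (i + 1) = d i"
    "d (i + 3) \<otimes> d i = d (i + 1)" "d i \<otimes> d (i + 3) = d (i + 1)"
proof -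
  have dK: "d j \<in> K" for j using cd_deg_closed[of "Some j"] by (simp add: d_def)
  then have dc: "d j \<in> carrier G" for j using cd_gensD by blast
  have dd: "d j \<otimes> d j = \<one>" for j using cd_gensD dK by blast
  have ddx: "d j \<otimes> (d j \<otimes> y) = y" if "y \<in> carrier G" for j y
    using dd[of j] dc[of j] that by (simp add: m_assoc[symmetric])
  have h: "h1 = d 1" "h2 = d 2" "h3 = d 3" by (simp_all add: d_def cd_degree_def)
  have d4: "d 4 = d 1 \<otimes> d 2" "d 5 = d 2 \<otimes> d 3" "d 6 = d 1 \<otimes> d 2 \<otimes> d 3" "d 7 = d 1 \<otimes> d 3"
    by (simp_all add: d_def cd_degree_def)
  have line: "d i \<otimes> d (i + 1) = d (i + 3)" for i
  proof -
    \<comment> \<open>The numerals in which i + 1 and i + 3 wrap around modulo 7.\<close>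
    have m8: "8 = (1::7)" "9 = (2::7)" "10 = (3::7)" by simp_all
    have "\<forall>i. d i \<otimes> d (i + 1) = d (i + 3)"
      unfolding all_mod7
      by (simp add: m8 d4 dc dd ddx m_ac)
    then show ?thesis by blast
  qed
  show "d i \<otimes> d i = \<one>" by (rule dd)
  show 1: "d i \<otimes> d (i + 1) = d (i + 3)" by (rule line)
  then show 2: "d (i + 1) \<otimes> d i = d (i + 3)" using dc m_comm by metis
  show 3: "d (i + 3) \<otimes> d (i + 1) = d i" "d (i + 3) \<otimes> d i = d (i + 1)"
    using dd dc by (simp add: 1[symmetric] m_assoc) (use dd dc in \<open>simp add: 2[symmetric] m_assoc\<close>)
  show "d (i + 1) \<otimes> d (i + 3) = d i" "d i \<otimes> d (i + 3) = d (i + 1)" using 3 m_comm[OF dc dc] by metis+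
qed

end

end

section \<open>Cayley-Dickson gradings\<close>

context cayley_group
begin

lemma cd_grading_eq:
  "cd_grading C w G h1 h2 h3 g = span (cd_vec C w ` {k. cd_deg G h1 h2 h3 k = g})"
proof -
  have "(if g = \<one> then {\<e>} else {}) \<union> w ` {i. cd_degree G h1 h2 h3 i = g}
      = cd_vec C w ` {k. cd_deg G h1 h2 h3 k = g}" (is "?A = ?B")
  proof (intro Set.set_eqI iffI)
    fix x assume "x \<in> ?A"
    then consider "g = \<one>" "x = \<e>" | i where "cd_degree G h1 h2 h3 i = g" "x = w i"
      by (auto split: if_splits)
    then show "x \<in> ?B"
    proof cases
      case 1
      then show ?thesis by (intro image_eqI[of _ _ None]) simp_all
    next
      case (2 i)
      then show ?thesis by (intro image_eqI[of _ _ "Some i"]) simp_all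
    qed
  next
    fix x assume "x \<in> ?B"
    then obtain k where "cd_deg G h1 h2 h3 k = g" "x = cd_vec C w k" by blast
    then show "x \<in> ?A" by (cases k) auto
  qed
  then show ?thesis by (simp add: cd_grading_def)
qed

context
  fixes K h1 h2 h3 w
  assumes gens: "G.cd_gens K h1 h2 h3" and two: "(2::'f) \<noteq> 0" and w: "cd_basis C w"
begin

abbreviation (input) "cdd \<equiv> cd_deg G h1 h2 h3"
abbreviation (input) "cdv \<equiv> cd_vec C w"
abbreviation (input) "cdg \<equiv> cd_grading C w G h1 h2 h3"

lemmas gensD = G.cd_gensD[OF gens]

lemma cd_vec_in: "cdv k \<in> cdg (cdd k)"
  unfolding cd_grading_eq by (intro span_base) auto

lemma subspace_cd_grading: "subspace (cdg g)"
  unfolding cd_grading_eq by (rule subspace_span)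

lemma cd_vec_prod: "cdv k \<odot> cdv l \<in> cdg (cdd k \<otimes> cdd l)"
proof -
  note D = cd_basisD[OF w]
  have c: "cdd k \<in> carrier G" for k using G.cd_deg_closed[OF gens] gensD by blast
  have S: "w i \<in> cdg (cd_degree G h1 h2 h3 i)" "- w i \<in> cdg (cd_degree G h1 h2 h3 i)" for i
    using cd_vec_in[of "Some i"] subspace_neg[OF subspace_cd_grading] by auto
  have U: "\<e> \<in> cdg \<one>" "- \<e> \<in> cdg \<one>"
    using cd_vec_in[of None] subspace_neg[OF subspace_cd_grading] by auto
  have "w i \<odot> w j \<in> cdg (cd_degree G h1 h2 h3 i \<otimes> cd_degree G h1 h2 h3 j)" for i j
    by (rule mod7_line_cases[of i j]) (simp_all only: D(4-) G.cd_degree_line[OF gens] S U)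
  then show ?thesis
    using cd_vec_in c[of "Some _"] by (cases k; cases l) (auto simp: unit_left unit_right U S)
qed

lemma cd_grading_prod:
  assumes x: "x \<in> cdg g" and y: "y \<in> cdg h"
  shows "x \<odot> y \<in> cdg (g \<otimes> h)"
proof -
  have S: "subspace {y. x \<odot> y \<in> cdg (g \<otimes> h)}" "subspace {x. x \<odot> y \<in> cdg (g \<otimes> h)}" for x y
    using subspace_cd_grading unfolding subspace_def by (auto simp: prod_simps)
  have 1: "cdv k \<odot> y \<in> cdg (g \<otimes> h)" if k: "cdd k = g" for k
    using span_induct[OF y[unfolded cd_grading_eq] S(1)] cd_vec_prod k by auto
  show ?thesis
    using span_induct[OF x[unfolded cd_grading_eq] S(2)] 1 by auto
qed

lemma cd_grading_conj:
  assumes x: "x \<in> cdg g"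
  shows "cj x \<in> cdg g"
proof -
  have S: "subspace {x. cj x \<in> cdg g}"
    using subspace_cd_grading unfolding subspace_def by (auto simp: conj_add conj_scale)
  have "cj (cdv k) \<in> cdg g" if "cdd k = g" for k
    using that cd_vec_in[of k] subspace_neg[OF subspace_cd_grading, of "cdv k"] imag_conj[OF cd_basis_imag[OF two w]]
    by (cases k) auto
  then show ?thesis
    using span_induct[OF x[unfolded cd_grading_eq] S] by auto
qed

lemma cd_grading_orthogonal:
  assumes "x \<in> cdg g" "y \<in> cdg h" "g \<noteq> h"
  shows "pol x y = 0"
proof (rule pol_span_zero[OF assms(1)[unfolded cd_grading_eq]])
  fix s assume s: "s \<in> cdv ` {k. cdd k = g}"
  have "pol y s = 0"
    by (rule pol_span_zero[OF assms(2)[unfolded cd_grading_eq]])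
      (use s assms(3) in \<open>auto intro!: cd_basis_orthogonal[OF two w]\<close>)
  then show "pol s y = 0" by (rule pol_zero_sym)
qed

text \<open>As the degrees of the basis vectors are distinct, a nonzero component is a line spanned
  by a vector of norm 1.\<close>

lemma cd_grading_nonzero:
  assumes "x \<in> cdg g" "x \<noteq> 0"
  shows "g \<in> K" "nrm x \<noteq> 0"
proof -
  have "{k. cdd k = g} \<noteq> {}"
  proof
    assume "{k. cdd k = g} = {}"
    then show False using assms unfolding cd_grading_eq by simp
  qed
  then obtain k where k: "cdd k = g" by blast
  then show "g \<in> K" using G.cd_deg_closed[OF gens] by blast
  have "{k. cdd k = g} = {k}" using k G.inj_cd_deg[OF gens] by (auto simp: inj_eq)
  then have "x \<in> span {cdv k}" using assms(1) unfolding cd_grading_eq by simp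
  then obtain a where a: "x = a \<cdot> cdv k" unfolding span_singleton by blast
  then have "a \<noteq> 0" using assms(2) by auto
  then show "nrm x \<noteq> 0" using a by (simp add: norm_scale nrm_cd_vec[OF two w])
qed

lemma cd_grading_unit_vector:
  assumes "g \<in> K"
  obtains x where "x \<in> cdg g" "nrm x = 1"
proof -
  obtain k where "cdd k = g" using assms G.range_cd_deg[OF gens] by blast
  then show ?thesis using that cd_vec_in[of k] nrm_cd_vec[OF two w] by blast
qed

lemma cd_grading_zero: "g \<notin> K \<Longrightarrow> x \<in> cdg g \<Longrightarrow> x = 0"
  using cd_grading_nonzero by blast

section \<open>Shifts of Cayley-Dickson gradings by an involution\<close>

context
  fixes s
  assumes s: "s \<in> carrier G" "s \<otimes> s = \<one>"
begin

lemma inv_shift: "inv s = s" "g \<in> carrier G \<Longrightarrow> s \<otimes> (s \<otimes> g) = g"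
  using s by (auto intro: G.inv_equality simp: G.m_assoc[symmetric])

text \<open>Components of distinct degrees are orthogonal already. If g = h and g g \<noteq> e, then
  s g has square \<noteq> e as well, so it is outside K and the component is zero.\<close>

lemma shifted_cd_grading_orthogonal: "orthogonal_family G (\<lambda>g. cdg (inv s \<otimes> g))"
proof -
  have "pol x y = 0" if gh: "g \<in> carrier G" "h \<in> carrier G" "g \<otimes> h \<noteq> \<one>"
    and x: "x \<in> cdg (s \<otimes> g)" and y: "y \<in> cdg (s \<otimes> h)" for g h x y
  proof (cases "g = h")
    case True
    then have "s \<otimes> g \<notin> K"
    proof (rule_tac notI)
      assume "s \<otimes> g \<in> K"
      then have "(s \<otimes> g) \<otimes> (s \<otimes> g) = \<one>" using gensD by blast
      moreover have "(s \<otimes> g) \<otimes> (s \<otimes> g) = s \<otimes> (s \<otimes> (g \<otimes> g))" using gh s by (simp add: G.m_ac)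
      ultimately have "g \<otimes> g = \<one>" using gh inv_shift(2) by simp
      then show False using gh True by simp
    qed
    then have "x = 0" using x by (rule cd_grading_zero)
    then show ?thesis by simp
  next
    case False
    then have "s \<otimes> g \<noteq> s \<otimes> h" using gh s by simp
    then show ?thesis using cd_grading_orthogonal x y by blast
  qed
  moreover have "span (\<Union>g\<in>carrier G. cdg (s \<otimes> g)) = UNIV"
  proof -
    have "cdv k \<in> cdg (s \<otimes> (s \<otimes> cdd k))" for k
      using cd_vec_in[of k] inv_shift gensD G.cd_deg_closed[OF gens] by simp
    then have "range cdv \<subseteq> (\<Union>g\<in>carrier G. cdg (s \<otimes> g))"
      using s gensD G.cd_deg_closed[OF gens] by (intro image_subsetI UN_I[of "s \<otimes> cdd _"]) auto
    then show ?thesis using span_mono cd_basisD(3)[OF w] by blast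
  qed
  ultimately show ?thesis
    unfolding orthogonal_family_def inv_shift by (simp add: subspace_cd_grading)
qed

lemma shifted_cd_grading_closed: "triple_closed G (\<lambda>g. cdg (inv s \<otimes> g))"
  unfolding triple_closed_def inv_shift
proof (intro ballI)
  fix g1 g2 g3 x y z
  assume g: "g1 \<in> carrier G" "g2 \<in> carrier G" "g3 \<in> carrier G"
    and x: "x \<in> cdg (s \<otimes> g1)" "y \<in> cdg (s \<otimes> g2)" "z \<in> cdg (s \<otimes> g3)"
  have "tri x y z \<in> cdg ((s \<otimes> g1) \<otimes> (s \<otimes> g2) \<otimes> (s \<otimes> g3))"
    unfolding triple_def using x by (intro cd_grading_prod cd_grading_conj)
  moreover have "(s \<otimes> g1) \<otimes> (s \<otimes> g2) \<otimes> (s \<otimes> g3) = s \<otimes> (s \<otimes> (s \<otimes> (g1 \<otimes> g2 \<otimes> g3)))"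
    using g s by (simp add: G.m_ac)
  ultimately show "tri x y z \<in> cdg (s \<otimes> (g1 \<otimes> g2 \<otimes> g3))"
    using g s inv_shift(2) by simp
qed

text \<open>A vector c of degree s becomes the unit of the isotope; unit vectors of degrees s h1, s
  h2, s h3 are then imaginary units in general position and generate a Cayley-Dickson basis there.
  The target \<Xi> is kept abstract because it is an unknown grading in the classification and
  another shifted Cayley-Dickson grading in the isomorphism criterion.\<close>

lemma shifted_cd_grading_iso:
  assumes sqrt: "\<And>a::'f. \<exists>r. r\<^sup>2 = a"
    and fam: "orthogonal_family G \<Xi>" and tc: "triple_closed G \<Xi>"
    and nz: "\<And>k. k \<in> K \<Longrightarrow> \<exists>x\<in>\<Xi> (s \<otimes> k). nrm x \<noteq> 0"
  shows "grading_iso C G (\<lambda>g. cdg (inv s \<otimes> g)) \<Xi>"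
proof -
  note F = orthogonal_familyD[OF fam]
  have unit: "\<exists>x\<in>\<Xi> (s \<otimes> k). nrm x = 1" if k: "k \<in> K" for k
  proof -
    obtain x where x: "x \<in> \<Xi> (s \<otimes> k)" "nrm x \<noteq> 0" using nz[OF k] by blast
    obtain r where "r\<^sup>2 = 1 / nrm x" using sqrt by blast
    then have "nrm (r \<cdot> x) = 1" using x by (simp add: norm_scale)
    moreover have "r \<cdot> x \<in> \<Xi> (s \<otimes> k)" using F(1) s gensD k x subspace_scale by simp
    ultimately show ?thesis by blast
  qed
  have one: "\<one> \<in> K" using gensD(1) by (rule subgroup.one_closed)
  note KK = subgroup.m_closed[OF gensD(1)]
  obtain c where c: "c \<in> \<Xi> (s \<otimes> \<one>)" "nrm c = 1" using unit[OF one] by blast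
  obtain x y z where xyz: "x \<in> \<Xi> (s \<otimes> h1)" "nrm x = 1" "y \<in> \<Xi> (s \<otimes> h2)" "nrm y = 1"
      "z \<in> \<Xi> (s \<otimes> h3)" "nrm z = 1"
    using unit gensD(4-6) by metis
  interpret I: cayley_group "isotope C c" G
    by (intro cayley_group.intro cayley_algebra_isotope c G.comm_group_axioms)
  \<comment> \<open>The factors a, c, b carry three shifts and s s s = s, so relative to the shifted
    degrees the isotope product is graded by K.\<close>
  have prod: "a \<star>\<^bsub>isotope C c\<^esub> b \<in> \<Xi> (s \<otimes> (k \<otimes> l))"
    if "k \<in> K" "l \<in> K" "a \<in> \<Xi> (s \<otimes> k)" "b \<in> \<Xi> (s \<otimes> l)" for a b k l
  proof -
    have "tri a c b \<in> \<Xi> ((s \<otimes> k) \<otimes> (s \<otimes> \<one>) \<otimes> (s \<otimes> l))"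
      by (rule triple_closedD[OF tc]) (use that c s gensD in auto)
    moreover have "(s \<otimes> k) \<otimes> (s \<otimes> \<one>) \<otimes> (s \<otimes> l) = s \<otimes> (s \<otimes> (s \<otimes> (k \<otimes> l)))"
      using that s gensD by (simp add: G.m_ac)
    ultimately show ?thesis using that s gensD inv_shift(2) by (simp add: isotope_prod)
  qed
  have orth: "pol a b = 0" if "a \<in> \<Xi> (s \<otimes> k)" "b \<in> \<Xi> (s \<otimes> l)" "k \<in> K" "l \<in> K" "k \<noteq> l" for a b k l
  proof -
    have kl: "k \<in> carrier G" "l \<in> carrier G" "l \<otimes> l = \<one>" using that gensD by auto
    have "(s \<otimes> k) \<otimes> (s \<otimes> l) \<noteq> \<one>"
    proof
      assume "(s \<otimes> k) \<otimes> (s \<otimes> l) = \<one>"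
      moreover have "(s \<otimes> k) \<otimes> (s \<otimes> l) = s \<otimes> (s \<otimes> (k \<otimes> l))" using kl s by (simp add: G.m_ac)
      ultimately have "k \<otimes> l = \<one>" using kl inv_shift(2) by simp
      then have "k = inv l" using kl by (simp add: G.inv_equality)
      moreover have "inv l = l" using kl by (simp add: G.inv_equality)
      ultimately show False using that by simp
    qed
    then show ?thesis using F(2) that kl s by (meson G.m_closed)
  qed
  let ?d = "cd_degree G h1 h2 h3"
  have "inj cdd" by (rule G.inj_cd_deg[OF gens])
  then have dneq: "?d i \<noteq> \<one>" "i \<noteq> j \<Longrightarrow> ?d i \<noteq> ?d j" for i j
    using inj_eq[of cdd "Some i" None] inj_eq[of cdd "Some i" "Some j"] by auto
  have d: "?d 1 = h1" "?d 2 = h2" "?d 3 = h3" "?d 4 = h1 \<otimes> h2" by (simp_all add: cd_degree_def)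
  have ne: "h1 \<noteq> \<one>" "h2 \<noteq> \<one>" "h3 \<noteq> \<one>" "h1 \<noteq> h2" "h2 \<noteq> h3" "h1 \<noteq> h3" "h1 \<otimes> h2 \<noteq> h3"
    using dneq(1)[of 1] dneq(1)[of 2] dneq(1)[of 3] dneq(2)[of 1 2] dneq(2)[of 2 3]
      dneq(2)[of 1 3] dneq(2)[of 4 3] unfolding d by simp_all
  let ?w' = "I.cd_of x y z"
  have "I.imag x" "I.imag y" "I.imag z"
    unfolding I.imag_def using orth[OF _ c(1)] xyz one gensD ne by auto
  moreover have "x \<star>\<^bsub>isotope C c\<^esub> y \<in> \<Xi> (s \<otimes> (h1 \<otimes> h2))" using prod xyz gensD by blast
  then have "pol (x \<star>\<^bsub>isotope C c\<^esub> y) z = 0"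
    by (rule orth[OF _ xyz(5) KK[OF gensD(4,5)] gensD(6) ne(7)])
  moreover have "pol x y = 0" "pol y z = 0" "pol x z = 0"
    using orth[OF xyz(1,3) gensD(4,5) ne(4)] orth[OF xyz(3,5) gensD(5,6) ne(5)]
      orth[OF xyz(1,5) gensD(4,6) ne(6)] by blast+
  ultimately have w': "cd_basis (isotope C c) ?w'"
    by (intro I.cd_basis_of two) (simp_all only: isotope_simps)
  note xy = prod[OF gensD(4,5) xyz(1,3)]
  have "z \<star>\<^bsub>isotope C c\<^esub> (x \<star>\<^bsub>isotope C c\<^esub> y) \<in> \<Xi> (s \<otimes> (h1 \<otimes> h2 \<otimes> h3))"
    using prod[OF gensD(6) KK[OF gensD(4,5)] xyz(5) xy] gensD(3)[OF gensD(4)] gensD(3)[OF gensD(5)] gensD(3)[OF gensD(6)]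
    by (simp add: G.m_ac)
  then have "\<forall>i. ?w' i \<in> \<Xi> (s \<otimes> ?d i)"
    unfolding all_mod7 using xyz xy prod[OF gensD(5,6) xyz(3,5)] prod[OF gensD(4,6) xyz(1,5)]
    by (simp add: I.cd_of_def cd_degree_def)
  then have hom: "cd_vec (isotope C c) ?w' k \<in> \<Xi> (s \<otimes> cdd k)" for k
    using c by (cases k) auto
  obtain \<phi> where \<phi>: "\<phi> \<in> triple_aut C" "\<forall>k. \<phi> (cdv k) = cd_vec (isotope C c) ?w' k"
    using cd_basis_triple_aut[OF c(2) w w'] by blast
  have "\<phi> ` cdg (inv s \<otimes> g) = \<Xi> g" if g: "g \<in> carrier G" for g
  proof -
    have "\<Xi> g = span (cd_vec (isotope C c) ?w' ` {k. s \<otimes> cdd k = g})"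
    proof (rule homogeneous_basis_components[OF fam _ hom _ g])
      show "s \<otimes> cdd k \<in> carrier G" for k using s gensD G.cd_deg_closed[OF gens] by blast
      show "span (range (cd_vec (isotope C c) ?w')) = UNIV" using I.cd_basisD(3)[OF w'] by simp
    qed
    moreover have "{k. s \<otimes> cdd k = g} = {k. cdd k = inv s \<otimes> g}"
      using g inv_shift G.cd_deg_closed[OF gens] gensD s by force
    ultimately show ?thesis
      using \<phi>(2) by (simp add: cd_grading_eq triple_aut_span[OF \<phi>(1)] image_image)
  qed
  then show ?thesis unfolding grading_iso_def using \<phi>(1) by blast
qed

end

end

end

section \<open>Gradings without isotropic homogeneous elements\<close>

context cayley_group
begin

lemma anisotropic_grading_iso:
  assumes two: "(2::'f) \<noteq> 0" and sqrt: "\<And>a::'f. \<exists>r. r\<^sup>2 = a" and w: "cd_basis C w"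
    and fam: "orthogonal_family G \<Gamma>" and tc: "triple_closed G \<Gamma>"
    and an: "\<And>g x. g \<in> carrier G \<Longrightarrow> x \<in> \<Gamma> g \<Longrightarrow> x \<noteq> 0 \<Longrightarrow> nrm x \<noteq> 0"
  obtains s K h1 h2 h3 where "G.cd_gens K h1 h2 h3" "s \<in> carrier G" "s \<otimes> s = \<one>"
    "s = \<one> \<or> s \<notin> K" "grading_iso C G \<Gamma> (\<lambda>g. cd_grading C w G h1 h2 h3 (inv s \<otimes> g))"
proof -
  note F = orthogonal_familyD[OF fam]
  define T where "T = {g \<in> carrier G. \<exists>x\<in>\<Gamma> g. x \<noteq> 0}"
  have Tc: "g \<in> carrier G" if "g \<in> T" for g using that by (simp add: T_def)
  define xs where "xs g = (SOME x. x \<in> \<Gamma> g \<and> x \<noteq> 0)" for g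
  have xs: "xs g \<in> \<Gamma> g" "xs g \<noteq> 0" if "g \<in> T" for g
    using someI_ex[of "\<lambda>x. x \<in> \<Gamma> g \<and> x \<noteq> 0"] that unfolding xs_def T_def by blast+
  have nx: "nrm (xs g) \<noteq> 0" if "g \<in> T" for g
    using an Tc xs that by blast
  have TI: "g \<in> T" if "x \<in> \<Gamma> g" "g \<in> carrier G" "nrm x \<noteq> 0" for x g
    using that unfolding T_def by (auto intro!: bexI[of _ x])
  \<comment> \<open>Where g g \<noteq> e the component is orthogonal to itself, hence isotropic as 2
    is invertible.\<close>
  have T2: "g \<otimes> g = \<one>" if g: "g \<in> T" for g
  proof (rule ccontr)
    assume "g \<otimes> g \<noteq> \<one>"
    then have "pol (xs g) (xs g) = 0" using F(2) xs Tc g by blast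
    then show False using nx[OF g] two by (simp add: pol_self)
  qed
  have Ti: "inv g = g" if "g \<in> T" for g using T2 Tc that by (intro G.inv_equality)
  have orth: "pol (xs g) (xs h) = 0" if "g \<in> T" "h \<in> T" "g \<noteq> h" for g h
  proof -
    have "g \<otimes> h \<noteq> \<one>" using that Tc Ti G.inv_equality by metis
    then show ?thesis using F(2) xs Tc that by blast
  qed
  \<comment> \<open>Over an algebraically closed field a plane contains a nonzero isotropic vector.\<close>
  have line: "y \<in> span {xs g}" if y: "y \<in> \<Gamma> g" and g: "g \<in> T" for y g
  proof -
    define a b c where "a = nrm (xs g)" and "b = pol y (xs g)" and "c = nrm y"
    have a: "a \<noteq> 0" using nx g by (simp add: a_def)
    obtain r where r: "r\<^sup>2 = b\<^sup>2 - 4 * a * c" using sqrt by blast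
    define t where "t = (r - b) / (2 * a)"
    have "4 * a * (c + t\<^sup>2 * a + t * b) = (2 * a * t + b)\<^sup>2 - (b\<^sup>2 - 4 * a * c)"
      by (simp add: power2_eq_square algebra_simps)
    also have "2 * a * t + b = r" using a two by (simp add: t_def)
    finally have "4 * a * (c + t\<^sup>2 * a + t * b) = 0" using r by simp
    moreover have "(4::'f) = 2 * 2" by simp
    ultimately have "c + t\<^sup>2 * a + t * b = 0" using a two by (metis mult_eq_0_iff)
    then have "nrm (y + t \<cdot> xs g) = 0"
      by (simp add: nrm_add norm_scale pol_scale_right a_def b_def c_def)
    moreover have "y + t \<cdot> xs g \<in> \<Gamma> g"
      using y F(1)[OF Tc[OF g]] xs(1)[OF g] by (simp add: subspace_add subspace_scale)
    ultimately have "y + t \<cdot> xs g = 0" using an Tc[OF g] by blast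
    then have "y = (- t) \<cdot> xs g" by (simp add: eq_neg_iff_add_eq_0)
    then show ?thesis by (simp add: span_base span_scale span_neg)
  qed
  have inj: "inj_on xs T"
    using orth nx two by (metis inj_onI mult_eq_0_iff pol_self)
  have "independent (xs ` T)"
  proof
    assume "dependent (xs ` T)"
    then obtain g where g: "g \<in> T" "xs g \<in> span (xs ` T - {xs g})"
      unfolding dependent_def by blast
    have "pol (xs g) (xs g) = 0"
      by (rule pol_span_zero[OF g(2)]) (use g(1) orth in auto)
    then show False using nx[OF g(1)] two by (simp add: pol_self)
  qed
  moreover have "span (xs ` T) = UNIV"
  proof -
    have "y \<in> span (xs ` T)" if "g \<in> carrier G" "y \<in> \<Gamma> g" for y g
    proof (cases "y = 0")
      case False
      then have "g \<in> T" using that by (auto simp: T_def)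
      then show ?thesis using line[OF that(2)] span_mono[of "{xs g}" "xs ` T"] by blast
    qed (simp add: span_zero)
    then have "span (\<Union>g\<in>carrier G. \<Gamma> g) \<subseteq> span (xs ` T)"
      by (intro span_minimal subspace_span) auto
    then show ?thesis using F(3) by auto
  qed
  ultimately have "card (xs ` T) = 8"
    using basis_card_eq_dim[of "xs ` T" UNIV] dim_8 by simp
  then have cT: "card T = 8" using inj by (simp add: card_image)
  \<comment> \<open>The norm of a triple product is the product of the norms, so anisotropic vectors
    multiply to a nonzero one. The support is thus closed under products of three degrees, though
    not necessarily of two.\<close>
  have T3: "g1 \<otimes> g2 \<otimes> g3 \<in> T" if g: "g1 \<in> T" "g2 \<in> T" "g3 \<in> T" for g1 g2 g3
  proof (rule TI)
    show "tri (xs g1) (xs g2) (xs g3) \<in> \<Gamma> (g1 \<otimes> g2 \<otimes> g3)"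
      by (intro triple_closedD[OF tc] Tc xs g)
    show "nrm (tri (xs g1) (xs g2) (xs g3)) \<noteq> 0"
      using nx g by (simp add: triple_def norm_mult)
  qed (use Tc g in simp)
  \<comment> \<open>Preferring the unit separates the two types: s in K would mean that s s = e is
    in the support, and then s = e.\<close>
  obtain s where s: "s \<in> T" "\<one> \<in> T \<Longrightarrow> s = \<one>"
  proof (cases "\<one> \<in> T")
    case False
    moreover have "T \<noteq> {}" using cT by auto
    ultimately show thesis using that by blast
  qed (use that in blast)
  note sc = Tc[OF s(1)] and ss = T2[OF s(1)]
  have s2: "s \<otimes> (s \<otimes> g) = g" if "g \<in> carrier G" for g
    using sc ss that by (simp add: G.m_assoc[symmetric])
  define K where "K = (\<lambda>g. s \<otimes> g) ` T"
  have inK: "k \<in> K \<longleftrightarrow> k \<in> carrier G \<and> s \<otimes> k \<in> T" for k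
  proof
    assume "k \<in> K"
    then show "k \<in> carrier G \<and> s \<otimes> k \<in> T" using sc Tc s2 by (auto simp: K_def)
  next
    assume "k \<in> carrier G \<and> s \<otimes> k \<in> T"
    then show "k \<in> K" unfolding K_def by (intro image_eqI[of _ _ "s \<otimes> k"]) (simp_all add: s2)
  qed
  have kk: "k \<otimes> k = \<one>" if "k \<in> K" for k
  proof -
    have kc: "k \<in> carrier G" "(s \<otimes> k) \<otimes> (s \<otimes> k) = \<one>" using that T2 by (simp_all add: inK)
    moreover have "(s \<otimes> k) \<otimes> (s \<otimes> k) = s \<otimes> (s \<otimes> (k \<otimes> k))" using kc sc by (simp add: G.m_ac)
    ultimately show ?thesis by (simp add: s2)
  qed
  have sub: "subgroup K G"
  proof (rule G.subgroupI)
    show "K \<subseteq> carrier G" using inK by blast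
    have "\<one> \<in> K" using s sc by (simp add: inK)
    then show "K \<noteq> {}" by blast
    show "inv a \<in> K" if "a \<in> K" for a
    proof -
      have "inv a = a" using kk[OF that] that by (intro G.inv_equality) (simp_all add: inK)
      then show ?thesis using that by simp
    qed
    show "a \<otimes> b \<in> K" if "a \<in> K" "b \<in> K" for a b
    proof -
      have c: "a \<in> carrier G" "b \<in> carrier G" using that inK by blast+
      \<comment> \<open>With s in the middle, ternary closure of the support becomes binary closure
        of its translate K.\<close>
      have "(s \<otimes> a) \<otimes> s \<otimes> (s \<otimes> b) \<in> T" using that s by (intro T3) (simp_all add: inK)
      moreover have "(s \<otimes> a) \<otimes> s \<otimes> (s \<otimes> b) = s \<otimes> (s \<otimes> (s \<otimes> (a \<otimes> b)))"
        using c sc by (simp add: G.m_ac)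
      ultimately show ?thesis using c sc by (simp add: inK s2)
    qed
  qed
  have "inj_on (\<lambda>g. s \<otimes> g) T" using Tc sc by (auto intro!: inj_onI)
  then have cK: "card K = 8" using cT by (simp add: K_def card_image)
  then have "finite K" by (intro card_ge_0_finite) simp
  then have "elementary_2_subgroup G K 3"
    using sub kk cK by (simp add: G.elementary_2_subgroup_iff)
  then obtain h1 h2 h3 where gens: "G.cd_gens K h1 h2 h3" by (rule G.elementary_generators)
  have "grading_iso C G (\<lambda>g. cd_grading C w G h1 h2 h3 (inv s \<otimes> g)) \<Gamma>"
  proof (rule shifted_cd_grading_iso[OF gens two w sc ss sqrt fam tc])
    show "\<exists>x\<in>\<Gamma> (s \<otimes> k). nrm x \<noteq> 0" if "k \<in> K" for k
      using that xs nx inK by blast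
  qed
  then have iso: "grading_iso C G \<Gamma> (\<lambda>g. cd_grading C w G h1 h2 h3 (inv s \<otimes> g))"
    by (rule grading_iso_sym)
  have "s = \<one> \<or> s \<notin> K" using s(2) ss by (auto simp: inK)
  then show thesis using that gens sc ss iso by blast
qed

lemma shift_subgroup:
  assumes gens: "G.cd_gens K h1 h2 h3" and s: "s \<in> carrier G" "s \<otimes> s = \<one>" "s \<notin> K"
  shows "elementary_2_subgroup G (K \<union> (\<lambda>k. s \<otimes> k) ` K) 4"
    "index_2_subgroup G (K \<union> (\<lambda>k. s \<otimes> k) ` K) K" "s \<in> K \<union> (\<lambda>k. s \<otimes> k) ` K"
proof -
  let ?H = "K \<union> (\<lambda>k. s \<otimes> k) ` K"
  note K = G.cd_gensD[OF gens]
  have Kc: "K \<subseteq> carrier G" using K by blast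
  have "generate G K = K"
    using G.generate_subgroup_incl[OF _ K(1), of K] generate.incl[of _ K] by blast
  then have H: "generate G (insert s K) = ?H"
    using G.generate_insert_involution[OF s(1,2) Kc] by simp
  then have sub: "subgroup ?H G"
    using G.generate_is_subgroup[of "insert s K"] Kc s by simp
  show sH: "s \<in> ?H" unfolding H[symmetric] by (rule generate.incl) simp
  have exp: "x \<otimes> x = \<one>" if "x \<in> ?H" for x
  proof -
    have "(s \<otimes> k) \<otimes> (s \<otimes> k) = (s \<otimes> s) \<otimes> (k \<otimes> k)" if "k \<in> K" for k
      using that K s by (simp add: G.m_ac)
    then show ?thesis using that K s by auto
  qed
  have fin: "finite K" and cK: "card K = 8"
    using gens by (auto simp: G.cd_gens_def intro: card_ge_0_finite)
  have disj: "K \<inter> (\<lambda>k. s \<otimes> k) ` K = {}"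
  proof (rule ccontr)
    assume "K \<inter> (\<lambda>k. s \<otimes> k) ` K \<noteq> {}"
    then obtain k where k: "k \<in> K" "s \<otimes> k \<in> K" by blast
    then have "s \<otimes> k \<otimes> k \<in> K" using subgroup.m_closed[OF K(1)] by blast
    then show False using k K s by (simp add: G.m_assoc)
  qed
  have "card ((\<lambda>k. s \<otimes> k) ` K) = card K"
    using Kc s by (intro card_image inj_onI) (auto simp: subsetD)
  then have cH: "card ?H = 16" using disj fin cK by (simp add: card_Un_disjoint)
  show "elementary_2_subgroup G ?H 4"
    using sub exp fin cH by (auto simp: G.elementary_2_subgroup_iff)
  show "index_2_subgroup G ?H K"
    using sub fin cH cK K by (subst G.index_2_subgroup_iff) auto
qed

lemma grading_classification:
  assumes two: "(2::'f) \<noteq> 0" and sqrt: "\<And>a::'f. \<exists>r. r\<^sup>2 = a"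
    and b: "standard_basis C b" and w: "cd_basis C w" and gr: "is_grading C G \<Gamma>"
  shows "(\<exists>\<alpha>\<in>hom Z3 G. grading_iso C G \<Gamma> (Gamma_alpha C b \<alpha>)) \<or>
    (\<exists>H. elementary_2_subgroup G H 3 \<and> (\<exists>\<Delta>\<in>Gamma_H C w G H. grading_iso C G \<Gamma> \<Delta>)) \<or>
    (\<exists>H K. elementary_2_subgroup G H 4 \<and> index_2_subgroup G H K \<and>
       (\<exists>\<Delta>\<in>Gamma_HK C w G H K. grading_iso C G \<Gamma> \<Delta>))"
proof -
  note fam = grading_orthogonal(1)[OF gr] and tc = grading_orthogonal(2)[OF gr]
  show ?thesis
  proof (cases "\<exists>g\<in>carrier G. \<exists>x\<in>\<Gamma> g. x \<noteq> 0 \<and> nrm x = 0")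
    case True
    then show ?thesis using isotropic_grading_iso[OF two fam tc b] by blast
  next
    case False
    then obtain s K h1 h2 h3 where gens: "G.cd_gens K h1 h2 h3"
        and s: "s \<in> carrier G" "s \<otimes> s = \<one>" "s = \<one> \<or> s \<notin> K"
        and iso: "grading_iso C G \<Gamma> (\<lambda>g. cd_grading C w G h1 h2 h3 (inv s \<otimes> g))"
      using anisotropic_grading_iso[OF two sqrt w fam tc] by metis
    have \<Delta>: "cd_grading C w G h1 h2 h3 \<in> Gamma_H C w G K"
      using gens unfolding Gamma_H_def G.cd_gens_def by blast
    show ?thesis
    proof (cases "s = \<one>")
      case True
      then have "grading_iso C G \<Gamma> (cd_grading C w G h1 h2 h3)"
        using iso unfolding grading_iso_def by simp
      moreover have "elementary_2_subgroup G K 3"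
        using gens by (auto simp: G.elementary_2_subgroup_iff G.cd_gens_def intro: card_ge_0_finite)
      ultimately show ?thesis using \<Delta> by blast
    next
      case False
      then have sK: "s \<notin> K" using s by blast
      note H = shift_subgroup[OF gens s(1,2) sK]
      have "(\<lambda>g. cd_grading C w G h1 h2 h3 (inv s \<otimes> g)) \<in> Gamma_HK C w G (K \<union> (\<lambda>k. s \<otimes> k) ` K) K"
        unfolding Gamma_HK_def using \<Delta> H(3) sK by blast
      then show ?thesis using H(1,2) iso by blast
    qed
  qed
qed

end

section \<open>Distinguishing the gradings\<close>

lemma (in cayley_algebra) standard_basis_nonzero:
  assumes "standard_basis C b"
  shows "b k \<noteq> 0"
proof
  assume "b k = 0"
  then have "0 \<in> range b" by (metis rangeI)
  then have "dependent (range b)" by (rule dependent_zero)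
  then show False using assms by (simp add: standard_basis_def)
qed

lemma (in cayley_algebra) standard_basis_isotropic_E1:
  assumes "standard_basis C b"
  shows "nrm (b E1) = 0"
proof -
  have "b E1 \<odot> b E2 = 0" using assms by (simp add: standard_basis_def)
  then show ?thesis
    using conj_left_prod[of "b E1" "b E2"] standard_basis_nonzero[OF assms] by simp
qed

lemma (in cayley_algebra) grading_iso_transfer:
  assumes "grading_iso C G \<Gamma> \<Delta>" "g \<in> carrier G" "x \<in> \<Gamma> g" "x \<noteq> 0"
  shows "\<exists>y\<in>\<Delta> g. y \<noteq> 0 \<and> nrm y = nrm x"
proof -
  obtain \<phi> where "\<phi> \<in> triple_aut C" "\<phi> ` \<Gamma> g = \<Delta> g"
    using assms unfolding grading_iso_def by blast
  then show ?thesis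
    using assms triple_autD(7)[of \<phi> x] triple_aut_nrm[of \<phi> x] by blast
qed

context cayley_group
begin

lemma shifted_support:
  assumes gens: "G.cd_gens K h1 h2 h3" and two: "(2::'f) \<noteq> 0" and w: "cd_basis C w"
    and s: "s \<in> carrier G" "s \<otimes> s = \<one>"
  shows "(\<exists>x\<in>cd_grading C w G h1 h2 h3 (inv s \<otimes> g). x \<noteq> 0) \<longleftrightarrow> s \<otimes> g \<in> K"
proof -
  have "nrm x = 1 \<Longrightarrow> x \<noteq> 0" for x by auto
  then show ?thesis
    unfolding inv_shift(1)[OF gens two w s]
    using cd_grading_nonzero(1)[OF gens two w] cd_grading_unit_vector[OF gens two w] by metis
qed

lemma shifted_iso_support:
  assumes two: "(2::'f) \<noteq> 0" and w: "cd_basis C w"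
    and A: "G.cd_gens K h1 h2 h3" "s \<in> carrier G" "s \<otimes> s = \<one>"
    and B: "G.cd_gens K' h1' h2' h3'" "s' \<in> carrier G" "s' \<otimes> s' = \<one>"
    and iso: "grading_iso C G (\<lambda>g. cd_grading C w G h1 h2 h3 (inv s \<otimes> g))
      (\<lambda>g. cd_grading C w G h1' h2' h3' (inv s' \<otimes> g))"
    and g: "g \<in> carrier G"
  shows "s \<otimes> g \<in> K \<longleftrightarrow> s' \<otimes> g \<in> K'"
  unfolding shifted_support[OF A(1) two w A(2,3), symmetric] shifted_support[OF B(1) two w B(2,3), symmetric]
  using grading_iso_transfer[OF iso g] grading_iso_transfer[OF grading_iso_sym[OF iso] g] by blast

text \<open>An isomorphism preserves the support, here the coset s K respectively s' K'. It contains
  s, so s' s is in K', and multiplying by s' s brings k in K into K'.\<close>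

lemma shifted_iso_subset:
  assumes two: "(2::'f) \<noteq> 0" and w: "cd_basis C w"
    and A: "G.cd_gens K h1 h2 h3" "s \<in> carrier G" "s \<otimes> s = \<one>"
    and B: "G.cd_gens K' h1' h2' h3'" "s' \<in> carrier G" "s' \<otimes> s' = \<one>"
    and iso: "grading_iso C G (\<lambda>g. cd_grading C w G h1 h2 h3 (inv s \<otimes> g))
      (\<lambda>g. cd_grading C w G h1' h2' h3' (inv s' \<otimes> g))"
  shows "K \<subseteq> K'" "s' \<otimes> s \<in> K'"
proof -
  note K = G.cd_gensD[OF A(1)] and K' = G.cd_gensD[OF B(1)]
  note supp = shifted_iso_support[OF assms]
  have "s \<otimes> s \<in> K" using A subgroup.one_closed[OF K(1)] by simp
  then show 1: "s' \<otimes> s \<in> K'" using supp[of s] A(2) by blast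
  show "K \<subseteq> K'"
  proof
    fix k assume k: "k \<in> K"
    then have kc: "k \<in> carrier G" using K by blast
    have "s \<otimes> (s \<otimes> k) = k" using A kc by (simp add: G.m_assoc[symmetric])
    then have "s' \<otimes> (s \<otimes> k) \<in> K'" using supp[of "s \<otimes> k"] k kc A(2) by simp
    then have "(s' \<otimes> s) \<otimes> (s' \<otimes> (s \<otimes> k)) \<in> K'" using 1 subgroup.m_closed[OF K'(1)] by blast
    moreover have "(s' \<otimes> s) \<otimes> (s' \<otimes> (s \<otimes> k)) = (s' \<otimes> s') \<otimes> ((s \<otimes> s) \<otimes> k)"
      using A(2) B(2) kc by (simp add: G.m_ac)
    ultimately show "k \<in> K'" using A B kc by simp
  qed
qed

lemma Gamma_alpha_not_shifted:
  assumes two: "(2::'f) \<noteq> 0" and w: "cd_basis C w" and b: "standard_basis C b"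
    and A: "G.cd_gens K h1 h2 h3" and \<alpha>: "\<alpha> \<in> hom Z3 G"
  shows "\<not> grading_iso C G (Gamma_alpha C b \<alpha>) (\<lambda>g. cd_grading C w G h1 h2 h3 (inv s \<otimes> g))"
proof
  assume iso: "grading_iso C G (Gamma_alpha C b \<alpha>) (\<lambda>g. cd_grading C w G h1 h2 h3 (inv s \<otimes> g))"
  have "b E1 \<in> Gamma_alpha C b \<alpha> (\<alpha> (std_degree E1))"
    unfolding Gamma_alpha_eq by (intro span_base) auto
  then obtain y where "y \<in> cd_grading C w G h1 h2 h3 (inv s \<otimes> \<alpha> (std_degree E1))" "y \<noteq> 0"
      "nrm y = 0"
    using grading_iso_transfer[OF iso hom_Z3D(1)[OF \<alpha>]] standard_basis_nonzero[OF b]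
      standard_basis_isotropic_E1[OF b] by metis
  then show False using cd_grading_nonzero(2)[OF A two w] by blast
qed

text \<open>The unshifted grading is treated as the shift by \<open>\<one>\<close>, so that both
  kinds share the lemmas on shifts. Outside the carrier the two families may differ as functions,
  hence equivalences about \<open>grading_iso\<close> rather than an equation.\<close>

lemma Gamma_HE:
  assumes H: "elementary_2_subgroup G H 3" and \<Delta>: "\<Delta> \<in> Gamma_H C w G H"
  obtains h1 h2 h3 where "G.cd_gens H h1 h2 h3" "\<Delta> = cd_grading C w G h1 h2 h3"
    "\<And>\<Gamma>. grading_iso C G \<Gamma> \<Delta> \<longleftrightarrow> grading_iso C G \<Gamma> (\<lambda>g. cd_grading C w G h1 h2 h3 (inv \<one> \<otimes> g))"
    "\<And>\<Gamma>. grading_iso C G \<Delta> \<Gamma> \<longleftrightarrow> grading_iso C G (\<lambda>g. cd_grading C w G h1 h2 h3 (inv \<one> \<otimes> g)) \<Gamma>"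
proof -
  obtain h1 h2 h3 where h: "\<Delta> = cd_grading C w G h1 h2 h3" "{h1, h2, h3} \<subseteq> H" "generate G {h1, h2, h3} = H"
    using \<Delta> unfolding Gamma_H_def by blast
  then have "G.cd_gens H h1 h2 h3"
    using H unfolding G.cd_gens_def G.elementary_2_subgroup_iff by simp
  then show ?thesis using that h(1) by (simp add: grading_iso_def)
qed

lemma Gamma_HKE:
  assumes H: "elementary_2_subgroup G H 4" and K: "index_2_subgroup G H K"
    and \<Delta>: "\<Delta> \<in> Gamma_HK C w G H K"
  obtains s h1 h2 h3 where "G.cd_gens K h1 h2 h3" "\<Delta> = (\<lambda>g. cd_grading C w G h1 h2 h3 (inv s \<otimes> g))"
    "s \<in> carrier G" "s \<otimes> s = \<one>" "s \<notin> K" "H = K \<union> (\<lambda>k. s \<otimes> k) ` K"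
proof -
  have H': "subgroup H G" "\<forall>x\<in>H. x \<otimes> x = \<one>" "finite H" "card H = 16"
    using H by (simp_all add: G.elementary_2_subgroup_iff)
  have K': "subgroup K G" "K \<subseteq> H" "card K = 8"
    using K H' by (simp_all add: G.index_2_subgroup_iff)
  obtain s h1 h2 h3 where h: "\<Delta> = (\<lambda>g. cd_grading C w G h1 h2 h3 (inv s \<otimes> g))" "s \<in> H" "s \<notin> K"
      "{h1, h2, h3} \<subseteq> K" "generate G {h1, h2, h3} = K"
    using \<Delta> unfolding Gamma_HK_def Gamma_H_def by auto
  have gens: "G.cd_gens K h1 h2 h3"
    unfolding G.cd_gens_def using K' H' h by auto
  have s: "s \<in> carrier G" "s \<otimes> s = \<one>" using h H' subgroup.subset by blast+
  let ?H = "K \<union> (\<lambda>k. s \<otimes> k) ` K"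
  have "?H \<subseteq> H" using K' subgroup.m_closed[OF H'(1)] h(2) by auto
  moreover have "card ?H = card H"
    using shift_subgroup(1)[OF gens s h(3)] H' by (simp add: G.elementary_2_subgroup_iff)
  ultimately have "?H = H" using H' card_subset_eq by blast
  then show ?thesis using that gens h s by blast
qed

text \<open>Necessity compares supports. For sufficiency, s' s k lies in K' for every k in K, so the
  second grading has a vector of norm 1 in degree s k and can serve as the target of
  \<open>shifted_cd_grading_iso\<close>.\<close>

lemma shifted_iso_iff:
  assumes two: "(2::'f) \<noteq> 0" and sqrt: "\<And>a::'f. \<exists>r. r\<^sup>2 = a" and w: "cd_basis C w"
    and A: "G.cd_gens K h1 h2 h3" "s \<in> carrier G" "s \<otimes> s = \<one>"
    and B: "G.cd_gens K' h1' h2' h3'" "s' \<in> carrier G" "s' \<otimes> s' = \<one>"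
  shows "grading_iso C G (\<lambda>g. cd_grading C w G h1 h2 h3 (inv s \<otimes> g))
      (\<lambda>g. cd_grading C w G h1' h2' h3' (inv s' \<otimes> g)) \<longleftrightarrow> K = K' \<and> s' \<otimes> s \<in> K'"
    (is "grading_iso C G ?\<Delta> ?\<Delta>' \<longleftrightarrow> _")
proof
  assume iso: "grading_iso C G ?\<Delta> ?\<Delta>'"
  show "K = K' \<and> s' \<otimes> s \<in> K'"
    using shifted_iso_subset[OF two w A B iso] shifted_iso_subset(1)[OF two w B A grading_iso_sym[OF iso]]
    by blast
next
  assume K: "K = K' \<and> s' \<otimes> s \<in> K'"
  show "grading_iso C G ?\<Delta> ?\<Delta>'"
  proof (rule shifted_cd_grading_iso[OF A(1) two w A(2,3) sqrt])
    show "orthogonal_family G ?\<Delta>'" "triple_closed G ?\<Delta>'"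
      using shifted_cd_grading_orthogonal[OF B(1) two w B(2,3)]
        shifted_cd_grading_closed[OF B(1) two w B(2,3)] by blast+
    fix k assume k: "k \<in> K"
    have "s' \<otimes> s \<otimes> k \<in> K'" using K k subgroup.m_closed[OF G.cd_gensD(1)[OF B(1)]] by blast
    then have "s' \<otimes> (s \<otimes> k) \<in> K'" using A(2) B(2) G.cd_gensD(3)[OF A(1) k] by (simp add: G.m_assoc)
    then obtain x where "x \<in> cd_grading C w G h1' h2' h3' (s' \<otimes> (s \<otimes> k))" "nrm x = 1"
      using cd_grading_unit_vector[OF B(1) two w] by blast
    then show "\<exists>x\<in>cd_grading C w G h1' h2' h3' (inv s' \<otimes> (s \<otimes> k)). nrm x \<noteq> 0"
      unfolding inv_shift(1)[OF B(1) two w B(2,3)] by (intro bexI[of _ x]) simp_all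
  qed
qed

lemma Gamma_H_iso_iff:
  assumes two: "(2::'f) \<noteq> 0" and sqrt: "\<And>a::'f. \<exists>r. r\<^sup>2 = a" and w: "cd_basis C w"
    and H: "elementary_2_subgroup G H 3" "\<Delta> \<in> Gamma_H C w G H"
    and H': "elementary_2_subgroup G H' 3" "\<Delta>' \<in> Gamma_H C w G H'"
  shows "grading_iso C G \<Delta> \<Delta>' \<longleftrightarrow> H = H'"
proof -
  obtain h1 h2 h3 where A: "G.cd_gens H h1 h2 h3"
    "\<And>\<Gamma>. grading_iso C G \<Delta> \<Gamma> \<longleftrightarrow> grading_iso C G (\<lambda>g. cd_grading C w G h1 h2 h3 (inv \<one> \<otimes> g)) \<Gamma>"
    using Gamma_HE[OF H] by metis
  obtain h1' h2' h3' where B: "G.cd_gens H' h1' h2' h3'"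
    "\<And>\<Gamma>. grading_iso C G \<Gamma> \<Delta>' \<longleftrightarrow> grading_iso C G \<Gamma> (\<lambda>g. cd_grading C w G h1' h2' h3' (inv \<one> \<otimes> g))"
    using Gamma_HE[OF H'] by metis
  show ?thesis
    unfolding A(2) B(2) using subgroup.one_closed[OF G.cd_gensD(1)[OF B(1)]]
    by (subst shifted_iso_iff[OF two sqrt w A(1) _ _ B(1)]) simp_all
qed

text \<open>For K = K' the condition that s' s is in K says that s and s' lie in the same coset of
  K, that is, that K and this coset have the same union.\<close>

lemma Gamma_HK_iso_iff:
  assumes two: "(2::'f) \<noteq> 0" and sqrt: "\<And>a::'f. \<exists>r. r\<^sup>2 = a" and w: "cd_basis C w"
    and H: "elementary_2_subgroup G H 4" "index_2_subgroup G H K" "\<Delta> \<in> Gamma_HK C w G H K"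
    and H': "elementary_2_subgroup G H' 4" "index_2_subgroup G H' K'" "\<Delta>' \<in> Gamma_HK C w G H' K'"
  shows "grading_iso C G \<Delta> \<Delta>' \<longleftrightarrow> H = H' \<and> K = K'"
proof -
  obtain s h1 h2 h3 where A: "G.cd_gens K h1 h2 h3" "s \<in> carrier G" "s \<otimes> s = \<one>"
    and \<Delta>: "\<Delta> = (\<lambda>g. cd_grading C w G h1 h2 h3 (inv s \<otimes> g))" and sK: "s \<notin> K" "H = K \<union> (\<lambda>k. s \<otimes> k) ` K"
    by (rule Gamma_HKE[OF H])
  obtain s' h1' h2' h3' where B: "G.cd_gens K' h1' h2' h3'" "s' \<in> carrier G" "s' \<otimes> s' = \<one>"
    and \<Delta>': "\<Delta>' = (\<lambda>g. cd_grading C w G h1' h2' h3' (inv s' \<otimes> g))"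
    and sK': "s' \<notin> K'" "H' = K' \<union> (\<lambda>k. s' \<otimes> k) ` K'"
    by (rule Gamma_HKE[OF H'])
  note K = G.cd_gensD[OF A(1)]
  have can: "t \<otimes> (t \<otimes> x) = x" if "t \<in> carrier G" "t \<otimes> t = \<one>" "x \<in> carrier G" for t x
    using that by (simp add: G.m_assoc[symmetric])
  have coset: "(\<lambda>k. s \<otimes> k) ` K \<subseteq> (\<lambda>k. t \<otimes> k) ` K"
    if t: "t \<otimes> s \<in> K" "t \<in> carrier G" "t \<otimes> t = \<one>" "s \<in> carrier G" for s t
  proof (rule image_subsetI)
    fix k assume k: "k \<in> K"
    show "s \<otimes> k \<in> (\<lambda>k. t \<otimes> k) ` K"
    proof (rule image_eqI)
      show "s \<otimes> k = t \<otimes> (t \<otimes> s \<otimes> k)" using t K k can by (simp add: G.m_assoc)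
      show "t \<otimes> s \<otimes> k \<in> K" using t k subgroup.m_closed[OF K(1)] by blast
    qed
  qed
  have "s' \<otimes> s \<in> K' \<longleftrightarrow> H = H'" if KK: "K = K'"
  proof
    assume "s' \<otimes> s \<in> K'"
    then have "s' \<otimes> s \<in> K" "s \<otimes> s' \<in> K" using KK A(2) B(2) by (simp_all add: G.m_comm)
    then have "(\<lambda>k. s \<otimes> k) ` K = (\<lambda>k. s' \<otimes> k) ` K" using coset A B by blast
    then show "H = H'" using KK sK(2) sK'(2) by simp
  next
    assume eq: "H = H'"
    have "s \<in> H" using sK(2) A subgroup.one_closed[OF K(1)] by (auto intro!: image_eqI[of _ _ \<one>])
    then obtain l where "l \<in> K" "s = s' \<otimes> l" using eq KK sK(1) sK'(2) by auto
    then show "s' \<otimes> s \<in> K'" using can B K KK by simp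
  qed
  then show ?thesis
    unfolding \<Delta> \<Delta>' shifted_iso_iff[OF two sqrt w A B] by blast
qed

lemma Gamma_H_not_iso_Gamma_HK:
  assumes two: "(2::'f) \<noteq> 0" and w: "cd_basis C w"
    and H: "elementary_2_subgroup G H 3" "\<Delta> \<in> Gamma_H C w G H"
    and H': "elementary_2_subgroup G H' 4" "index_2_subgroup G H' K'" "\<Delta>' \<in> Gamma_HK C w G H' K'"
  shows "\<not> grading_iso C G \<Delta> \<Delta>'"
proof
  assume iso: "grading_iso C G \<Delta> \<Delta>'"
  obtain h1 h2 h3 where A: "G.cd_gens H h1 h2 h3"
    "\<And>\<Gamma>. grading_iso C G \<Delta> \<Gamma> \<longleftrightarrow> grading_iso C G (\<lambda>g. cd_grading C w G h1 h2 h3 (inv \<one> \<otimes> g)) \<Gamma>"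
    using Gamma_HE[OF H] by metis
  obtain s' h1' h2' h3' where B: "G.cd_gens K' h1' h2' h3'" "s' \<in> carrier G" "s' \<otimes> s' = \<one>"
    and \<Delta>': "\<Delta>' = (\<lambda>g. cd_grading C w G h1' h2' h3' (inv s' \<otimes> g))" and sK': "s' \<notin> K'"
    by (rule Gamma_HKE[OF H'])
  have o: "\<one> \<in> carrier G" "\<one> \<otimes> \<one> = \<one>" by simp_all
  have "s' \<otimes> \<one> \<in> K'"
    using shifted_iso_subset(2)[OF two w A(1) o B] iso unfolding A(2) \<Delta>' by blast
  then show False using sK' B by simp
qed

end

section \<open>The Weyl group of the Cartan grading\<close>

lemma std_degree_inj [simp]: "std_degree k = std_degree l \<longleftrightarrow> k = l"
proof -
  have "\<forall>k l. std_degree k = std_degree l \<longleftrightarrow> k = l"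
    unfolding all_std_index std_degree_simps std_degree.simps(1,2) by (simp add: mod3_simps)
  then show ?thesis by blast
qed

text \<open>The four weights below add up to zero, and the support consists of these weights and their
  opposites. The Weyl group is the full group of their permutations and common sign changes.\<close>

definition pos_indices :: "std_index set" where
  "pos_indices = {E1, U 1, U 2, U 3}"

definition opp :: "std_index \<Rightarrow> std_index" where
  "opp k = (case k of E1 \<Rightarrow> E2 | E2 \<Rightarrow> E1 | U i \<Rightarrow> V i | V i \<Rightarrow> U i)"

context cayley_algebra
begin

section \<open>Unit and norm recovered from the multiplication table of a standard basis\<close>

lemma standard_basis_table:
  assumes "standard_basis C b"
  shows "b E1 \<odot> b E1 = b E1" "b E2 \<odot> b E2 = b E2" "b E1 \<odot> b E2 = 0" "b E2 \<odot> b E1 = 0"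
    "b E1 \<odot> b (U i) = b (U i)" "b (U i) \<odot> b E2 = b (U i)" "b E2 \<odot> b (U i) = 0" "b (U i) \<odot> b E1 = 0"
    "b E2 \<odot> b (V i) = b (V i)" "b (V i) \<odot> b E1 = b (V i)" "b E1 \<odot> b (V i) = 0" "b (V i) \<odot> b E2 = 0"
    "b (U i) \<odot> b (V i) = - b E1" "b (V i) \<odot> b (U i) = - b E2"
    "b (U i) \<odot> b (U i) = 0" "b (V i) \<odot> b (V i) = 0"
    "i \<noteq> j \<Longrightarrow> b (U i) \<odot> b (V j) = 0" "i \<noteq> j \<Longrightarrow> b (V i) \<odot> b (U j) = 0"
    "b (U 1) \<odot> b (U 2) = b (V 3)" "b (U 2) \<odot> b (U 1) = - b (V 3)"
    "b (U 3) \<odot> b (U 1) = b (V 2)" "b (U 1) \<odot> b (U 3) = - b (V 2)"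
    "b (V 1) \<odot> b (V 2) = b (U 3)" "b (V 2) \<odot> b (V 1) = - b (U 3)"
    "b (V 3) \<odot> b (V 1) = b (U 2)" "b (V 1) \<odot> b (V 3) = - b (U 2)"
  using assms[unfolded standard_basis_def] mod3_simps by (metis (no_types))+

context
  fixes b
  assumes b: "standard_basis C b"
begin

lemmas table = standard_basis_table[OF b]

lemma standard_basis_nz: "b k \<noteq> 0"
  using standard_basis_nonzero[OF b] .

lemma standard_basis_one: "b E1 + b E2 = \<e>"
proof -
  have "(b E1 + b E2) \<odot> x = x" for x
  proof -
    have "x \<in> span (range b)" using b by (simp add: standard_basis_def)
    then show ?thesis
    proof (rule span_induct)
      show "subspace {x. (b E1 + b E2) \<odot> x = x}"
        unfolding subspace_def by (auto simp: prod_add_right prod_scale_right)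
      fix x assume "x \<in> range b"
      then obtain k where "x = b k" by blast
      then show "(b E1 + b E2) \<odot> x = x" by (cases k) (simp_all add: prod_add_left table)
    qed
  qed
  from this[of \<e>] show ?thesis by (simp add: unit_right)
qed

lemma standard_basis_compl: "\<e> - b E1 = b E2" "\<e> - b E2 = b E1"
  using standard_basis_one by (simp_all add: algebra_simps flip: standard_basis_one)

lemma standard_basis_idem: "idem (b E1)" "idem (b E2)"
proof -
  have n: "nrm (b E1) = 0" by (rule standard_basis_isotropic_E1[OF b])
  have "pol (b E1) \<e> \<cdot> b E1 = 1 \<cdot> b E1"
    using table(1) square_eq[of "b E1"] n by simp
  then have "pol (b E1) \<e> = 1" using standard_basis_nz by (simp only: scale_cancel_right) simp
  then show 1: "idem (b E1)" using n by (simp add: idem_def)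
  show "idem (b E2)" using idem_compl[OF 1] by (simp add: standard_basis_compl)
qed

text \<open>e u = u with e isotropic makes u isotropic, so u u = 0 leaves only the trace term in
  \<open>square_eq\<close>. Orthogonality to e follows by writing both vectors as left multiples of
  the isotropic e.\<close>

lemma standard_basis_peirce: "peirce (b E1) (b (U i))" "peirce (b E2) (b (V i))"
proof -
  have *: "peirce e u" if e: "idem e" "e \<odot> u = u" "u \<odot> u = 0" "u \<noteq> 0" for e u
  proof -
    have n: "nrm u = 0" "nrm e = 0"
      using e norm_mult[of e u] by (simp_all add: idem_def)
    have "pol u \<e> \<cdot> u = 0" using e(3) square_eq[of u] n by simp
    then have "pol u \<e> = 0" using e by simp
    moreover have "pol u e = 0"
      using pol_prod_left[of e u \<e>] e n by (simp add: unit_right)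
    ultimately show ?thesis using e by (simp add: peirce_def)
  qed
  show "peirce (b E1) (b (U i))" "peirce (b E2) (b (V i))"
    using *[OF standard_basis_idem(1)] *[OF standard_basis_idem(2)] table standard_basis_nz by simp_all
qed

lemma standard_basis_pol: "pol (b (U i)) (b (V j)) = (if i = j then 1 else 0)"
proof -
  have "b (U i) \<odot> cj (b (V j)) + b (V j) \<odot> cj (b (U i)) = pol (b (U i)) (b (V j)) \<cdot> \<e>"
    by (rule prod_conj_linearized)
  then have eq: "- (b (U i) \<odot> b (V j)) - b (V j) \<odot> b (U i) = pol (b (U i)) (b (V j)) \<cdot> \<e>"
    using standard_basis_peirce[THEN peirce_conj] by (simp add: prod_minus_right)
  show ?thesis
  proof (cases "i = j")
    case True
    then have "1 \<cdot> \<e> = pol (b (U i)) (b (V j)) \<cdot> \<e>"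
      using eq by (simp add: table standard_basis_one)
    then show ?thesis using True by (simp only: scale_cancel_right) simp
  next
    case False
    then show ?thesis using eq by (simp add: table)
  qed
qed

lemma standard_basis_isotropic: "nrm (b k) = 0"
  using standard_basis_idem peirce_isotropic[OF standard_basis_idem(1) standard_basis_peirce(1)]
    peirce_isotropic[OF standard_basis_idem(2) standard_basis_peirce(2)]
  by (cases k) (simp_all add: idem_def)

lemma standard_basis_orthogonal:
  assumes "\<And>i. {k, l} \<noteq> {U i, V i}" "{k, l} \<noteq> {E1, E2}"
  shows "pol (b k) (b l) = 0"
proof -
  note P = standard_basis_peirce and I = standard_basis_idem
  have p1: "pol (b (U i)) (b (U j)) = 0" "pol (b (V i)) (b (V j)) = 0" for i j
    using peirce_pol[OF I(1) P(1) P(1)] peirce_pol[OF I(2) P(2) P(2)] by blast+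
  have p2: "pol (b (U i)) (b E1) = 0" "pol (b (U i)) (b E2) = 0"
    "pol (b (V i)) (b E1) = 0" "pol (b (V i)) (b E2) = 0" for i
    using P[of i] peirce_compl_pol(1)[OF P(1)[of i]] peirce_compl_pol(1)[OF P(2)[of i]]
    by (simp_all add: standard_basis_compl peirce_def)
  have p3: "pol (b E1) (b E1) = 0" "pol (b E2) (b E2) = 0"
    using standard_basis_isotropic by (simp_all add: pol_self)
  show ?thesis
    using assms p1 p2 p2[THEN pol_zero_sym] p3 standard_basis_pol standard_basis_pol[THEN trans[OF pol_commute]]
    by (cases k; cases l) (auto simp: doubleton_eq_iff)
qed

text \<open>A working form of membership in \<open>weyl_on_degrees\<close>: one representative
  \<phi> replaces the coset, and \<pi> records the permutation of the basis lines, which are the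
  components since the eight weights are distinct.\<close>

definition degree_action :: "(int \<times> int \<times> int \<Rightarrow> int \<times> int \<times> int) \<Rightarrow> bool" where
  "degree_action \<omega> \<longleftrightarrow> \<omega> \<in> hom Z3 Z3 \<and> bij \<omega> \<and> (\<exists>\<phi>\<in>triple_aut C. \<exists>\<pi>. \<forall>k.
     std_degree (\<pi> k) = \<omega> (std_degree k) \<and> \<phi> ` span {b k} = span {b (\<pi> k)})"

lemma degree_action_id: "degree_action id"
  unfolding degree_action_def
  using triple_aut_id(1) by (auto simp: hom_def intro!: bexI[of _ id] exI[of _ id])

lemma degree_action_comp:
  assumes "degree_action \<omega>" "degree_action \<omega>'"
  shows "degree_action (\<omega> \<circ> \<omega>')"
proof -
  obtain \<phi> \<pi> where 1: "\<phi> \<in> triple_aut C"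
      "\<forall>k. std_degree (\<pi> k) = \<omega> (std_degree k) \<and> \<phi> ` span {b k} = span {b (\<pi> k)}"
    using assms(1) unfolding degree_action_def by blast
  obtain \<phi>' \<pi>' where 2: "\<phi>' \<in> triple_aut C"
      "\<forall>k. std_degree (\<pi>' k) = \<omega>' (std_degree k) \<and> \<phi>' ` span {b k} = span {b (\<pi>' k)}"
    using assms(2) unfolding degree_action_def by blast
  have "\<forall>k. std_degree ((\<pi> \<circ> \<pi>') k) = (\<omega> \<circ> \<omega>') (std_degree k)
      \<and> (\<phi> \<circ> \<phi>') ` span {b k} = span {b ((\<pi> \<circ> \<pi>') k)}"
    using 1(2) 2(2) by (metis comp_apply image_comp)
  moreover have "\<omega> \<circ> \<omega>' \<in> hom Z3 Z3"
  proof (rule homI)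
    fix x y
    have "\<omega> (u \<otimes>\<^bsub>Z3\<^esub> v) = \<omega> u \<otimes>\<^bsub>Z3\<^esub> \<omega> v" "\<omega>' (u \<otimes>\<^bsub>Z3\<^esub> v) = \<omega>' u \<otimes>\<^bsub>Z3\<^esub> \<omega>' v" for u v
      using assms hom_mult[of _ Z3 Z3 u v] unfolding degree_action_def Z3_simps(1) by blast+
    then show "(\<omega> \<circ> \<omega>') (x \<otimes>\<^bsub>Z3\<^esub> y) = (\<omega> \<circ> \<omega>') x \<otimes>\<^bsub>Z3\<^esub> (\<omega> \<circ> \<omega>') y"
      by (simp only: comp_apply)
  qed simp
  moreover have "bij (\<omega> \<circ> \<omega>')"
    using assms unfolding degree_action_def by (blast intro: bij_comp)
  ultimately show ?thesis
    unfolding degree_action_def using triple_aut_comp[OF 1(1) 2(1)] by blast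
qed

text \<open>Signs are harmless because only the lines spanned by the basis vectors matter. The
  generators needed are involutions, which makes \<omega> bijective at once.\<close>

lemma degree_action_from_basis:
  assumes \<omega>: "\<And>x y. \<omega> (x \<otimes>\<^bsub>Z3\<^esub> y) = \<omega> x \<otimes>\<^bsub>Z3\<^esub> \<omega> y" "\<And>x. \<omega> (\<omega> x) = x"
    and c: "nrm c = 1" and b': "standard_basis (isotope C c) b'"
    and deg: "\<forall>k. std_degree (\<pi> k) = \<omega> (std_degree k)" "\<forall>k. b' k = b (\<pi> k) \<or> b' k = - b (\<pi> k)"
  shows "degree_action \<omega>"
proof -
  obtain \<phi> where \<phi>: "\<phi> \<in> triple_aut C" "\<forall>k. \<phi> (b k) = b' k"
    using standard_basis_triple_aut[OF c b b'] by blast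
  have neg: "span {- x} = span {x}" for x :: 'c
  proof -
    have "span {- x} \<subseteq> span {x}" for x :: 'c
      by (intro span_minimal subspace_span) (simp add: span_base span_neg)
    from this[of x] this[of "- x"] show ?thesis by auto
  qed
  have "\<phi> ` span {b k} = span {b (\<pi> k)}" for k
    using deg(2)[rule_format, of k] \<phi>(2) by (auto simp: triple_aut_span[OF \<phi>(1)] neg)
  moreover have "\<omega> \<in> hom Z3 Z3" using \<omega>(1) by (auto simp: hom_def)
  moreover have "bij \<omega>" using \<omega>(2) by (intro o_bij[of \<omega>]) auto
  ultimately show ?thesis unfolding degree_action_def using deg(1) \<phi>(1) by blast
qed

text \<open>In the standard basis built on the exchanged pairs the third pair becomes -u3,
  -v3.\<close>

lemma degree_action_swap12: "degree_action (\<lambda>(x, y, z). (y, x, z))"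
proof (rule degree_action_from_basis[where c = \<e>])
  show "standard_basis (isotope C \<e>) (std_basis_of (b E1) (b (U 2)) (b (U 1)) (b (V 2)) (b (V 1)))"
    unfolding isotope_one
    using standard_basis_idem standard_basis_peirce standard_basis_pol mod3_simps
    by (intro standard_basis_of) (simp_all add: standard_basis_compl)
  let ?p = "\<lambda>k. if k = U 1 then U 2 else if k = U 2 then U 1 else
    if k = V 1 then V 2 else if k = V 2 then V 1 else k"
  show "\<forall>k. std_degree (?p k) = (case std_degree k of (x, y, z) \<Rightarrow> (y, x, z))"
    unfolding all_std_index by (simp add: mod3_simps)
  show "\<forall>k. std_basis_of (b E1) (b (U 2)) (b (U 1)) (b (V 2)) (b (V 1)) k = b (?p k) \<or>
       std_basis_of (b E1) (b (U 2)) (b (U 1)) (b (V 2)) (b (V 1)) k = - b (?p k)"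
    unfolding all_std_index by (simp add: mod3_simps table standard_basis_compl)
qed auto

lemma degree_action_swap23: "degree_action (\<lambda>(x, y, z). (x, z, y))"
proof (rule degree_action_from_basis[where c = \<e>])
  show "standard_basis (isotope C \<e>) (std_basis_of (b E1) (b (U 1)) (b (U 3)) (b (V 1)) (b (V 3)))"
    unfolding isotope_one
    using standard_basis_idem standard_basis_peirce standard_basis_pol mod3_simps
    by (intro standard_basis_of) (simp_all add: standard_basis_compl)
  let ?p = "\<lambda>k. if k = U 3 then U 2 else if k = U 2 then U 3 else
    if k = V 3 then V 2 else if k = V 2 then V 3 else k"
  show "\<forall>k. std_degree (?p k) = (case std_degree k of (x, y, z) \<Rightarrow> (x, z, y))"
    unfolding all_std_index by (simp add: mod3_simps)
  show "\<forall>k. std_basis_of (b E1) (b (U 1)) (b (U 3)) (b (V 1)) (b (V 3)) k = b (?p k) \<or>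
       std_basis_of (b E1) (b (U 1)) (b (U 3)) (b (V 1)) (b (V 3)) k = - b (?p k)"
    unfolding all_std_index by (simp add: mod3_simps table standard_basis_compl)
qed auto

lemma degree_action_neg: "degree_action (\<lambda>(x, y, z). (- x, - y, - z))"
proof (rule degree_action_from_basis[where c = \<e>])
  show "standard_basis (isotope C \<e>) (std_basis_of (b E2) (b (V 1)) (b (V 2)) (b (U 1)) (b (U 2)))"
    unfolding isotope_one
    using standard_basis_idem standard_basis_peirce standard_basis_pol mod3_simps
    by (intro standard_basis_of) (simp_all add: standard_basis_compl pol_commute[of "b (V _)"])
  show "\<forall>k. std_degree (opp k) = (case std_degree k of (x, y, z) \<Rightarrow> (- x, - y, - z))"
    unfolding all_std_index by (simp add: mod3_simps opp_def)
  show "\<forall>k. std_basis_of (b E2) (b (V 1)) (b (V 2)) (b (U 1)) (b (U 2)) k = b (opp k) \<or>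
       std_basis_of (b E2) (b (V 1)) (b (V 2)) (b (U 1)) (b (U 2)) k = - b (opp k)"
    unfolding all_std_index by (simp add: mod3_simps table standard_basis_compl opp_def)
qed auto

text \<open>Exchanging an idempotent with a nilpotent basis vector is not induced by an automorphism of
  the algebra: the new standard basis lives in the isotope with unit \<open>b (U 1) + b (V 1)\<close>.\<close>

lemma degree_action_swap01: "degree_action (\<lambda>(x, y, z). (- x, y - x, z - x))"
proof -
  define c where "c = b (U 1) + b (V 1)"
  have c: "nrm c = 1"
    using standard_basis_pol[of 1 1] by (simp add: c_def nrm_add standard_basis_isotropic)
  have "cj c = - c"
    using standard_basis_peirce[THEN peirce_conj] by (simp add: c_def conj_add)
  then have tri: "tri x c y = - ((x \<odot> c) \<odot> y)" for x y
    by (simp add: triple_def prod_minus_left prod_minus_right)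
  interpret I: cayley_algebra "isotope C c" by (rule cayley_algebra_isotope[OF c])
  note P = standard_basis_pol standard_basis_orthogonal[simplified doubleton_eq_iff]
    standard_basis_idem[unfolded idem_def]
  \<comment> \<open>The map on degrees exchanges the weights (1,0,0) and (-1,-1,-1) and fixes
    (0,1,0) and (0,0,1). Accordingly u1 and e1, and v1 and e2, trade places, u2 and v2 stay, and the
    isotope product makes the third pair -u3, -v3.\<close>
  let ?b = "I.std_basis_of (b (U 1)) (b E1) (b (U 2)) (b E2) (b (V 2))"
  have V1: "c - b (U 1) = b (V 1)" by (simp add: c_def)
  have VU: "pol (b (V i)) (b (U j)) = (if i = j then 1 else 0)" for i j
    using standard_basis_pol[of j i] by (simp add: pol_commute[of "b (V i)"])
  have E12: "pol (b E1) (b E2) = 1"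
    using standard_basis_idem(1) standard_basis_isotropic[of E1]
    by (simp add: idem_def pol_diff_right pol_self flip: standard_basis_compl(1))
  have O: "pol (b (U 1)) (b (U 1)) = 0" "pol (b E1) (b (U 1)) = 0" "pol (b E1) (b (V 1)) = 0"
    "pol (b (U 2)) (b (U 1)) = 0" "pol (b (U 2)) (b (V 1)) = 0" "pol (b E2) (b (U 1)) = 0"
    "pol (b E2) (b (V 1)) = 0" "pol (b (V 2)) (b (U 1)) = 0" "pol (b (V 2)) (b (V 1)) = 0"
    "pol (b E1) (b (V 2)) = 0" "pol (b (U 2)) (b E2) = 0"
    by (rule standard_basis_orthogonal; simp add: doubleton_eq_iff mod3_simps)+
  show ?thesis
  proof (rule degree_action_from_basis[OF _ _ c])
    show "standard_basis (isotope C c) ?b"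
    proof (rule I.standard_basis_of)
      show "I.idem (b (U 1))"
        unfolding I.idem_def using standard_basis_pol[of 1 1] standard_basis_isotropic
        by (simp add: c_def pol_add_right O)
      show "I.peirce (b (U 1)) (b E1)" "I.peirce (b (U 1)) (b (U 2))"
        unfolding I.peirce_def isotope_simps isotope_prod tri
        by (simp_all add: c_def prod_simps pol_add_right O table mod3_simps)
      show "I.peirce (vunit (isotope C c) - b (U 1)) (b E2)"
        "I.peirce (vunit (isotope C c) - b (U 1)) (b (V 2))"
        unfolding I.peirce_def isotope_simps isotope_prod tri V1
        by (simp_all add: c_def prod_simps pol_add_right O table mod3_simps)
    qed (simp_all add: E12 standard_basis_pol O)
    let ?p = "\<lambda>k. if k = E1 then U 1 else if k = U 1 then E1 else
      if k = E2 then V 1 else if k = V 1 then E2 else k"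
    show "\<forall>k. std_degree (?p k) = (case std_degree k of (x, y, z) \<Rightarrow> (- x, y - x, z - x))"
      unfolding all_std_index by (simp add: mod3_simps)
    show "\<forall>k. ?b k = b (?p k) \<or> ?b k = - b (?p k)"
      unfolding all_std_index I.std_basis_of_simps isotope_prod tri isotope_simps V1
      by (simp add: mod3_simps c_def prod_simps table)
  qed auto
qed

end

end

lemma pos_indices_cases:
  assumes "k \<in> pos_indices"
  obtains "k = E1" | "k = U 1" | "k = U 2" | "k = U 3"
  using assms by (auto simp: pos_indices_def)

lemma finite_pos_indices: "finite pos_indices"
  by (simp add: pos_indices_def)

context cayley_algebra
begin

lemma cartan_grading_eq:
  "cartan_grading C b (std_degree k) = span {b k}"
  "a \<notin> range std_degree \<Longrightarrow> cartan_grading C b a = {0}"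
proof -
  have "{l. l = k} = {k}" by blast
  then show "cartan_grading C b (std_degree k) = span {b k}" by (simp add: cartan_grading_def)
  assume "a \<notin> range std_degree"
  then have "{k. std_degree k = a} = {}" by blast
  then show "cartan_grading C b a = {0}" by (simp add: cartan_grading_def)
qed

context
  fixes b
  assumes b: "standard_basis C b"
begin

lemma span_basis_nonzero: "span {b k} \<noteq> {0}"
  using standard_basis_nonzero[OF b, of k] span_base[of "b k" "{b k}"] by auto

lemma cartan_components: "homogeneous_components Z3 (cartan_grading C b) = range (\<lambda>k. span {b k})"
proof (intro Set.set_eqI iffI)
  fix D assume "D \<in> homogeneous_components Z3 (cartan_grading C b)"
  then obtain a where a: "D = cartan_grading C b a" "cartan_grading C b a \<noteq> {0}"
    unfolding homogeneous_components_def by blast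
  then obtain k where "a = std_degree k" using cartan_grading_eq(2) by blast
  then show "D \<in> range (\<lambda>k. span {b k})" using a cartan_grading_eq(1) by simp
next
  fix D assume "D \<in> range (\<lambda>k. span {b k})"
  then obtain k where "D = span {b k}" by blast
  then have "D = cartan_grading C b (std_degree k)" "D \<noteq> {0}"
    by (simp_all only: cartan_grading_eq(1) span_basis_nonzero not_False_eq_True)
  then show "D \<in> homogeneous_components Z3 (cartan_grading C b)"
    unfolding homogeneous_components_def Z3_simps(1) by blast
qed

lemma carrier_weyl_group:
  "carrier (weyl_group C Z3 (cartan_grading C b)) =
    {(\<lambda>s. s \<circ> \<phi>) ` grading_Stab C Z3 (cartan_grading C b) | \<phi>. \<phi> \<in> grading_Aut C Z3 (cartan_grading C b)}"
proof -
  have B: "\<phi> \<in> Bij UNIV" if "\<phi> \<in> triple_aut C" for \<phi>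
    using triple_autD(2)[OF that] by (simp add: Bij_def)
  have "grading_Stab C Z3 (cartan_grading C b) #>\<^bsub>BijGroup UNIV\<lparr>carrier := grading_Aut C Z3 (cartan_grading C b)\<rparr>\<^esub> \<phi>
      = (\<lambda>s. s \<circ> \<phi>) ` grading_Stab C Z3 (cartan_grading C b)"
    if "\<phi> \<in> grading_Aut C Z3 (cartan_grading C b)" for \<phi>
  proof -
    have "\<phi> \<in> Bij UNIV" using that B unfolding grading_Aut_def by blast
    moreover have "s \<in> Bij UNIV" if "s \<in> grading_Stab C Z3 (cartan_grading C b)" for s
      using that B unfolding grading_Stab_def by blast
    ultimately show ?thesis
      unfolding r_coset_def BijGroup_def by (auto simp: compose_def comp_def restrict_UNIV)
  qed
  then show ?thesis
    unfolding weyl_group_def FactGroup_def RCOSETS_def by auto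
qed

text \<open>A coset contains its own representative because the identity is in the stabiliser;
  conversely, composing with stabilising maps does not change the action on components.\<close>

lemma weyl_on_degrees_iff:
  "\<omega> \<in> weyl_on_degrees C Z3 (cartan_grading C b) \<longleftrightarrow> degree_action b \<omega>"
proof
  have auto: "carrier (AutoGroup Z3) = {\<omega> \<in> hom Z3 Z3. bij \<omega>}"
    by (auto simp: AutoGroup_def auto_def Bij_def)
  assume "\<omega> \<in> weyl_on_degrees C Z3 (cartan_grading C b)"
  then obtain D where \<omega>: "\<omega> \<in> hom Z3 Z3" "bij \<omega>" and D: "D \<in> carrier (weyl_group C Z3 (cartan_grading C b))"
      "\<forall>\<phi>\<in>D. \<forall>a. cartan_grading C b a \<noteq> {0} \<longrightarrow> \<phi> ` cartan_grading C b a = cartan_grading C b (\<omega> a)"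
    unfolding weyl_on_degrees_def auto Z3_simps(1) by blast
  obtain \<phi> where \<phi>: "\<phi> \<in> grading_Aut C Z3 (cartan_grading C b)"
      "D = (\<lambda>s. s \<circ> \<phi>) ` grading_Stab C Z3 (cartan_grading C b)"
    using D(1) unfolding carrier_weyl_group by blast
  have "id \<in> grading_Stab C Z3 (cartan_grading C b)"
    using triple_aut_id(1) by (simp add: grading_Stab_def)
  then have "\<phi> \<in> D" using \<phi>(2) by (metis id_comp image_eqI)
  then have \<phi>k: "\<phi> ` span {b k} = cartan_grading C b (\<omega> (std_degree k))" for k
    using D(2) span_basis_nonzero[of k] by (metis cartan_grading_eq(1))
  have aut: "\<phi> \<in> triple_aut C" using \<phi>(1) by (simp add: grading_Aut_def)
  \<comment> \<open>A degree outside the support has a zero component, which is not the image of a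
    line under a bijection.\<close>
  have "\<exists>l. std_degree l = \<omega> (std_degree k)" for k
  proof (rule ccontr)
    assume "\<nexists>l. std_degree l = \<omega> (std_degree k)"
    then have "\<omega> (std_degree k) \<notin> range std_degree" by (metis rangeE)
    then have "\<phi> ` span {b k} = {0}" unfolding \<phi>k by (rule cartan_grading_eq(2))
    moreover have "b k \<in> span {b k}" by (rule span_base) simp
    ultimately have "\<phi> (b k) = 0" by blast
    then show False using triple_autD(7)[OF aut] standard_basis_nonzero[OF b] by simp
  qed
  then obtain \<pi> where "\<forall>k. std_degree (\<pi> k) = \<omega> (std_degree k)" by metis
  moreover from this have "\<forall>k. \<phi> ` span {b k} = span {b (\<pi> k)}"
    unfolding \<phi>k by (metis cartan_grading_eq(1))
  ultimately show "degree_action b \<omega>"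
    unfolding degree_action_def[OF b] using \<omega> aut by blast
next
  have auto: "carrier (AutoGroup Z3) = {\<omega> \<in> hom Z3 Z3. bij \<omega>}"
    by (auto simp: AutoGroup_def auto_def Bij_def)
  assume "degree_action b \<omega>"
  then obtain \<phi> \<pi> where \<omega>: "\<omega> \<in> hom Z3 Z3" "bij \<omega>" and aut: "\<phi> \<in> triple_aut C"
    and \<pi>: "\<And>k. std_degree (\<pi> k) = \<omega> (std_degree k)" "\<And>k. \<phi> ` span {b k} = span {b (\<pi> k)}"
    unfolding degree_action_def[OF b] by blast
  let ?H = "range (\<lambda>k. span {b k})"
  have fin: "finite ?H" using UNIV_std_index by (metis finite.emptyI finite_imageI finite_insert)
  have "bij_betw ((`) \<phi>) ?H ?H"
  proof -
    have "inj_on ((`) \<phi>) ?H"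
      using triple_autD(2)[OF aut] by (intro inj_onI) (simp add: bij_is_inj inj_image_eq_iff)
    moreover have "((`) \<phi>) ` ?H \<subseteq> ?H" using \<pi>(2) by auto
    ultimately show ?thesis
      using fin by (simp add: bij_betw_def endo_inj_surj)
  qed
  then have \<phi>: "\<phi> \<in> grading_Aut C Z3 (cartan_grading C b)"
    using aut by (simp add: grading_Aut_def cartan_components)
  define D where "D = (\<lambda>s. s \<circ> \<phi>) ` grading_Stab C Z3 (cartan_grading C b)"
  have "D \<in> carrier (weyl_group C Z3 (cartan_grading C b))"
    unfolding carrier_weyl_group D_def using \<phi> by blast
  moreover have "\<psi> ` cartan_grading C b a = cartan_grading C b (\<omega> a)"
    if \<psi>: "\<psi> \<in> D" and a: "cartan_grading C b a \<noteq> {0}" for \<psi> a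
  proof -
    obtain s where s: "\<psi> = s \<circ> \<phi>" "\<forall>D\<in>?H. s ` D = D"
      using \<psi> unfolding D_def grading_Stab_def cartan_components by blast
    obtain k where k: "a = std_degree k" using a cartan_grading_eq(2) by blast
    have "\<psi> ` span {b k} = s ` (\<phi> ` span {b k})" by (simp add: s(1) image_comp)
    also have "\<dots> = span {b (\<pi> k)}" unfolding \<pi>(2) using s(2) by blast
    finally show ?thesis unfolding k \<pi>(1)[symmetric] cartan_grading_eq(1) .
  qed
  ultimately show "\<omega> \<in> weyl_on_degrees C Z3 (cartan_grading C b)"
    unfolding weyl_on_degrees_def auto Z3_simps(1)
    by (intro CollectI conjI bexI[of _ D] ballI impI) (use \<omega> in simp_all)
qed

text \<open>The exchanges of neighbours in the list e1, u1, u2, u3 are the generators constructed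
  above; the other three transpositions are conjugates of these.\<close>

lemma degree_action_transpose:
  assumes "i \<in> pos_indices" "j \<in> pos_indices" "i \<noteq> j"
  shows "\<exists>\<omega>. degree_action b \<omega> \<and> (\<forall>k\<in>pos_indices. \<omega> (std_degree k) = std_degree (Transposition.transpose i j k))"
    (is "?P i j")
proof -
  note c = degree_action_comp[OF b]
  note w12 = degree_action_swap12[OF b] and w23 = degree_action_swap23[OF b] and w01 = degree_action_swap01[OF b]
  note w02 = c[OF w12 c[OF w01 w12]]
  have H: "?P i j" if "degree_action b \<omega>"
    "\<forall>k\<in>pos_indices. \<omega> (std_degree k) = std_degree (Transposition.transpose i j k)" for \<omega> i j
    using that by blast
  have "?P (U 1) (U 2)"
    by (rule H[OF w12])
      (simp add: pos_indices_def Transposition.transpose_def mod3_simps)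
  moreover have "?P (U 2) (U 3)"
    by (rule H[OF w23])
      (simp add: pos_indices_def Transposition.transpose_def mod3_simps)
  moreover have "?P (U 1) (U 3)"
    by (rule H[OF c[OF w12 c[OF w23 w12]]])
      (simp add: pos_indices_def Transposition.transpose_def mod3_simps)
  moreover have "?P E1 (U 1)"
    by (rule H[OF w01])
      (simp add: pos_indices_def Transposition.transpose_def mod3_simps)
  moreover have "?P E1 (U 2)"
    by (rule H[OF w02])
      (simp add: pos_indices_def Transposition.transpose_def mod3_simps)
  moreover have "?P E1 (U 3)"
    by (rule H[OF c[OF w23 c[OF w02 w23]]])
      (simp add: pos_indices_def Transposition.transpose_def mod3_simps)
  moreover have "?P k l \<Longrightarrow> ?P l k" for k l by (simp add: transpose_commute)
  ultimately show ?thesis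
    using assms by (elim pos_indices_cases[of i] pos_indices_cases[of j]) (hypsubst, assumption | simp)+
qed

lemma degree_action_permutes:
  assumes "p permutes pos_indices"
  shows "\<exists>\<omega>. degree_action b \<omega> \<and> (\<forall>k\<in>pos_indices. \<omega> (std_degree k) = std_degree (p k))"
  using assms finite_pos_indices
proof (induction rule: permutes_induct)
  case id
  show ?case by (rule exI[of _ id]) (simp add: degree_action_id[OF b, unfolded id_def] id_def)
next
  case (swap i j p)
  obtain \<omega> where \<omega>: "degree_action b \<omega>" "\<forall>k\<in>pos_indices. \<omega> (std_degree k) = std_degree (p k)"
    using swap by blast
  obtain \<tau> where \<tau>: "degree_action b \<tau>"
      "\<forall>k\<in>pos_indices. \<tau> (std_degree k) = std_degree (Transposition.transpose i j k)"
    using degree_action_transpose swap by blast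
  have "(\<tau> \<circ> \<omega>) (std_degree k) = std_degree ((Transposition.transpose i j \<circ> p) k)"
    if "k \<in> pos_indices" for k
    using \<omega>(2) \<tau>(2) that permutes_in_image[OF \<open>p permutes pos_indices\<close>] by simp
  then show ?case using degree_action_comp[OF b \<tau>(1) \<omega>(1)] by blast
qed

end

end

context cayley_group
begin

lemma hom_Z3_eqI:
  assumes "\<alpha> \<in> hom Z3 G" "\<beta> \<in> hom Z3 G"
    and "\<And>i. \<alpha> (std_degree (U i)) = \<beta> (std_degree (U i))"
  shows "\<alpha> = \<beta>"
proof
  fix x :: "int \<times> int \<times> int"
  obtain i j k where x: "x = (i, j, k)" by (cases x)
  have gen: "\<gamma> (i, j, k) = \<gamma> (1, 0, 0) [^] i \<otimes> \<gamma> (0, 1, 0) [^] j \<otimes> \<gamma> (0, 0, 1) [^] k"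
    if \<gamma>: "\<gamma> \<in> hom Z3 G" for \<gamma>
  proof -
    note D = hom_Z3D[OF \<gamma>]
    interpret Z: comm_group Z3 by (rule comm_group_Z3)
    have 1: "(\<lambda>m. \<gamma> (m, 0, 0)) \<in> hom integer_group G" "(\<lambda>m. \<gamma> (0, m, 0)) \<in> hom integer_group G"
      "(\<lambda>m. \<gamma> (0, 0, m)) \<in> hom integer_group G"
      using D(1) D(2)[of _ _ 0 0 0 0] D(2)[of 0 0 _ _ 0 0] D(2)[of 0 0 0 0 _ _]
      by (auto simp: hom_def)
    have pow: "f m = f 1 [^] m" if f: "f \<in> hom integer_group G" for f :: "int \<Rightarrow> 'g" and m
    proof -
      show ?thesis using hom_int_pow[OF f, of 1 m] by simp
    qed
    have "\<gamma> (i, j, k) = \<gamma> (i, 0, 0) \<otimes> \<gamma> (0, j, 0) \<otimes> \<gamma> (0, 0, k)"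
      using D(2)[of i 0 0 j 0 0] D(2)[of i 0 j 0 0 k] by simp
    then show ?thesis using 1[THEN pow, of i] 1[THEN pow, of j] 1[THEN pow, of k] by simp
  qed
  have "\<alpha> (1, 0, 0) = \<beta> (1, 0, 0)" "\<alpha> (0, 1, 0) = \<beta> (0, 1, 0)" "\<alpha> (0, 0, 1) = \<beta> (0, 0, 1)"
    using assms(3)[of 1] assms(3)[of 2] assms(3)[of 3] by (simp_all add: mod3_simps)
  then show "\<alpha> x = \<beta> x" unfolding x using gen assms(1,2) by metis
qed

text \<open>\<phi> maps b k, of degree \<alpha>(\<omega>(deg k)), into the line of
  \<open>b (\<pi> k)\<close>, whose degree under \<alpha> is the same. So \<phi> itself goes from
  the grading of \<open>\<alpha> \<circ> \<omega>\<close> to that of \<alpha>, and symmetry is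
  applied at the end.\<close>

lemma degree_action_grading_iso:
  assumes b: "standard_basis C b" and \<omega>: "degree_action b \<omega>"
  shows "grading_iso C G (Gamma_alpha C b \<alpha>) (Gamma_alpha C b (\<alpha> \<circ> \<omega>))"
proof -
  obtain \<phi> \<pi> where inj: "bij \<omega>" and aut: "\<phi> \<in> triple_aut C"
    and \<pi>: "\<And>k. std_degree (\<pi> k) = \<omega> (std_degree k)" "\<And>k. \<phi> ` span {b k} = span {b (\<pi> k)}"
    using \<omega> unfolding degree_action_def[OF b] by blast
  have "inj \<pi>" using \<pi>(1) inj by (metis bij_is_inj injD injI std_degree_inj)
  moreover have "finite (UNIV :: std_index set)" using UNIV_std_index by (metis finite.emptyI finite_insert)
  ultimately have surj: "surj \<pi>" by (simp add: finite_UNIV_inj_surj)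
  have in_span: "x \<in> span {b k} \<Longrightarrow> \<alpha> (std_degree k) = g \<Longrightarrow> x \<in> Gamma_alpha C b \<alpha> g" for x k g \<alpha>
    unfolding Gamma_alpha_eq using span_mono[of "{b k}" "b ` {k. \<alpha> (std_degree k) = g}"] by blast
  have "\<phi> ` Gamma_alpha C b (\<alpha> \<circ> \<omega>) g = Gamma_alpha C b \<alpha> g" for g
  proof
    have "\<phi> (b k) \<in> Gamma_alpha C b \<alpha> g" if "\<alpha> (\<omega> (std_degree k)) = g" for k
    proof (rule in_span)
      have "b k \<in> span {b k}" by (rule span_base) simp
      then show "\<phi> (b k) \<in> span {b (\<pi> k)}" using \<pi>(2) by blast
      show "\<alpha> (std_degree (\<pi> k)) = g" using that \<pi>(1) by simp
    qed
    then have "\<phi> ` b ` {k. (\<alpha> \<circ> \<omega>) (std_degree k) = g} \<subseteq> Gamma_alpha C b \<alpha> g" by auto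
    then show "\<phi> ` Gamma_alpha C b (\<alpha> \<circ> \<omega>) g \<subseteq> Gamma_alpha C b \<alpha> g"
      unfolding Gamma_alpha_eq triple_aut_span[OF aut] by (intro span_minimal subspace_span)
    have "b l \<in> \<phi> ` Gamma_alpha C b (\<alpha> \<circ> \<omega>) g" if l: "\<alpha> (std_degree l) = g" for l
    proof -
      obtain k where k: "l = \<pi> k" using surj by blast
      have "b l \<in> span {b l}" by (rule span_base) simp
      then obtain x where x: "x \<in> span {b k}" "b l = \<phi> x" using \<pi>(2)[of k] k by blast
      then have "x \<in> Gamma_alpha C b (\<alpha> \<circ> \<omega>) g" using l k \<pi>(1) by (intro in_span) simp_all
      then show ?thesis using x by blast
    qed
    then have "b ` {l. \<alpha> (std_degree l) = g} \<subseteq> \<phi> ` Gamma_alpha C b (\<alpha> \<circ> \<omega>) g" by blast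
    then show "Gamma_alpha C b \<alpha> g \<subseteq> \<phi> ` Gamma_alpha C b (\<alpha> \<circ> \<omega>) g"
      unfolding Gamma_alpha_eq triple_aut_span[OF aut] by (intro span_minimal subspace_span)
  qed
  then have "grading_iso C G (Gamma_alpha C b (\<alpha> \<circ> \<omega>)) (Gamma_alpha C b \<alpha>)"
    unfolding grading_iso_def using aut by blast
  then show ?thesis by (rule grading_iso_sym)
qed

end

section \<open>Isomorphic coarsenings of the Cartan grading\<close>

lemma opp_simps [simp]: "opp E1 = E2" "opp E2 = E1" "opp (U i) = V i" "opp (V i) = U i"
  by (simp_all add: opp_def)

lemma opp_opp [simp]: "opp (opp k) = k"
  by (cases k) simp_all

lemma pos_indices_iff: "k \<in> pos_indices \<longleftrightarrow> k = E1 \<or> (\<exists>i. k = U i)"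
  using exhaust_mod3 by (cases k) (auto simp: pos_indices_def)

lemma opp_in_pos: "opp k \<in> pos_indices \<longleftrightarrow> k \<notin> pos_indices"
  by (cases k) (auto simp: pos_indices_iff)

lemma fourth_weight:
  assumes "k1 \<in> pos_indices" "k2 \<in> pos_indices" "k3 \<in> pos_indices" "k1 \<noteq> k2" "k2 \<noteq> k3" "k1 \<noteq> k3"
  shows "\<exists>k0. pos_indices = {k0, k1, k2, k3} \<and> k0 \<notin> {k1, k2, k3} \<and> (\<forall>a a' a'' b b' b'' c c' c''.
      std_degree k1 = (a, b, c) \<longrightarrow> std_degree k2 = (a', b', c') \<longrightarrow> std_degree k3 = (a'', b'', c'') \<longrightarrow>
      std_degree k0 = (- (a + a' + a''), - (b + b' + b''), - (c + c' + c'')))" (is "\<exists>k0. ?P k0")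
proof -
  have "?P E1 \<or> ?P (U 1) \<or> ?P (U 2) \<or> ?P (U 3)"
    using assms(4-6)
    by (cases rule: pos_indices_cases[OF assms(1)]; cases rule: pos_indices_cases[OF assms(2)];
        cases rule: pos_indices_cases[OF assms(3)])
      (simp_all add: mod3_simps pos_indices_def insert_commute)
  then show ?thesis by blast
qed

context cayley_algebra
begin

lemma triple_span_nonzero:
  assumes "x \<in> span A" "y \<in> span B" "z \<in> span D" "tri x y z \<noteq> 0"
  shows "\<exists>a\<in>A. \<exists>b\<in>B. \<exists>d\<in>D. tri a b d \<noteq> 0"
proof (rule ccontr)
  assume no: "\<not> ?thesis"
  have S: "subspace {x. tri x y z = 0}" "subspace {y. tri x y z = 0}" "subspace {z. tri x y z = 0}" for x y z
    unfolding subspace_def by (auto simp: triple_add triple_scale)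
  have 1: "tri a b z = 0" if "a \<in> A" "b \<in> B" for a b
    using span_induct[OF assms(3) S(3)] no that by blast
  have 2: "tri a y z = 0" if "a \<in> A" for a
    using span_induct[OF assms(2) S(2)] 1 that by blast
  have "tri x y z = 0"
    using span_induct[OF assms(1) S(1)] 2 by blast
  then show False using assms(4) by blast
qed

context
  fixes b
  assumes b: "standard_basis C b"
begin

lemma basis_pol_zero:
  assumes "l \<noteq> opp k"
  shows "pol (b k) (b l) = 0"
  by (rule standard_basis_orthogonal[OF b])
    (use assms in \<open>cases k; cases l; auto simp: doubleton_eq_iff\<close>)+

lemma basis_conj: "cj (b E1) = b E2" "cj (b E2) = b E1" "cj (b (U i)) = - b (U i)" "cj (b (V i)) = - b (V i)"
  using idem_conj[OF standard_basis_idem(1)[OF b]] idem_conj[OF standard_basis_idem(2)[OF b]]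
    standard_basis_peirce[OF b, THEN peirce_conj] standard_basis_compl[OF b]
  by simp_all

lemma basis_prod_opposite_sign:
  assumes "k \<in> pos_indices \<longleftrightarrow> l \<notin> pos_indices" "l \<noteq> opp k"
  shows "b k \<odot> cj (b l) = 0"
  using assms by (cases k; cases l) (auto simp: pos_indices_iff basis_conj prod_minus_right standard_basis_table[OF b])

text \<open>Basis vectors are isotropic, and orthogonal unless opposite, so a repeated entry kills
  the triple. Entries of different sign and not opposite have zero product; orthogonality lets the
  last two entries trade places up to sign, which brings the third one next to the first.\<close>

lemma basis_triple_nonzero:
  assumes nz: "tri (b k1) (b k2) (b k3) \<noteq> 0" and opp: "k2 \<noteq> opp k1" "k3 \<noteq> opp k2" "k3 \<noteq> opp k1"
  shows "k1 \<noteq> k2" "k2 \<noteq> k3" "k1 \<noteq> k3" "k1 \<in> pos_indices \<longleftrightarrow> k2 \<in> pos_indices"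
    "k2 \<in> pos_indices \<longleftrightarrow> k3 \<in> pos_indices"
proof -
  note n = standard_basis_isotropic[OF b]
  show "k1 \<noteq> k2" using nz triple_left[of "b k1" "b k3"] n by auto
  show "k2 \<noteq> k3" using nz triple_right[of "b k1" "b k2"] n by auto
  show "k1 \<noteq> k3"
    using nz triple_outer[of "b k1" "b k2"] n basis_pol_zero[OF opp(1)] by auto
  have z: "tri (b k) (b l) x = 0" if "k \<in> pos_indices \<longleftrightarrow> l \<notin> pos_indices" "l \<noteq> opp k" for k l x
    using basis_prod_opposite_sign[OF that] by (simp add: triple_def)
  show 1: "k1 \<in> pos_indices \<longleftrightarrow> k2 \<in> pos_indices"
    using z[of k1 k2 "b k3"] opp nz by blast
  have "tri (b k1) (b k2) (b k3) = - tri (b k1) (b k3) (b k2)"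
    using triple_right_linearized[of "b k1" "b k2" "b k3"] basis_pol_zero[OF opp(2)]
    by (simp add: add_eq_0_iff2)
  then show "k2 \<in> pos_indices \<longleftrightarrow> k3 \<in> pos_indices"
    using z[of k1 k3 "b k2"] opp nz 1 by auto
qed

end

end

context cayley_group
begin

lemma hom_opp:
  assumes "\<alpha> \<in> hom Z3 G"
  shows "\<alpha> (std_degree (opp k)) = inv (\<alpha> (std_degree k))"
proof -
  obtain x y z where d: "std_degree k = (x, y, z)" by (cases "std_degree k")
  have "std_degree (opp k) = (- x, - y, - z)"
    using d by (cases k) (auto split: if_splits)
  then show ?thesis using hom_Z3D(4)[OF assms, of x y z] d by simp
qed

lemma Gamma_alpha_support:
  assumes b: "standard_basis C b"
  shows "(\<exists>x\<in>Gamma_alpha C b \<alpha> g. x \<noteq> 0) \<longleftrightarrow> g \<in> range (\<lambda>k. \<alpha> (std_degree k))"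
proof
  assume "\<exists>x\<in>Gamma_alpha C b \<alpha> g. x \<noteq> 0"
  then have "{k. \<alpha> (std_degree k) = g} \<noteq> {}" unfolding Gamma_alpha_eq by (metis image_empty span_empty singletonD)
  then show "g \<in> range (\<lambda>k. \<alpha> (std_degree k))" by blast
next
  assume "g \<in> range (\<lambda>k. \<alpha> (std_degree k))"
  then obtain k where "\<alpha> (std_degree k) = g" by blast
  then have "b k \<in> Gamma_alpha C b \<alpha> g" unfolding Gamma_alpha_eq by (intro span_base) blast
  then show "\<exists>x\<in>Gamma_alpha C b \<alpha> g. x \<noteq> 0" using standard_basis_nonzero[OF b] by blast
qed

definition pos_mset :: "(int \<times> int \<times> int \<Rightarrow> 'g) \<Rightarrow> 'g multiset" where
  "pos_mset \<alpha> = image_mset (\<lambda>k. \<alpha> (std_degree k)) (mset_set pos_indices)"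

lemma pos_mset_eq: "pos_mset \<alpha> = {#\<alpha> (std_degree E1), \<alpha> (std_degree (U 1)), \<alpha> (std_degree (U 2)), \<alpha> (std_degree (U 3))#}"
  unfolding pos_mset_def pos_indices_def by (simp add: mod3_simps del: std_degree.simps)

lemma fourth_value:
  assumes \<alpha>: "\<alpha> \<in> hom Z3 G"
    and k: "k1 \<in> pos_indices" "k2 \<in> pos_indices" "k3 \<in> pos_indices" "k1 \<noteq> k2" "k2 \<noteq> k3" "k1 \<noteq> k3"
  defines "v \<equiv> \<lambda>k. \<alpha> (std_degree k)"
  shows "pos_mset \<alpha> = {#inv (v k1 \<otimes> v k2 \<otimes> v k3), v k1, v k2, v k3#}"
proof -
  obtain x1 y1 z1 x2 y2 z2 x3 y3 z3 where d: "std_degree k1 = (x1, y1, z1)"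
      "std_degree k2 = (x2, y2, z2)" "std_degree k3 = (x3, y3, z3)"
    by (metis surj_pair)
  obtain k0 where k0: "pos_indices = {k0, k1, k2, k3}" "k0 \<notin> {k1, k2, k3}"
      "std_degree k0 = (- (x1 + x2 + x3), - (y1 + y2 + y3), - (z1 + z2 + z3))"
    using fourth_weight[OF k] d by metis
  have "v k0 = inv (v k1 \<otimes> v k2 \<otimes> v k3)"
    unfolding v_def k0(3) d hom_Z3D(4)[OF \<alpha>] hom_Z3D(2)[OF \<alpha>] ..
  then show ?thesis
    unfolding pos_mset_def k0(1) using k0(2) k by (simp add: v_def)
qed

text \<open>Equal multisets of values over the same index set differ by a permutation of the four
  weights, and this permutation is realised in the Weyl group. Agreement on the weights of u1, u2,
  u3, which generate the lattice, gives equality of the homomorphisms; a common inversion is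
  absorbed by \<open>degree_action_neg\<close>.\<close>

lemma degree_action_from_mset:
  assumes b: "standard_basis C b" and \<alpha>: "\<alpha> \<in> hom Z3 G" "\<alpha>' \<in> hom Z3 G"
    and eq: "pos_mset \<alpha>' = pos_mset \<alpha> \<or> pos_mset \<alpha>' = image_mset (\<lambda>g. inv g) (pos_mset \<alpha>)"
  shows "\<exists>\<omega>. degree_action b \<omega> \<and> \<alpha>' = \<alpha> \<circ> \<omega>"
proof -
  have fin: "finite pos_indices" by (rule finite_pos_indices)
  have U: "U i \<in> pos_indices" for i by (simp add: pos_indices_iff)
  have hom: "\<alpha> \<circ> \<omega> \<in> hom Z3 G" if "degree_action b \<omega>" for \<omega>
  proof (rule homI)
    fix x y
    have "\<omega> (x \<otimes>\<^bsub>Z3\<^esub> y) = \<omega> x \<otimes>\<^bsub>Z3\<^esub> \<omega> y"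
      using that hom_mult[of \<omega> Z3 Z3 x y] unfolding degree_action_def[OF b] Z3_simps(1) by blast
    then show "(\<alpha> \<circ> \<omega>) (x \<otimes>\<^bsub>Z3\<^esub> y) = (\<alpha> \<circ> \<omega>) x \<otimes> (\<alpha> \<circ> \<omega>) y"
      using hom_mult[OF \<alpha>(1), of "\<omega> x" "\<omega> y"] by simp
  qed (simp add: hom_Z3D(1)[OF \<alpha>(1)])
  from eq show ?thesis
  proof
    assume "pos_mset \<alpha>' = pos_mset \<alpha>"
    then obtain p where p: "p permutes pos_indices"
        "\<forall>k\<in>pos_indices. \<alpha>' (std_degree k) = \<alpha> (std_degree (p k))"
      unfolding pos_mset_def by (rule image_mset_eq_implies_permutes[OF fin])
    obtain \<omega> where \<omega>: "degree_action b \<omega>" "\<forall>k\<in>pos_indices. \<omega> (std_degree k) = std_degree (p k)"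
      using degree_action_permutes[OF b p(1)] by blast
    have "\<alpha>' = \<alpha> \<circ> \<omega>"
      by (rule hom_Z3_eqI[OF \<alpha>(2) hom[OF \<omega>(1)]]) (use p(2) \<omega>(2) U in \<open>simp del: std_degree.simps\<close>)
    then show ?thesis using \<omega>(1) by blast
  next
    let ?n = "\<lambda>(x, y, z). (- x, - y, - z) :: int \<times> int \<times> int"
    assume "pos_mset \<alpha>' = image_mset (\<lambda>g. inv g) (pos_mset \<alpha>)"
    then have "image_mset (\<lambda>k. \<alpha>' (std_degree k)) (mset_set pos_indices)
        = image_mset (\<lambda>k. inv (\<alpha> (std_degree k))) (mset_set pos_indices)"
      by (simp add: pos_mset_def multiset.map_comp comp_def)
    then obtain p where p: "p permutes pos_indices"
        "\<forall>k\<in>pos_indices. \<alpha>' (std_degree k) = inv (\<alpha> (std_degree (p k)))"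
      by (rule image_mset_eq_implies_permutes[OF fin])
    obtain \<omega> where \<omega>: "degree_action b \<omega>" "\<forall>k\<in>pos_indices. \<omega> (std_degree k) = std_degree (p k)"
      using degree_action_permutes[OF b p(1)] by blast
    have n: "degree_action b (?n \<circ> \<omega>)"
      by (rule degree_action_comp[OF b degree_action_neg[OF b] \<omega>(1)])
    have neg: "\<alpha> (?n x) = inv (\<alpha> x)" for x
      using hom_Z3D(4)[OF \<alpha>(1)] by (cases x) simp
    have "\<alpha>' = \<alpha> \<circ> (?n \<circ> \<omega>)"
    proof (rule hom_Z3_eqI[OF \<alpha>(2) hom[OF n]])
      fix i
      have "(\<alpha> \<circ> (?n \<circ> \<omega>)) (std_degree (U i)) = \<alpha> (?n (std_degree (p (U i))))"
        unfolding comp_apply using \<omega>(2) U by metis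
      then show "\<alpha>' (std_degree (U i)) = (\<alpha> \<circ> (?n \<circ> \<omega>)) (std_degree (U i))"
        unfolding neg using p(2) U by metis
    qed
    then show ?thesis using n by blast
  qed
qed

text \<open>The image of the nonzero product of \<open>b (U 1)\<close>, \<open>b (U 2)\<close>, \<open>b (U 3)\<close> involves a nonzero product
  of three basis elements of the same degrees. If no two of these have opposite weights, then the
  weights all have the same sign, and they determine the fourth one.\<close>

lemma pos_mset_from_iso:
  assumes b: "standard_basis C b" and \<alpha>: "\<alpha> \<in> hom Z3 G" "\<alpha>' \<in> hom Z3 G"
    and iso: "grading_iso C G (Gamma_alpha C b \<alpha>) (Gamma_alpha C b \<alpha>')"
    and np: "\<And>i j. i \<noteq> j \<Longrightarrow> \<alpha> (std_degree (U i)) \<otimes> \<alpha> (std_degree (U j)) \<noteq> \<one>"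
  shows "pos_mset \<alpha> = pos_mset \<alpha>' \<or> pos_mset \<alpha> = image_mset (\<lambda>g. inv g) (pos_mset \<alpha>')"
proof -
  obtain \<phi> where \<phi>: "\<phi> \<in> triple_aut C"
      "\<And>g. g \<in> carrier G \<Longrightarrow> \<phi> ` Gamma_alpha C b \<alpha> g = Gamma_alpha C b \<alpha>' g"
    using iso unfolding grading_iso_def by blast
  define v v' where "v k = \<alpha> (std_degree k)" and "v' k = \<alpha>' (std_degree k)" for k
  have vc: "v k \<in> carrier G" "v' k \<in> carrier G" for k
    using hom_Z3D(1)[OF \<alpha>(1)] hom_Z3D(1)[OF \<alpha>(2)] by (simp_all add: v_def v'_def)
  have in_span: "\<phi> (b (U i)) \<in> span (b ` {k. v' k = v (U i)})" for i
  proof -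
    have "b (U i) \<in> Gamma_alpha C b \<alpha> (v (U i))"
      unfolding Gamma_alpha_eq v_def by (intro span_base) blast
    then show ?thesis using \<phi>(2)[OF vc(1)] unfolding Gamma_alpha_eq[of b \<alpha>'] v'_def by blast
  qed
  have "tri (b (U 1)) (b (U 2)) (b (U 3)) = b E2"
    by (simp add: triple_def basis_conj[OF b] prod_minus_left prod_minus_right standard_basis_table[OF b])
  then have "tri (\<phi> (b (U 1))) (\<phi> (b (U 2))) (\<phi> (b (U 3))) \<noteq> 0"
    using triple_autD(3)[OF \<phi>(1)] triple_autD(7)[OF \<phi>(1)] standard_basis_nonzero[OF b] by metis
  then obtain k1 k2 k3 where k: "v' k1 = v (U 1)" "v' k2 = v (U 2)" "v' k3 = v (U 3)"
      and nz: "tri (b k1) (b k2) (b k3) \<noteq> 0"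
    using triple_span_nonzero[OF in_span in_span in_span] by blast
  have opp: "l \<noteq> opp m" if "v' m = v (U i)" "v' l = v (U j)" "i \<noteq> j" for l m i j
  proof
    assume "l = opp m"
    then have "v (U i) \<otimes> v (U j) = \<one>"
      using that vc hom_opp[OF \<alpha>(2), of m] by (metis v'_def G.r_inv)
    then show False using np[OF that(3)] by (simp add: v_def)
  qed
  note K = basis_triple_nonzero[OF b nz opp[OF k(1,2)] opp[OF k(2,3)] opp[OF k(1,3)]]
  have K': "k1 \<noteq> k2" "k2 \<noteq> k3" "k1 \<noteq> k3" "k1 \<in> pos_indices \<longleftrightarrow> k2 \<in> pos_indices"
    "k2 \<in> pos_indices \<longleftrightarrow> k3 \<in> pos_indices"
    using K by (simp_all add: mod3_simps)
  have U: "U i \<in> pos_indices" for i by (simp add: pos_indices_iff)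
  have M: "pos_mset \<alpha> = {#inv (v' k1 \<otimes> v' k2 \<otimes> v' k3), v' k1, v' k2, v' k3#}"
    using fourth_value[OF \<alpha>(1) U U U, of 1 2 3] unfolding k v_def by (simp add: mod3_simps)
  show ?thesis
  proof (cases "k1 \<in> pos_indices")
    case True
    then have "pos_mset \<alpha>' = {#inv (v' k1 \<otimes> v' k2 \<otimes> v' k3), v' k1, v' k2, v' k3#}"
      unfolding v'_def using K' by (intro fourth_value[OF \<alpha>(2)]) simp_all
    then show ?thesis using M by simp
  next
    case False
    \<comment> \<open>All three weights are negative here: \<open>fourth_value\<close> applies to
      their opposites, which inverts all the values.\<close>
    have vo: "v' (opp k) = inv (v' k)" for k using hom_opp[OF \<alpha>(2)] by (simp add: v'_def)
    have "opp k1 \<in> pos_indices" "opp k2 \<in> pos_indices" "opp k3 \<in> pos_indices"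
      using False K' by (simp_all add: opp_in_pos)
    moreover have "opp k1 \<noteq> opp k2" "opp k2 \<noteq> opp k3" "opp k1 \<noteq> opp k3"
      using K' by (metis opp_opp)+
    ultimately have "pos_mset \<alpha>' = {#inv (v' (opp k1) \<otimes> v' (opp k2) \<otimes> v' (opp k3)),
        v' (opp k1), v' (opp k2), v' (opp k3)#}"
      unfolding v'_def by (intro fourth_value[OF \<alpha>(2)])
    then have "image_mset (\<lambda>g. inv g) (pos_mset \<alpha>') = pos_mset \<alpha>"
      unfolding M vo using vc by (simp add: G.inv_mult)
    then show ?thesis by simp
  qed
qed

text \<open>The four weights add up to zero, so when the values at two of them cancel, so do the
  values at the other two.\<close>

lemma inverse_pair:
  assumes \<alpha>: "\<alpha> \<in> hom Z3 G" and ij: "i \<noteq> j" "\<alpha> (std_degree (U i)) \<otimes> \<alpha> (std_degree (U j)) = \<one>"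
  shows "\<exists>x\<in>carrier G. \<exists>y\<in>carrier G. pos_mset \<alpha> = {#x, inv x, y, inv y#} \<and>
    range (\<lambda>k. \<alpha> (std_degree k)) = {x, inv x, y, inv y}"
proof -
  define v where "v k = \<alpha> (std_degree k)" for k
  have vc: "v k \<in> carrier G" for k using hom_Z3D(1)[OF \<alpha>] by (simp add: v_def)
  obtain l where l: "l \<noteq> i" "l \<noteq> j"
  proof -
    have "\<exists>l. l \<noteq> i \<and> l \<noteq> j"
      using exhaust_mod3[of i] exhaust_mod3[of j] mod3_simps by metis
    then show thesis using that by blast
  qed
  have "v (U j) \<otimes> v (U i) = \<one>" using ij vc G.m_comm by (metis v_def)
  then have vj: "v (U j) = inv (v (U i))" using vc by (simp add: G.inv_equality)
  have U: "U m \<in> pos_indices" for m by (simp add: pos_indices_iff)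
  have "pos_mset \<alpha> = {#inv (v (U i) \<otimes> v (U j) \<otimes> v (U l)), v (U i), v (U j), v (U l)#}"
    unfolding v_def using ij l by (intro fourth_value[OF \<alpha> U U U]) auto
  then have M: "pos_mset \<alpha> = {#v (U i), inv (v (U i)), v (U l), inv (v (U l))#}"
    using vc vj by simp
  have "range v = set_mset (pos_mset \<alpha>) \<union> (\<lambda>g. inv g) ` set_mset (pos_mset \<alpha>)"
  proof -
    have sp: "set_mset (pos_mset \<alpha>) = v ` pos_indices"
      by (simp add: pos_mset_def pos_indices_def v_def)
    have vo: "v (opp k) = inv (v k)" for k using hom_opp[OF \<alpha>] by (simp add: v_def)
    have "UNIV = pos_indices \<union> opp ` pos_indices"
      using opp_in_pos by (metis UNIV_eq_I Un_iff image_eqI opp_opp)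
    then have "range v = v ` pos_indices \<union> (\<lambda>k. v (opp k)) ` pos_indices"
      by (metis image_Un image_image)
    then show ?thesis unfolding sp vo by (simp add: image_image)
  qed
  then have "range v = {v (U i), inv (v (U i)), v (U l), inv (v (U l))}"
    unfolding M using vc by auto
  then show ?thesis using M vc unfolding v_def by blast
qed

text \<open>\<open>pos_mset_from_iso\<close> needs a source in which no two of the degrees of u1,
  u2, u3 cancel. It is applied to the isomorphism or to its inverse, unless both sides have a
  cancelling pair.\<close>

lemma Gamma_alpha_iso_iff:
  assumes b: "standard_basis C b" and \<alpha>: "\<alpha> \<in> hom Z3 G" "\<alpha>' \<in> hom Z3 G"
  shows "grading_iso C G (Gamma_alpha C b \<alpha>) (Gamma_alpha C b \<alpha>') \<longleftrightarrow>
    (\<exists>\<omega>\<in>weyl_on_degrees C Z3 (cartan_grading C b). \<alpha>' = \<alpha> \<circ> \<omega>)"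
proof
  assume "\<exists>\<omega>\<in>weyl_on_degrees C Z3 (cartan_grading C b). \<alpha>' = \<alpha> \<circ> \<omega>"
  then show "grading_iso C G (Gamma_alpha C b \<alpha>) (Gamma_alpha C b \<alpha>')"
    unfolding Bex_def weyl_on_degrees_iff[OF b] using degree_action_grading_iso[OF b] by blast
next
  assume iso: "grading_iso C G (Gamma_alpha C b \<alpha>) (Gamma_alpha C b \<alpha>')"
  have invinv: "image_mset (\<lambda>g. inv g) (image_mset (\<lambda>g. inv g) (pos_mset \<beta>)) = pos_mset \<beta>"
    if "\<beta> \<in> hom Z3 G" for \<beta>
    using hom_Z3D(1)[OF that] by (simp add: pos_mset_eq del: std_degree.simps)
  have "pos_mset \<alpha>' = pos_mset \<alpha> \<or> pos_mset \<alpha>' = image_mset (\<lambda>g. inv g) (pos_mset \<alpha>)"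
  proof (cases "\<exists>i j. i \<noteq> j \<and> \<alpha> (std_degree (U i)) \<otimes> \<alpha> (std_degree (U j)) = \<one>")
    case False
    then show ?thesis using pos_mset_from_iso[OF b \<alpha> iso] invinv[OF \<alpha>(2)] by metis
  next
    case pair: True
    \<comment> \<open>When both sides have inverse pairs, the supports alone determine the multisets.\<close>
    show ?thesis
    proof (cases "\<exists>i j. i \<noteq> j \<and> \<alpha>' (std_degree (U i)) \<otimes> \<alpha>' (std_degree (U j)) = \<one>")
      case False
      then show ?thesis using pos_mset_from_iso[OF b \<alpha>(2,1) grading_iso_sym[OF iso]] by blast
    next
      case True
      obtain x y where x: "x \<in> carrier G" "y \<in> carrier G" "pos_mset \<alpha> = {#x, inv x, y, inv y#}"
          "range (\<lambda>k. \<alpha> (std_degree k)) = {x, inv x, y, inv y}"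
        using inverse_pair[OF \<alpha>(1)] pair by metis
      obtain x' y' where x': "x' \<in> carrier G" "y' \<in> carrier G" "pos_mset \<alpha>' = {#x', inv x', y', inv y'#}"
          "range (\<lambda>k. \<alpha>' (std_degree k)) = {x', inv x', y', inv y'}"
        using inverse_pair[OF \<alpha>(2)] True by metis
      have "range (\<lambda>k. \<alpha> (std_degree k)) = range (\<lambda>k. \<alpha>' (std_degree k))"
      proof (intro Set.set_eqI iffI)
        fix g assume g: "g \<in> range (\<lambda>k. \<alpha> (std_degree k))"
        then have "g \<in> carrier G" using hom_Z3D(1)[OF \<alpha>(1)] by blast
        then show "g \<in> range (\<lambda>k. \<alpha>' (std_degree k))"
          using g grading_iso_transfer[OF iso] unfolding Gamma_alpha_support[OF b, symmetric] by blast
      next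
        fix g assume g: "g \<in> range (\<lambda>k. \<alpha>' (std_degree k))"
        then have "g \<in> carrier G" using hom_Z3D(1)[OF \<alpha>(2)] by blast
        then show "g \<in> range (\<lambda>k. \<alpha> (std_degree k))"
          using g grading_iso_transfer[OF grading_iso_sym[OF iso]]
          unfolding Gamma_alpha_support[OF b, symmetric] by blast
      qed
      then have eq: "{x, inv x, y, inv y} = {x', inv x', y', inv y'}" using x(4) x'(4) by simp
      have pm: "{#x', inv x', y', inv y'#} = {#x, inv x, y, inv y#}"
        if "{x', inv x'} = {x, inv x}" "{y', inv y'} = {y, inv y}" for x x' y y'
        using that by (auto simp: doubleton_eq_iff add_mset_commute)
      have dbl: "u \<in> {w, inv w} \<Longrightarrow> {u, inv u} = {w, inv w}" if "w \<in> carrier G" for u w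
        using that by auto
      have ux: "x' \<in> {x, inv x} \<or> x' \<in> {y, inv y}" and uy: "y' \<in> {x, inv x} \<or> y' \<in> {y, inv y}"
        and vx: "x \<in> {x', inv x'} \<or> x \<in> {y', inv y'}" and vy: "y \<in> {x', inv x'} \<or> y \<in> {y', inv y'}"
        using eq by blast+
      \<comment> \<open>The sets {g, inv g} partition the group, so pairs with a common element
        coincide. Since the unions agree, each class on one side occurs on the other, which gives
        the matching; if all pairs coincide, either one works.\<close>
      have "{x', inv x'} = {x, inv x} \<and> {y', inv y'} = {y, inv y} \<or>
          {x', inv x'} = {y, inv y} \<and> {y', inv y'} = {x, inv x}"
        using ux[THEN disjE] dbl[OF x(1), of x'] dbl[OF x(2), of x'] dbl[OF x(1), of y'] dbl[OF x(2), of y']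
          dbl[OF x'(1), of x] dbl[OF x'(2), of x] dbl[OF x'(1), of y] dbl[OF x'(2), of y] ux uy vx vy
        by metis
      then have "pos_mset \<alpha>' = pos_mset \<alpha>"
        unfolding x(3) x'(3) using pm[of x' x y' y] pm[of x' y y' x] by (auto simp: add_mset_commute)
      then show ?thesis ..
    qed
  qed
  then obtain \<omega> where "degree_action b \<omega>" "\<alpha>' = \<alpha> \<circ> \<omega>"
    using degree_action_from_mset[OF b \<alpha>] by blast
  then show "\<exists>\<omega>\<in>weyl_on_degrees C Z3 (cartan_grading C b). \<alpha>' = \<alpha> \<circ> \<omega>"
    using weyl_on_degrees_iff[OF b] by blast
qed

end

text \<open>Quantifying over all standard and Cayley-Dickson bases shows that nothing depends on
  their choice; the two existence claims keep this from being vacuous.\<close>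

theorem theorem4p9:
  fixes C :: "('f::alg_closed_field, 'c::ab_group_add) quad_algebra"
    and G :: "('g, 'm) monoid_scheme"
  assumes "cayley_algebra C" and "(2::'f) \<noteq> 0" and "comm_group G"
  shows "(\<exists>b. standard_basis C b) \<and> (\<exists>w. cd_basis C w) \<and>
    (\<forall>b w. standard_basis C b \<longrightarrow> cd_basis C w \<longrightarrow>
      (\<forall>\<Gamma>. is_grading C G \<Gamma> \<longrightarrow>
          (\<exists>\<alpha>\<in>hom Z3 G. grading_iso C G \<Gamma> (Gamma_alpha C b \<alpha>)) \<or>
          (\<exists>H. elementary_2_subgroup G H 3 \<and> (\<exists>\<Delta>\<in>Gamma_H C w G H. grading_iso C G \<Gamma> \<Delta>)) \<or>
          (\<exists>H K. elementary_2_subgroup G H 4 \<and> index_2_subgroup G H K \<and>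
             (\<exists>\<Delta>\<in>Gamma_HK C w G H K. grading_iso C G \<Gamma> \<Delta>))) \<and>
      (\<forall>\<alpha>\<in>hom Z3 G. \<forall>H. elementary_2_subgroup G H 3 \<longrightarrow>
          (\<forall>\<Delta>\<in>Gamma_H C w G H. \<not> grading_iso C G (Gamma_alpha C b \<alpha>) \<Delta>)) \<and>
      (\<forall>\<alpha>\<in>hom Z3 G. \<forall>H K. elementary_2_subgroup G H 4 \<longrightarrow> index_2_subgroup G H K \<longrightarrow>
          (\<forall>\<Delta>\<in>Gamma_HK C w G H K. \<not> grading_iso C G (Gamma_alpha C b \<alpha>) \<Delta>)) \<and>
      (\<forall>H H' K'. elementary_2_subgroup G H 3 \<longrightarrow>
          elementary_2_subgroup G H' 4 \<longrightarrow> index_2_subgroup G H' K' \<longrightarrow>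
          (\<forall>\<Delta>\<in>Gamma_H C w G H. \<forall>\<Delta>'\<in>Gamma_HK C w G H' K'. \<not> grading_iso C G \<Delta> \<Delta>')) \<and>
      (\<forall>\<alpha>\<in>hom Z3 G. \<forall>\<alpha>'\<in>hom Z3 G.
          grading_iso C G (Gamma_alpha C b \<alpha>) (Gamma_alpha C b \<alpha>') \<longleftrightarrow>
          (\<exists>\<omega>\<in>weyl_on_degrees C Z3 (cartan_grading C b). \<alpha>' = \<alpha> \<circ> \<omega>)) \<and>
      (\<forall>H H'. elementary_2_subgroup G H 3 \<longrightarrow> elementary_2_subgroup G H' 3 \<longrightarrow>
          (\<forall>\<Delta>\<in>Gamma_H C w G H. \<forall>\<Delta>'\<in>Gamma_H C w G H'.
             grading_iso C G \<Delta> \<Delta>' \<longleftrightarrow> H = H')) \<and>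
      (\<forall>H K H' K'.
          elementary_2_subgroup G H 4 \<longrightarrow> index_2_subgroup G H K \<longrightarrow>
          elementary_2_subgroup G H' 4 \<longrightarrow> index_2_subgroup G H' K' \<longrightarrow>
          (\<forall>\<Delta>\<in>Gamma_HK C w G H K. \<forall>\<Delta>'\<in>Gamma_HK C w G H' K'.
             grading_iso C G \<Delta> \<Delta>' \<longleftrightarrow> H = H' \<and> K = K')))"
proof -
  interpret cayley_group C G
    by (intro cayley_group.intro assms)
  note two = assms(2)
  have sqrt: "\<exists>r. r\<^sup>2 = a" for a :: 'f by (rule alg_closed_has_square_root)
  show ?thesis
  proof (intro conjI allI impI)
    show "\<exists>b. standard_basis C b" "\<exists>w. cd_basis C w"
      using standard_basis_exists cd_basis_exists assms(1,2) by blast+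
    fix b w assume b: "standard_basis C b" and w: "cd_basis C w"
    show "(\<exists>\<alpha>\<in>hom Z3 G. grading_iso C G \<Gamma> (Gamma_alpha C b \<alpha>)) \<or>
          (\<exists>H. elementary_2_subgroup G H 3 \<and> (\<exists>\<Delta>\<in>Gamma_H C w G H. grading_iso C G \<Gamma> \<Delta>)) \<or>
          (\<exists>H K. elementary_2_subgroup G H 4 \<and> index_2_subgroup G H K \<and>
             (\<exists>\<Delta>\<in>Gamma_HK C w G H K. grading_iso C G \<Gamma> \<Delta>))"
      if "is_grading C G \<Gamma>" for \<Gamma>
      using grading_classification[OF two sqrt b w that] .
    show "\<forall>\<alpha>\<in>hom Z3 G. \<forall>H. elementary_2_subgroup G H 3 \<longrightarrow>
        (\<forall>\<Delta>\<in>Gamma_H C w G H. \<not> grading_iso C G (Gamma_alpha C b \<alpha>) \<Delta>)"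
    proof (intro ballI allI impI)
      fix \<alpha> H \<Delta>
      assume \<alpha>: "\<alpha> \<in> hom Z3 G" and H: "elementary_2_subgroup G H 3" "\<Delta> \<in> Gamma_H C w G H"
      obtain h1 h2 h3 where "G.cd_gens H h1 h2 h3"
          "\<And>\<Gamma>. grading_iso C G \<Gamma> \<Delta> \<longleftrightarrow>
            grading_iso C G \<Gamma> (\<lambda>g. cd_grading C w G h1 h2 h3 (inv\<^bsub>G\<^esub> \<one>\<^bsub>G\<^esub> \<otimes>\<^bsub>G\<^esub> g))"
        using Gamma_HE[OF H] by metis
      then show "\<not> grading_iso C G (Gamma_alpha C b \<alpha>) \<Delta>"
        using Gamma_alpha_not_shifted[OF two w b _ \<alpha>] by metis
    qed
    show "\<forall>\<alpha>\<in>hom Z3 G. \<forall>H K. elementary_2_subgroup G H 4 \<longrightarrow> index_2_subgroup G H K \<longrightarrow>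
        (\<forall>\<Delta>\<in>Gamma_HK C w G H K. \<not> grading_iso C G (Gamma_alpha C b \<alpha>) \<Delta>)"
    proof (intro ballI allI impI)
      fix \<alpha> H K \<Delta>
      assume \<alpha>: "\<alpha> \<in> hom Z3 G"
        and H: "elementary_2_subgroup G H 4" "index_2_subgroup G H K" "\<Delta> \<in> Gamma_HK C w G H K"
      obtain s h1 h2 h3 where "G.cd_gens K h1 h2 h3"
          "\<Delta> = (\<lambda>g. cd_grading C w G h1 h2 h3 (inv\<^bsub>G\<^esub> s \<otimes>\<^bsub>G\<^esub> g))"
        by (rule Gamma_HKE[OF H])
      then show "\<not> grading_iso C G (Gamma_alpha C b \<alpha>) \<Delta>"
        using Gamma_alpha_not_shifted[OF two w b _ \<alpha>] by metis
    qed
    show "\<forall>\<Delta>\<in>Gamma_H C w G H. \<forall>\<Delta>'\<in>Gamma_HK C w G H' K'. \<not> grading_iso C G \<Delta> \<Delta>'"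
      if "elementary_2_subgroup G H 3" "elementary_2_subgroup G H' 4" "index_2_subgroup G H' K'"
      for H H' K'
      by (intro ballI Gamma_H_not_iso_Gamma_HK[OF two w that(1) _ that(2,3)])
    show "\<forall>\<alpha>\<in>hom Z3 G. \<forall>\<alpha>'\<in>hom Z3 G.
        grading_iso C G (Gamma_alpha C b \<alpha>) (Gamma_alpha C b \<alpha>') \<longleftrightarrow>
        (\<exists>\<omega>\<in>weyl_on_degrees C Z3 (cartan_grading C b). \<alpha>' = \<alpha> \<circ> \<omega>)"
      by (intro ballI Gamma_alpha_iso_iff[OF b])
    show "\<forall>\<Delta>\<in>Gamma_H C w G H. \<forall>\<Delta>'\<in>Gamma_H C w G H'. grading_iso C G \<Delta> \<Delta>' \<longleftrightarrow> H = H'"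
      if "elementary_2_subgroup G H 3" "elementary_2_subgroup G H' 3" for H H'
      by (intro ballI Gamma_H_iso_iff[OF two sqrt w that(1) _ that(2)])
    show "\<forall>\<Delta>\<in>Gamma_HK C w G H K. \<forall>\<Delta>'\<in>Gamma_HK C w G H' K'.
        grading_iso C G \<Delta> \<Delta>' \<longleftrightarrow> H = H' \<and> K = K'"
      if "elementary_2_subgroup G H 4" "index_2_subgroup G H K"
        "elementary_2_subgroup G H' 4" "index_2_subgroup G H' K'" for H K H' K'
      by (intro ballI Gamma_HK_iso_iff[OF two sqrt w that(1,2) _ that(3,4)])
  qed
qed

end
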